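(* Let $\nu,\mu\in\mathbb{C}$ with $\operatorname{Re}\nu<1$ and $\operatorname{Re}\mu<\min[1-\operatorname{Re}\nu,\,2+\operatorname{Re}\nu]$. Let $x>0$, let $y>0$ (so that $|\arg y|<\pi$), and let $p\in\mathbb{C}$ with $\operatorname{Re}p>0$. Then $$ \begin{aligned} &p^{-1/2}\exp\left(\tfrac12 p(y-x)\right)D_\mu\left(2^{1/2}y^{1/2}p^{1/2}\right)D_\nu\left(-2^{1/2}x^{1/2}p^{1/2}\right)\\ &=\frac{2^{(\mu-\nu)/2}\sqrt\pi}{\Gamma\left[1+(\nu-\mu)/2\right]\Gamma[-\nu]}\int_0^x e^{-pt}\,t^{(\nu-\mu)/2}(x-t)^{-(1+\nu)/2}(y+t)^{\mu/2}\\ &\qquad\times{}_2F_1\left(-\frac{\mu}{2},\frac{1+\nu}{2};1+\frac{\nu-\mu}{2};\frac{t(x-y-t)}{(x-t)(y+t)}\right)dt\\ &\quad+\frac{2^{1+(\mu+\nu)/2}\sqrt\pi\,x^{1/2}y^{1/2}}{\Gamma[-\mu/2]\,\Gamma[-\nu/2]}\int_x^\infty e^{-pt}\,t^{(\nu-1)/2}(t-x)^{-(1+\mu+\nu)/2}(y-x+t)^{(\mu-1)/2}\\ &\qquad\times\left\{{}_2F_1\left(\frac{1-\mu}{2},\frac{1-\nu}{2};\frac32;\frac{xy}{t(y-x+t)}\right)\right.\\ &\qquad\quad\left.+\frac{\Gamma[-\mu/2]\,\Gamma[-\nu/2]}{\Gamma\left[(1-\mu)/2\right]\Gamma\left[(1-\nu)/2\right]}\left(\frac{t(y-x+t)}{4xy}\right)^{1/2}{}_2F_1\left(-\frac{\mu}{2},-\frac{\nu}{2};\frac12;\frac{xy}{t(y-x+t)}\right)\right\}dt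 . \end{aligned} $$ If $\mu/2$ or $\nu/2$ is a nonnegative integer, the factors $\Gamma[-\mu/2]\Gamma[-\nu/2]$ in front of the last term are understood to cancel against those in the denominator of the prefactor.
   Context: $\Gamma[\cdot]$ is the gamma function, with $1/\Gamma$ taken to be $0$ at the nonpositive integers. ${}_2F_1(a,b;c;z)$ is the Gaussian hypergeometric function (principal branch, analytic on $\mathbb{C}\setminus[1,\infty)$). $D_\nu(z)$ is Whittaker's parabolic cylinder function of order $\nu$, the entire function of $z$ given by $$D_\nu(z)=2^{\nu/2}e^{-z^2/4}\left\{\frac{\Gamma[1/2]}{\Gamma[(1-\nu)/2]}\Phi\left(-\frac{\nu}{2};\frac12;\frac{z^2}{2}\right)+\frac{z}{2^{1/2}}\frac{\Gamma[-1/2]}{\Gamma[-\nu/2]}\Phi\left(\frac{1-\nu}{2};\frac32;\frac{z^2}{2}\right)\right\},$$ where $\Phi(a;b;z)=\sum_{n\ge0}\frac{(a)_n}{(b)_n}\frac{z^n}{n!}$ is Kummer's confluent hypergeometric function. All powers are principal values. *)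

theory Defs
  imports "HOL-Complex_Analysis.Complex_Analysis"
begin

definition kummer_Phi :: "complex \<Rightarrow> complex \<Rightarrow> complex \<Rightarrow> complex" where
  "kummer_Phi a b z = eval_fps (fps_hypergeo [a] [b] 1) z"

lemma kummer_Phi_eq_suminf:
  "kummer_Phi a b z = (\<Sum>n. pochhammer a n / pochhammer b n * z ^ n / fact n)"
  by (simp add: kummer_Phi_def eval_fps_def)

(* Since rGamma is the entire function 1/Gamma, it vanishes at the poles of Gamma, as required. *)
definition parabolic_cylinder_D :: "complex \<Rightarrow> complex \<Rightarrow> complex" where
  "parabolic_cylinder_D \<nu> z =
     2 powr (\<nu> / 2) * exp (- (z ^ 2) / 4) *
       (Gamma (1 / 2) * rGamma ((1 - \<nu>) / 2) * kummer_Phi (- \<nu> / 2) (1 / 2) (z ^ 2 / 2) +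
        z / 2 powr (1 / 2) * (Gamma (- 1 / 2) * rGamma (- \<nu> / 2)) *
          kummer_Phi ((1 - \<nu>) / 2) (3 / 2) (z ^ 2 / 2))"

definition hyp2f1_slit :: "complex set" where
  "hyp2f1_slit = - (complex_of_real ` {1..})"

(* Principal branch: the value at z of the holomorphic continuation of the Gauss series from the
   unit disc to the slit plane. It is meaningful for z in the slit plane when c is not a
   nonpositive integer; on the cut itself the value is unspecified. *)
definition hyp2f1 :: "complex \<Rightarrow> complex \<Rightarrow> complex \<Rightarrow> complex \<Rightarrow> complex" where
  "hyp2f1 a b c z =
     (THE w. \<exists>f. f holomorphic_on hyp2f1_slit \<and>
        (\<forall>u\<in>ball 0 1. f u = eval_fps (fps_hypergeo [a, b] [c] 1) u) \<and> w = f z)"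

lemma hyp2f1_series_eq_suminf:
  "eval_fps (fps_hypergeo [a, b] [c] 1) (z :: complex) =
     (\<Sum>n. pochhammer a n * pochhammer b n / pochhammer c n * z ^ n / fact n)"
  by (simp add: eval_fps_def)

lemma open_hyp2f1_slit: "open hyp2f1_slit"
proof -
  have "complex_of_real ` {1..} = \<real> \<inter> {z. 1 \<le> Re z}"
    by (auto simp: Reals_def)
  then have "closed (complex_of_real ` {1..})"
    by (simp only: closed_Int closed_complex_Reals closed_halfspace_Re_ge)
  then show ?thesis
    unfolding hyp2f1_slit_def by (rule open_Compl)
qed

lemma connected_hyp2f1_slit: "connected hyp2f1_slit"
proof (intro starlike_imp_connected, unfold starlike_def, intro bexI ballI)
  show "0 \<in> hyp2f1_slit"
    by (auto simp: hyp2f1_slit_def)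
next
  fix z assume z: "z \<in> hyp2f1_slit"
  show "closed_segment 0 z \<subseteq> hyp2f1_slit"
  proof (rule subsetI, rule ccontr)
    fix w assume "w \<in> closed_segment 0 z" "w \<notin> hyp2f1_slit"
    then obtain s r where s: "0 \<le> s" "s \<le> 1" "w = of_real s * z"
      and r: "1 \<le> r" "w = of_real r"
      by (auto simp: closed_segment_def hyp2f1_slit_def scaleR_conv_of_real)
    have "s > 0"
      using s r by (cases "s = 0") auto
    then have "z = of_real (r / s)"
      using s r by (auto simp: field_simps)
    moreover have "r / s \<ge> 1"
      using \<open>s > 0\<close> s r by (simp add: field_simps)
    ultimately show False
      using z unfolding hyp2f1_slit_def by blast
  qed
qed

lemma ball_subset_hyp2f1_slit: "ball 0 1 \<subseteq> hyp2f1_slit"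
  by (auto simp: hyp2f1_slit_def)

lemma hyp2f1_eqI:
  assumes f: "f holomorphic_on hyp2f1_slit"
    and eq: "\<And>u. u \<in> ball 0 1 \<Longrightarrow> f u = eval_fps (fps_hypergeo [a, b] [c] 1) u"
    and z: "z \<in> hyp2f1_slit"
  shows "hyp2f1 a b c z = f z"
  unfolding hyp2f1_def
proof (rule the_equality)
  show "\<exists>g. g holomorphic_on hyp2f1_slit \<and>
      (\<forall>u\<in>ball 0 1. g u = eval_fps (fps_hypergeo [a, b] [c] 1) u) \<and> f z = g z"
    using f eq by (intro exI[of _ f] conjI ballI refl)
next
  fix w assume "\<exists>g. g holomorphic_on hyp2f1_slit \<and>
      (\<forall>u\<in>ball 0 1. g u = eval_fps (fps_hypergeo [a, b] [c] 1) u) \<and> w = g z"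
  then obtain g where g: "g holomorphic_on hyp2f1_slit" "w = g z"
      "\<And>u. u \<in> ball 0 1 \<Longrightarrow> g u = eval_fps (fps_hypergeo [a, b] [c] 1) u"
    by blast
  have "g u = f u" if "u \<in> ball 0 1" for u
    by (rule trans[OF g(3)[OF that] sym[OF eq[OF that]]])
  moreover have "ball (0 :: complex) 1 \<noteq> {}"
    by simp
  ultimately have "g z = f z"
    using analytic_continuation_open[OF open_ball open_hyp2f1_slit _ connected_hyp2f1_slit
      ball_subset_hyp2f1_slit g(1) f _ z] by blast
  then show "w = f z"
    by (rule trans[OF g(2)])
qed

end

theory Submission
  imports Defs
begin

text \<open>
  The function \<open>exp (p y / 2) D\<^sub>\<mu>(sqrt (2 p y))\<close> is, up to a power of \<open>p\<close>, the Laplace transform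
  of \<open>t powr (- \<mu> / 2 - 1) (y + t) powr ((\<mu> - 1) / 2)\<close>, and also of
  \<open>t powr (- (1 + \<mu>) / 2) (y + t) powr (\<mu> / 2)\<close>; the even and odd parts of
  \<open>exp (- p x / 2) D\<^sub>\<nu>(- sqrt (2 p x))\<close> are Laplace transforms of beta densities on \<open>(0, x)\<close>.
  Pairing the second representation with the even part and the first with the odd part makes the
  powers of \<open>p\<close> cancel, and the density of the convolution at \<open>t\<close> is an integral over
  \<open>0 < s < min t x\<close> of powers of \<open>s\<close>, \<open>x - s\<close>, \<open>t - s\<close>, \<open>y + t - s\<close> whose exponents add up to -2.
  A Moebius substitution turns it into an Euler integral. For \<open>t < x\<close> both pairings give the same
  hypergeometric function, and for \<open>t > x\<close> they give the two terms of the second integrand.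
  For real \<open>\<mu> < 0\<close>, \<open>- 1 < \<nu> < 0\<close>, \<open>p > 0\<close> all integrands are positive, so Tonelli applies throughout.
  The general case follows by analytic continuation in \<open>\<mu>\<close>, then \<open>\<nu>\<close>, then \<open>p\<close>: after a Pfaff
  transformation the integrands are locally uniformly dominated, because the coefficients of the Gauss
  series are bounded by those of a power of \<open>1 - z\<close>.
\<close>

section \<open>Holomorphic series and integrals\<close>

text \<open>\<open>hyp2f1\<close> is a definite description: nothing is known about it until a
  continuation to the slit plane is exhibited. Euler's integral does this only for 0 < Re b < Re c;
  contiguous relations carry it to all b and all c with Re c > 0. Holomorphy in the parameters is a
  separate matter and rests on locally uniform coefficient bounds. The starting range of
  \<open>\<mu>\<close> and \<open>\<nu>\<close> is exactly where all four densities are integrable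
  at their singular ends. In \<open>ennreal\<close> the finite product then forces each integral on
  the right to be finite, so convergence comes for free in the real case. Each pairing contributes
  half of the integral over (0, x), with equal coefficients; the duplication formula turns their sum
  into the factor 1 / Gamma(-\<nu>). The order of continuation is possible because for real
  \<open>\<nu>\<close> in (-1, 0) the admissible \<open>\<mu>\<close> form a half-plane containing
  (-1, 0), while for a given admissible \<open>\<mu>\<close> the strip of admissible
  \<open>\<nu>\<close> still meets (-1, 0) in an interval. Working with 1 / Gamma keeps all
  prefactors entire, poles of Gamma included.\<close>

lemma holomorphic_on_suminf_local:
  fixes f :: "nat \<Rightarrow> complex \<Rightarrow> complex"
  assumes S: "open S" and hol: "\<And>n. f n holomorphic_on S"
    and bd: "\<And>w. w \<in> S \<Longrightarrow> \<exists>r>0. \<exists>M. summable M \<and> (\<forall>n. \<forall>u\<in>cball w r \<inter> S. norm (f n u) \<le> M n)"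
  shows "(\<lambda>w. \<Sum>n. f n w) holomorphic_on S"
proof (rule holomorphic_uniform_sequence[OF S])
  show "(\<lambda>w. \<Sum>i<n. f i w) holomorphic_on S" for n
    by (intro holomorphic_intros hol)
next
  fix w assume w: "w \<in> S"
  obtain r M where r: "r > 0" and M: "summable M" "\<And>n u. u \<in> cball w r \<inter> S \<Longrightarrow> norm (f n u) \<le> M n"
    using bd[OF w] by blast
  obtain e where e: "e > 0" "cball w e \<subseteq> S"
    using S w open_contains_cball by blast
  define d where "d = min r e"
  have sub: "cball w d \<subseteq> S" "cball w d \<subseteq> cball w r \<inter> S"
    using e by (auto simp: d_def)
  have "uniform_limit (cball w d) (\<lambda>n u. \<Sum>i<n. f i u) (\<lambda>u. \<Sum>i. f i u) sequentially"
    by (rule Weierstrass_m_test[OF _ M(1)]) (use M(2) sub in blast)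
  then show "\<exists>d>0. cball w d \<subseteq> S \<and>
      uniform_limit (cball w d) (\<lambda>n w. \<Sum>i<n. f i w) (\<lambda>w. \<Sum>n. f n w) sequentially"
    using r e sub by (intro exI[of _ d]) (auto simp: d_def)
qed

text \<open>Every point of the half ball is the centre of a ball of radius r / 2 inside the given
  one, so Cauchy's estimate gives |f'| <= 2 B / r there; convexity of the half ball turns this into
  a Lipschitz bound.\<close>

lemma Cauchy_difference_bound:
  fixes f :: "complex \<Rightarrow> complex"
  assumes hol: "f holomorphic_on ball w r" and r: "r > 0"
    and bd: "\<And>u. u \<in> ball w r \<Longrightarrow> norm (f u) \<le> B"
    and u: "u \<in> ball w (r / 2)"
  shows "norm (f u - f w) \<le> 2 * B / r * norm (u - w)"
proof -
  have der: "norm (deriv f v) \<le> 2 * B / r" if v: "v \<in> ball w (r / 2)" for v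
  proof -
    have sub: "ball v (r / 2) \<subseteq> ball w r"
    proof
      fix z assume "z \<in> ball v (r / 2)"
      then have "dist w z < r / 2 + r / 2"
        using v dist_triangle[of w z v] by auto
      then show "z \<in> ball w r" by simp
    qed
    have "norm ((deriv ^^ 1) f v) \<le> fact 1 * B / (r / 2) ^ 1"
    proof (rule field_le_epsilon)
      fix e :: real assume e: "e > 0"
      have hol1: "f holomorphic_on ball v (r / 2)"
        using hol sub by (rule holomorphic_on_subset)
      show "norm ((deriv ^^ 1) f v) \<le> fact 1 * B / (r / 2) ^ 1 + e"
      proof -
        \<comment> \<open>Cauchy's inequality wants a closed disc, while f is controlled only on the
          open ball; hence radii below r / 2, followed by the limit from the left.\<close>
        have "norm (deriv f v) \<le> B / \<rho>" if \<rho>: "0 < \<rho>" "\<rho> < r / 2" for \<rho>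
        proof -
          have "cball v \<rho> \<subseteq> ball v (r / 2)" using \<rho> by auto
          then have "norm ((deriv ^^ 1) f v) \<le> fact 1 * B / \<rho> ^ 1"
            using \<rho> sub
            by (intro Cauchy_inequality holomorphic_on_subset[OF hol1]
                holomorphic_on_imp_continuous_on[OF holomorphic_on_subset[OF hol1]] bd)
              (auto simp: dist_norm norm_minus_commute subset_iff)
          then show ?thesis by simp
        qed
        then have ev: "\<forall>\<^sub>F \<rho> in at_left (r / 2). norm (deriv f v) \<le> B / \<rho>"
          using r by (intro eventually_at_leftI[of 0]) auto
        have "((\<lambda>\<rho>. B / \<rho>) \<longlongrightarrow> B / (r / 2)) (at_left (r / 2))"
          using r by (intro tendsto_intros) auto
        then have "norm (deriv f v) \<le> B / (r / 2)"
          using ev tendsto_lowerbound trivial_limit_at_left_real by blast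
        then show ?thesis using e by simp
      qed
    qed
    then show ?thesis by (simp add: mult.commute)
  qed
  show ?thesis
  proof (rule field_differentiable_bound[where S = "ball w (r / 2)" and f' = "deriv f"])
    fix z assume z: "z \<in> ball w (r / 2)"
    then have "z \<in> ball w r" using r by auto
    then show "(f has_field_derivative deriv f z) (at z within ball w (r / 2))"
      using hol holomorphic_derivI by blast
  qed (use der u r in auto)
qed

text \<open>Differentiation under the integral sign needs no bound on the derivative: Cauchy's estimate
  turns a locally uniform bound on the integrand into one on its difference quotients.\<close>

lemma holomorphic_on_lebesgue_integral:
  fixes F :: "complex \<Rightarrow> 'a \<Rightarrow> complex"
  assumes S: "open S"
    and meas: "\<And>w. w \<in> S \<Longrightarrow> F w \<in> borel_measurable M"
    and hol: "\<And>t. t \<in> space M \<Longrightarrow> (\<lambda>w. F w t) holomorphic_on S"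
    and bd: "\<And>w. w \<in> S \<Longrightarrow> \<exists>r>0. \<exists>h. integrable M h \<and>
      (\<forall>u\<in>ball w r \<inter> S. \<forall>t\<in>space M. norm (F u t) \<le> h t)"
  shows "(\<lambda>w. \<integral>t. F w t \<partial>M) holomorphic_on S"
proof -
  have "\<exists>D. ((\<lambda>w. \<integral>t. F w t \<partial>M) has_field_derivative D) (at w)" if w: "w \<in> S" for w
  proof -
    obtain r0 h where r0: "r0 > 0" and h: "integrable M h"
      and hb: "\<And>u t. u \<in> ball w r0 \<inter> S \<Longrightarrow> t \<in> space M \<Longrightarrow> norm (F u t) \<le> h t"
      using bd[OF w] by blast
    obtain e where e: "e > 0" "ball w e \<subseteq> S"
      using S w open_contains_ball by blast
    define r where "r = min r0 e"
    have r: "r > 0" "ball w r \<subseteq> S" "ball w r \<subseteq> ball w r0 \<inter> S"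
      using r0 e by (auto simp: r_def)
    define D where "D = (\<lambda>t. deriv (\<lambda>w. F w t) w)"
    have int: "integrable M (F u)" if u: "u \<in> ball w r" for u
    proof (rule Bochner_Integration.integrable_bound[OF h])
      show "F u \<in> borel_measurable M" using u r meas by blast
      have "norm (F u t) \<le> norm (h t)" if "t \<in> space M" for t
        using hb[OF subsetD[OF r(3) u] that] by auto
      then show "AE t in M. norm (F u t) \<le> norm (h t)" by (rule AE_I2)
    qed
    have lim: "((\<lambda>u. (F u t - F w t) / (u - w)) \<longlongrightarrow> D t) (at w)" if "t \<in> space M" for t
    proof -
      have "((\<lambda>w. F w t) has_field_derivative D t) (at w)"
        unfolding D_def using hol[OF that] S w holomorphic_derivI by blast
      then show ?thesis by (simp add: has_field_derivative_iff)
    qed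
    have "((\<lambda>u. ((\<integral>t. F u t \<partial>M) - (\<integral>t. F w t \<partial>M)) / (u - w)) \<longlongrightarrow> (\<integral>t. D t \<partial>M)) (at w)"
      unfolding tendsto_at_iff_sequentially
    proof (intro allI impI)
      fix X :: "nat \<Rightarrow> complex"
      assume X: "\<forall>i. X i \<in> UNIV - {w}" "X \<longlonglongrightarrow> w"
      have "\<forall>\<^sub>F i in sequentially. X i \<in> ball w (r / 2)"
        using X(2) r by (intro topological_tendstoD) auto
      then obtain N where N: "\<And>i. i \<ge> N \<Longrightarrow> X i \<in> ball w (r / 2)"
        by (auto simp: eventually_sequentially)
      \<comment> \<open>Dominated convergence wants its bound at every index, but X enters the half
        ball only eventually. The shift is undone by \<open>LIMSEQ_offset\<close> at the
        end.\<close>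
      define Y where "Y = (\<lambda>i. X (i + N))"
      have Y: "Y i \<in> ball w (r / 2)" "Y i \<noteq> w" "Y i \<in> ball w r" "Y i \<in> S" for i
      proof -
        show "Y i \<in> ball w (r / 2)" "Y i \<noteq> w"
          using N X(1) by (auto simp: Y_def)
        then show "Y i \<in> ball w r" using r by auto
        then show "Y i \<in> S" using r by auto
      qed
      have Ylim: "Y \<longlonglongrightarrow> w"
        unfolding Y_def using X(2) by (rule LIMSEQ_ignore_initial_segment)
      have lim': "(\<lambda>i. (F (Y i) t - F w t) / (Y i - w)) \<longlonglongrightarrow> D t" if "t \<in> space M" for t
        using lim[OF that] Ylim Y(2) unfolding tendsto_at_iff_sequentially
        by (auto simp: o_def)
      have "(\<lambda>i. \<integral>t. (F (Y i) t - F w t) / (Y i - w) \<partial>M) \<longlonglongrightarrow> (\<integral>t. D t \<partial>M)"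
      proof (rule integral_dominated_convergence[where w = "\<lambda>t. 2 * h t / r"])
        show "D \<in> borel_measurable M"
          by (rule borel_measurable_LIMSEQ_metric[OF _ lim'])
            (use meas[OF Y(4)] meas[OF w] in auto)
        show "integrable M (\<lambda>t. 2 * h t / r)" using h by auto
        show "AE t in M. norm ((F (Y i) t - F w t) / (Y i - w)) \<le> 2 * h t / r" for i
        proof (rule AE_I2)
          fix t assume t: "t \<in> space M"
          have "norm (F (Y i) t - F w t) \<le> 2 * h t / r * norm (Y i - w)"
            by (rule Cauchy_difference_bound[OF holomorphic_on_subset[OF hol[OF t] r(2)] r(1) _ Y(1)])
              (use hb t r(3) in blast)
          then show "norm ((F (Y i) t - F w t) / (Y i - w)) \<le> 2 * h t / r"
            using Y(2)[of i] by (simp add: norm_divide divide_le_eq)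
        qed
      qed (use meas[OF Y(4)] meas[OF w] lim' in auto)
      moreover have "(\<lambda>i. \<integral>t. (F (Y i) t - F w t) / (Y i - w) \<partial>M) =
          (\<lambda>i. ((\<integral>t. F (X (i + N)) t \<partial>M) - (\<integral>t. F w t \<partial>M)) / (X (i + N) - w))"
      proof
        fix i
        show "(\<integral>t. (F (Y i) t - F w t) / (Y i - w) \<partial>M) =
            ((\<integral>t. F (X (i + N)) t \<partial>M) - (\<integral>t. F w t \<partial>M)) / (X (i + N) - w)"
          using int[OF Y(3)[of i]] int[of w] r by (simp add: Y_def)
      qed
      ultimately have "(\<lambda>i. ((\<integral>t. F (X (i + N)) t \<partial>M) - (\<integral>t. F w t \<partial>M)) / (X (i + N) - w))
          \<longlonglongrightarrow> (\<integral>t. D t \<partial>M)"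
        by simp
      then show "((\<lambda>u. ((\<integral>t. F u t \<partial>M) - (\<integral>t. F w t \<partial>M)) / (u - w)) \<circ> X) \<longlonglongrightarrow> (\<integral>t. D t \<partial>M)"
        unfolding o_def by (rule LIMSEQ_offset)
    qed
    then show ?thesis
      by (auto simp: has_field_derivative_iff)
  qed
  then show ?thesis
    using S by (auto simp: holomorphic_on_open)
qed

section \<open>Gauss series\<close>

definition gauss_coeff :: "complex \<Rightarrow> complex \<Rightarrow> complex \<Rightarrow> nat \<Rightarrow> complex" where
  "gauss_coeff a b c n = pochhammer a n * pochhammer b n / (pochhammer c n * fact n)"

definition gauss_series :: "complex \<Rightarrow> complex \<Rightarrow> complex \<Rightarrow> complex \<Rightarrow> complex" where
  "gauss_series a b c z = (\<Sum>n. gauss_coeff a b c n * z ^ n)"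

lemma fps_hypergeo_nth_gauss [simp]: "fps_hypergeo [a, b] [c] 1 $ n = gauss_coeff a b c n"
  by (simp add: gauss_coeff_def)

lemma eval_fps_hypergeo: "eval_fps (fps_hypergeo [a, b] [c] 1) z = gauss_series a b c z"
  unfolding eval_fps_def gauss_series_def fps_hypergeo_nth_gauss ..

lemma gauss_coeff_commute: "gauss_coeff a b c n = gauss_coeff b a c n"
  by (simp add: gauss_coeff_def mult.commute)

lemma hyp2f1_commute: "hyp2f1 a b c z = hyp2f1 b a c z"
  by (simp add: hyp2f1_def eval_fps_hypergeo gauss_series_def gauss_coeff_commute[of a b])

lemma gauss_coeff_Suc:
  "gauss_coeff a b c (Suc n) =
     gauss_coeff a b c n * ((a + of_nat n) * (b + of_nat n) / ((c + of_nat n) * of_nat (Suc n)))"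
  by (simp add: gauss_coeff_def pochhammer_Suc field_simps)

lemma pochhammer_nonneg:
  fixes x :: real
  assumes "x \<ge> 0" shows "pochhammer x n \<ge> 0"
  using assms by (induction n) (auto simp: pochhammer_Suc)

lemma norm_pochhammer_le:
  fixes a :: complex
  assumes "norm a \<le> A" shows "norm (pochhammer a n) \<le> pochhammer A n"
proof (induction n)
  case (Suc n)
  have "A \<ge> 0" using assms norm_ge_zero order_trans by blast
  then show ?case
    using Suc assms norm_triangle_ineq[of a "of_nat n"]
    by (auto simp: pochhammer_Suc norm_mult intro!: mult_mono pochhammer_nonneg)
qed auto

lemma pochhammer_le_norm:
  fixes c :: complex
  assumes "0 < e" "e \<le> Re c" shows "pochhammer e n \<le> norm (pochhammer c n)"
proof (induction n)
  case (Suc n)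
  have "e + real n \<le> norm (c + of_nat n)"
    using assms complex_Re_le_cmod[of "c + of_nat n"] by simp
  then show ?case
    using Suc assms by (auto simp: pochhammer_Suc norm_mult intro!: mult_mono)
qed auto

text \<open>The linear term must be Re a and not |a|, since the growth exponent of the Gauss
  coefficients is Re (a + b - c). The error A^2 / (2 n) is what completing the square leaves
  over.\<close>

lemma norm_add_of_nat_le:
  fixes a :: complex
  assumes "norm a \<le> A" "n \<ge> 1" "real n \<ge> A"
  shows "norm (a + of_nat n) \<le> real n + Re a + A\<^sup>2 / (2 * real n)"
proof -
  define e where "e = A\<^sup>2 / (2 * real n)"
  have e: "2 * real n * e = A\<^sup>2" "e \<ge> 0"
    using assms by (auto simp: e_def)
  have "\<bar>Re a\<bar> \<le> A" using assms abs_Re_le_cmod order_trans by blast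
  then have pos: "real n + Re a + e \<ge> 0" using assms e by auto
  have "(norm (a + of_nat n))\<^sup>2 = (Re a + real n)\<^sup>2 + (Im a)\<^sup>2"
    by (simp add: cmod_power2)
  also have "\<dots> = (norm a)\<^sup>2 + 2 * real n * Re a + (real n)\<^sup>2"
    unfolding cmod_power2 by (simp add: power2_eq_square algebra_simps)
  also have "\<dots> \<le> A\<^sup>2 + 2 * real n * Re a + (real n)\<^sup>2"
    using assms by (simp add: power_mono)
  also have "\<dots> \<le> A\<^sup>2 + 2 * real n * Re a + (real n)\<^sup>2 + (Re a + e)\<^sup>2"
    by simp
  also have "\<dots> = (real n + Re a + e)\<^sup>2"
    unfolding e(1)[symmetric] by (simp add: power2_eq_square algebra_simps)
  finally show ?thesis
    using pos unfolding e_def by (rule power2_le_imp_le)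
qed

text \<open>For large n the ratio of consecutive coefficients is
  \<open>1 + (a + b - c - 1) / n + O(1 / n\<^sup>2)\<close>, so it is eventually dominated by the ratio
  \<open>(\<sigma> + n) / (1 + n)\<close> of the binomial series of \<open>(1 - z) powr - \<sigma>\<close>.\<close>

lemma gauss_coeff_bound:
  fixes A e \<sigma> \<delta> :: real
  assumes e: "e > 0" and \<sigma>: "\<sigma> > 0" and \<delta>: "\<delta> > 0"
  obtains C where "C \<ge> 0"
    "\<And>a b c n. \<lbrakk>norm a \<le> A; norm b \<le> A; e \<le> Re c; Re a + Re b - Re c \<le> \<sigma> - \<delta>\<rbrakk> \<Longrightarrow>
       norm (gauss_coeff a b c n) \<le> C * (pochhammer \<sigma> n / fact n)"
proof (cases "A \<ge> 0")
  case False
  show ?thesis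
  proof (rule that[of 0])
    fix a b c :: complex and n
    assume "norm a \<le> A"
    then show "norm (gauss_coeff a b c n) \<le> 0 * (pochhammer \<sigma> n / fact n)"
      using False norm_ge_zero order_trans by blast
  qed auto
next
  case A: True
  \<comment> \<open>\<open>k0\<close> bounds the error k = A^2 / (2 n) and equals n k.
    \<open>M\<close> collects the bounded terms of (n + Re a + k) (n + Re b + k): A^2 for the
    product of real parts, 2 k0 = A^2 for the two mixed terms n k, then 2 A k0 and k0^2. Beyond
    \<open>N\<close> they are absorbed by the slack: n \<delta> >= M.\<close>
  define k0 where "k0 = A\<^sup>2 / 2"
  define M where "M = 2 * A\<^sup>2 + 2 * A * k0 + k0\<^sup>2"
  obtain N :: nat where N: "real N \<ge> max 1 (max A (M / \<delta>))"
    using real_arch_simple by blast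
  \<comment> \<open>The crude quotient of the n-th coefficient by the comparison coefficient.
    Summing it up to \<open>N\<close> gives a constant that covers all initial indices, and the
    ratio estimate propagates the bound from there.\<close>
  define T where "T = (\<lambda>n. (pochhammer A n)\<^sup>2 / (pochhammer e n * fact n) / (pochhammer \<sigma> n / fact n))"
  define C where "C = (\<Sum>n\<le>N. T n)"
  have T0: "T n \<ge> 0" for n
    unfolding T_def using A e \<sigma> by (intro divide_nonneg_nonneg mult_nonneg_nonneg pochhammer_nonneg) auto
  have q0: "pochhammer \<sigma> n / fact n > 0" for n
    using pochhammer_pos[OF \<sigma>, of n] by simp
  show ?thesis
  proof (rule that[of C])
    show C0: "C \<ge> 0" unfolding C_def using T0 by (intro sum_nonneg) auto
    fix a b c :: complex and n
    assume a: "norm a \<le> A" and b: "norm b \<le> A" and c: "e \<le> Re c"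
      and s: "Re a + Re b - Re c \<le> \<sigma> - \<delta>"
    have small: "norm (gauss_coeff a b c n) \<le> C * (pochhammer \<sigma> n / fact n)" if "n \<le> N" for n
    proof -
      have "norm (gauss_coeff a b c n) =
          norm (pochhammer a n) * norm (pochhammer b n) / (norm (pochhammer c n) * fact n)"
        by (simp add: gauss_coeff_def norm_mult norm_divide)
      also have "\<dots> \<le> pochhammer A n * pochhammer A n / (pochhammer e n * fact n)"
        using A e by (intro frac_le mult_mono norm_pochhammer_le a b pochhammer_le_norm c
            mult_nonneg_nonneg pochhammer_nonneg mult_pos_pos pochhammer_pos) auto
      also have "\<dots> = T n * (pochhammer \<sigma> n / fact n)"
        using pochhammer_pos[OF \<sigma>, of n] by (simp add: T_def power2_eq_square)
      also have "\<dots> \<le> C * (pochhammer \<sigma> n / fact n)"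
      proof (rule mult_right_mono)
        show "T n \<le> C" unfolding C_def using T0 that by (intro member_le_sum) auto
      qed (use q0[of n] in simp)
      finally show ?thesis .
    qed
    have "norm (gauss_coeff a b c n) \<le> C * (pochhammer \<sigma> n / fact n)" if "n \<ge> N" for n
      using that
    proof (induction n rule: dec_induct)
      case base
      show ?case by (rule small) simp
    next
      case (step n)
      have n: "n \<ge> 1" "real n \<ge> A" "real n * \<delta> \<ge> M"
      proof -
        have "real n \<ge> max 1 (max A (M / \<delta>))" using N step by linarith
        then show "n \<ge> 1" "real n \<ge> A" "real n * \<delta> \<ge> M" using \<delta> by (auto simp: field_simps)
      qed
      define k where "k = A\<^sup>2 / (2 * real n)"
      have k: "0 \<le> k" "k \<le> k0" "real n * k = k0"
        using n A frac_le[of "A\<^sup>2" "A\<^sup>2" 2 "2 * real n"] by (auto simp: k_def k0_def)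
      have ra: "\<bar>Re a\<bar> \<le> A" "\<bar>Re b\<bar> \<le> A"
        using a b abs_Re_le_cmod order_trans by blast+
      have "norm (a + of_nat n) * norm (b + of_nat n) \<le> (n + Re a + k) * (n + Re b + k)"
      proof (rule mult_mono)
        show "norm (a + of_nat n) \<le> n + Re a + k"
          using norm_add_of_nat_le[OF a n(1,2)] by (simp add: k_def)
        show "norm (b + of_nat n) \<le> n + Re b + k"
          using norm_add_of_nat_le[OF b n(1,2)] by (simp add: k_def)
        show "0 \<le> n + Re a + k" using ra(1) n(2) k(1) by linarith
      qed simp
      also have "\<dots> = (real n)\<^sup>2 + n * (Re a + Re b) + Re a * Re b + 2 * (real n * k) + k * (Re a + Re b) + k * k"
        by (simp add: power2_eq_square algebra_simps)
      also have "\<dots> \<le> (real n)\<^sup>2 + n * (Re a + Re b) + A * A + 2 * k0 + k0 * (A + A) + k0 * k0"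
      proof -
        have "Re a * Re b \<le> A * A"
          using ra abs_mult[of "Re a" "Re b"] mult_mono[OF ra(1) ra(2)] A by linarith
        moreover have "k * (Re a + Re b) \<le> k0 * (A + A)"
          using k ra A order_trans[OF mult_left_mono[of "Re a + Re b" "A + A" k] mult_right_mono[of k k0 "A + A"]]
          by auto
        moreover have "k * k \<le> k0 * k0" using k by (intro mult_mono) auto
        ultimately show ?thesis using k(3) by auto
      qed
      also have "\<dots> = (real n)\<^sup>2 + n * (Re a + Re b) + M"
        by (simp add: M_def k0_def power2_eq_square algebra_simps)
      \<comment> \<open>Here the slack \<delta> between the growth exponent and \<sigma> is spent on
        \<open>M\<close>.\<close>
      also have "\<dots> \<le> (real n)\<^sup>2 + n * (Re a + Re b + \<delta>)"
        using n(3) by (simp add: algebra_simps)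
      also have "\<dots> \<le> (real n)\<^sup>2 + n * (Re c + \<sigma>)"
        using s by (intro add_left_mono mult_left_mono) auto
      also have "\<dots> \<le> (real n)\<^sup>2 + n * (Re c + \<sigma>) + Re c * \<sigma>"
        using c e \<sigma> by simp
      also have "\<dots> = (Re c + n) * (\<sigma> + n)"
        by (simp add: power2_eq_square algebra_simps)
      also have "\<dots> \<le> norm (c + of_nat n) * (\<sigma> + n)"
        using complex_Re_le_cmod[of "c + of_nat n"] \<sigma> by (intro mult_right_mono) auto
      finally have *: "norm (a + of_nat n) * norm (b + of_nat n) \<le> norm (c + of_nat n) * (\<sigma> + n)" .
      have cn: "norm (c + of_nat n) > 0"
        using c e complex_Re_le_cmod[of "c + of_nat n"] by (simp del: zero_less_norm_iff)
      have "norm (gauss_coeff a b c (Suc n)) = norm (gauss_coeff a b c n) *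
          ((norm (a + of_nat n) * norm (b + of_nat n)) / (norm (c + of_nat n) * real (Suc n)))"
        by (simp only: gauss_coeff_Suc norm_mult norm_divide norm_of_nat)
      also have "\<dots> \<le> (C * (pochhammer \<sigma> n / fact n)) * ((\<sigma> + n) / real (Suc n))"
      proof (intro mult_mono step.IH)
        have "(norm (a + of_nat n) * norm (b + of_nat n)) / (norm (c + of_nat n) * real (Suc n))
            \<le> (norm (c + of_nat n) * (\<sigma> + n)) / (norm (c + of_nat n) * real (Suc n))"
          using * by (intro divide_right_mono) auto
        also have "\<dots> = (\<sigma> + n) / real (Suc n)" using cn by simp
        finally show "(norm (a + of_nat n) * norm (b + of_nat n)) / (norm (c + of_nat n) * real (Suc n))
            \<le> (\<sigma> + n) / real (Suc n)" .
        show "0 \<le> C * (pochhammer \<sigma> n / fact n)"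
          using q0[of n] C0 by (simp only: mult_nonneg_nonneg less_imp_le)
      qed auto
      also have "\<dots> = C * (pochhammer \<sigma> (Suc n) / fact (Suc n))"
        by (simp add: pochhammer_Suc mult_ac)
      finally show ?case .
    qed
    with small show "norm (gauss_coeff a b c n) \<le> C * (pochhammer \<sigma> n / fact n)"
      using nat_le_linear by blast
  qed
qed

lemma binomial_series_negative:
  fixes x \<sigma> :: real
  assumes "\<bar>x\<bar> < 1"
  shows "(\<lambda>n. pochhammer \<sigma> n / fact n * x ^ n) sums (1 - x) powr (- \<sigma>)"
proof -
  have "(\<lambda>n. ((- \<sigma>) gchoose n) * (- x) ^ n) sums (1 + - x) powr (- \<sigma>)"
    using assms by (intro gen_binomial_real) auto
  also have "(\<lambda>n. ((- \<sigma>) gchoose n) * (- x) ^ n) = (\<lambda>n. pochhammer \<sigma> n / fact n * x ^ n)"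
  proof
    fix n
    have "(- 1) ^ n * (- x) ^ n = x ^ n" by (simp flip: power_mult_distrib)
    then show "((- \<sigma>) gchoose n) * (- x) ^ n = pochhammer \<sigma> n / fact n * x ^ n"
      by (simp add: gbinomial_pochhammer mult.assoc mult.left_commute)
  qed
  finally show ?thesis by simp
qed

lemma binomial_series_negative_complex:
  fixes z a :: complex
  assumes "norm z < 1"
  shows "(\<lambda>n. pochhammer a n / fact n * z ^ n) sums (1 - z) powr (- a)"
proof -
  have "(\<lambda>n. ((- a) gchoose n) * (- z) ^ n) sums (1 + - z) powr (- a)"
    using assms by (intro gen_binomial_complex) auto
  also have "(\<lambda>n. ((- a) gchoose n) * (- z) ^ n) = (\<lambda>n. pochhammer a n / fact n * z ^ n)"
  proof
    fix n
    have "(- 1) ^ n * (- z) ^ n = z ^ n" by (simp flip: power_mult_distrib)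
    then show "((- a) gchoose n) * (- z) ^ n = pochhammer a n / fact n * z ^ n"
      by (simp add: gbinomial_pochhammer mult.assoc mult.left_commute)
  qed
  finally show ?thesis by simp
qed

text \<open>Termwise comparison with the binomial series of (1 - |z|)^(-\<sigma>). The constant is
  uniform in the three parameters, which is what makes the integrands locally uniformly dominated
  near the singular point z = 1.\<close>

lemma gauss_series_bound:
  fixes A e \<sigma> \<delta> :: real
  assumes e: "e > 0" and \<sigma>: "\<sigma> > 0" and \<delta>: "\<delta> > 0"
  obtains C where "C \<ge> 0"
    "\<And>a b c z. \<lbrakk>norm a \<le> A; norm b \<le> A; e \<le> Re c; Re a + Re b - Re c \<le> \<sigma> - \<delta>; norm z < 1\<rbrakk> \<Longrightarrow>
       norm (gauss_series a b c z) \<le> C * (1 - norm z) powr (- \<sigma>)"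
proof -
  obtain C where C: "C \<ge> 0" "\<And>a b c n. \<lbrakk>norm a \<le> A; norm b \<le> A; e \<le> Re c; Re a + Re b - Re c \<le> \<sigma> - \<delta>\<rbrakk> \<Longrightarrow>
       norm (gauss_coeff a b c n) \<le> C * (pochhammer \<sigma> n / fact n)"
    using gauss_coeff_bound[OF assms, of A] by blast
  show ?thesis
  proof (rule that[OF C(1)])
    fix a b c z :: complex
    assume h: "norm a \<le> A" "norm b \<le> A" "e \<le> Re c" "Re a + Re b - Re c \<le> \<sigma> - \<delta>"
      and z: "norm z < 1"
    have S: "(\<lambda>n. C * (pochhammer \<sigma> n / fact n * norm z ^ n)) sums (C * (1 - norm z) powr (- \<sigma>))"
      by (intro sums_mult binomial_series_negative) (use z in auto)
    have le: "norm (gauss_coeff a b c n * z ^ n) \<le> C * (pochhammer \<sigma> n / fact n * norm z ^ n)" for n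
      using mult_right_mono[OF C(2)[OF h], of "norm z ^ n" n] by (simp add: norm_mult norm_power mult.assoc)
    show "norm (gauss_series a b c z) \<le> C * (1 - norm z) powr (- \<sigma>)"
      unfolding gauss_series_def sums_unique[OF S] by (rule norm_suminf_le[OF le sums_summable[OF S]])
  qed
qed

lemma summable_gauss_series:
  assumes c: "Re c > 0" and z: "norm z < 1"
  shows "summable (\<lambda>n. gauss_coeff a b c n * z ^ n)"
proof -
  define A where "A = norm a + norm b"
  have r: "Re a \<le> A" "Re b \<le> A" "norm a \<le> A" "norm b \<le> A"
    using complex_Re_le_cmod[of a] complex_Re_le_cmod[of b] norm_ge_zero[of a] norm_ge_zero[of b]
    unfolding A_def by linarith+
  \<comment> \<open>The exponent 2 A + 1 leaves slack 1 whatever the parameters are, because Re a +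
    Re b <= 2 A and Re c > 0. For convergence inside the disc its size is irrelevant.\<close>
  have \<sigma>: "2 * A + 1 > 0" using r(3) norm_ge_zero[of a] by linarith
  obtain C where C: "C \<ge> 0" "\<And>a' b' c' n. \<lbrakk>norm a' \<le> A; norm b' \<le> A; Re c \<le> Re c'; Re a' + Re b' - Re c' \<le> (2 * A + 1) - 1\<rbrakk> \<Longrightarrow>
       norm (gauss_coeff a' b' c' n) \<le> C * (pochhammer (2 * A + 1) n / fact n)"
    using gauss_coeff_bound[OF c \<sigma> zero_less_one, of A] by metis
  have le: "norm (gauss_coeff a b c n * z ^ n) \<le> C * (pochhammer (2 * A + 1) n / fact n * norm z ^ n)" for n
    using mult_right_mono[OF C(2)[of a b c n], of "norm z ^ n"] r c
    by (simp add: norm_mult norm_power mult.assoc)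
  have "summable (\<lambda>n. C * (pochhammer (2 * A + 1) n / fact n * norm z ^ n))"
    by (intro summable_mult sums_summable[OF binomial_series_negative]) (use z in auto)
  then show ?thesis using le by (rule summable_comparison_test'[where N = 0]) 
qed

lemma fps_conv_radius_hypergeo:
  assumes "Re c > 0"
  shows "fps_conv_radius (fps_hypergeo [a, b] [c] 1) \<ge> 1"
  unfolding fps_conv_radius_def fps_hypergeo_nth_gauss
proof (rule conv_radius_geI_ex')
  fix r :: real assume "0 < r" "ereal r < 1"
  then show "summable (\<lambda>n. gauss_coeff a b c n * of_real r ^ n)"
    using assms by (intro summable_gauss_series) auto
qed

text \<open>On a small closed disc the parameters are bounded and Re c attains a positive minimum,
  so \<open>gauss_coeff_bound\<close> supplies one summable majorant for the whole disc.\<close>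

lemma holomorphic_gauss_series_params:
  assumes W: "open W" and hol: "a holomorphic_on W" "b holomorphic_on W" "c holomorphic_on W"
    and c: "\<And>w. w \<in> W \<Longrightarrow> Re (c w) > 0" and z: "norm z < 1"
  shows "(\<lambda>w. gauss_series (a w) (b w) (c w) z) holomorphic_on W"
  unfolding gauss_series_def
proof (rule holomorphic_on_suminf_local[OF W])
  have nz: "pochhammer (c w) n \<noteq> 0" if "w \<in> W" for w n
    using c[OF that] by (auto simp: pochhammer_eq_0_iff)
  show "(\<lambda>w. gauss_coeff (a w) (b w) (c w) n * z ^ n) holomorphic_on W" for n
    unfolding gauss_coeff_def pochhammer_prod using nz
    by (intro holomorphic_intros hol) (auto simp: pochhammer_prod)
next
  fix w assume w: "w \<in> W"
  obtain r where r: "r > 0" "cball w r \<subseteq> W" using W w open_contains_cball by blast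
  have cont: "continuous_on (cball w r) f" if "f holomorphic_on W" for f
    using that r(2) holomorphic_on_subset holomorphic_on_imp_continuous_on by blast
  have bdd: "\<exists>B\<ge>0. \<forall>u\<in>cball w r. norm (f u) \<le> B" if "f holomorphic_on W" for f :: "complex \<Rightarrow> complex"
  proof -
    have "bounded (f ` cball w r)"
      by (intro compact_imp_bounded compact_continuous_image cont that) auto
    then show ?thesis unfolding bounded_pos by (auto intro: less_imp_le)
  qed
  obtain A1 where A1: "A1 \<ge> 0" "\<And>u. u \<in> cball w r \<Longrightarrow> norm (a u) \<le> A1" using bdd[OF hol(1)] by blast
  obtain A2 where A2: "A2 \<ge> 0" "\<And>u. u \<in> cball w r \<Longrightarrow> norm (b u) \<le> A2" using bdd[OF hol(2)] by blast
  define A where "A = A1 + A2"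
  have "\<exists>x\<in>cball w r. \<forall>y\<in>cball w r. Re (c x) \<le> Re (c y)"
    by (intro continuous_attains_inf continuous_intros cont hol) (use r in auto)
  then obtain u0 where u0: "u0 \<in> cball w r" "\<And>y. y \<in> cball w r \<Longrightarrow> Re (c u0) \<le> Re (c y)" by blast
  have e: "Re (c u0) > 0" using u0 r c by blast
  have \<sigma>: "2 * A + 1 > 0" using A1 A2 by (simp add: A_def)
  obtain C where C: "C \<ge> 0" "\<And>a' b' c' n. \<lbrakk>norm a' \<le> A; norm b' \<le> A; Re (c u0) \<le> Re c'; Re a' + Re b' - Re c' \<le> (2 * A + 1) - 1\<rbrakk> \<Longrightarrow>
       norm (gauss_coeff a' b' c' n) \<le> C * (pochhammer (2 * A + 1) n / fact n)"
    using gauss_coeff_bound[OF e \<sigma> zero_less_one, of A] by metis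
  show "\<exists>r>0. \<exists>M. summable M \<and>
      (\<forall>n. \<forall>u\<in>cball w r \<inter> W. norm (gauss_coeff (a u) (b u) (c u) n * z ^ n) \<le> M n)"
  proof (intro exI conjI allI ballI)
    show "r > 0" by fact
    show "summable (\<lambda>n. C * (pochhammer (2 * A + 1) n / fact n * norm z ^ n))"
      by (intro summable_mult sums_summable[OF binomial_series_negative]) (use z in auto)
    fix n u assume u: "u \<in> cball w r \<inter> W"
    have ru: "norm (a u) \<le> A" "norm (b u) \<le> A" "Re (c u0) \<le> Re (c u)" "Re (c u) > 0"
      using A1 A2 u0 u c by (force simp: A_def)+
    then have "Re (a u) + Re (b u) - Re (c u) \<le> (2 * A + 1) - 1"
      using complex_Re_le_cmod[of "a u"] complex_Re_le_cmod[of "b u"] by linarith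
    then show "norm (gauss_coeff (a u) (b u) (c u) n * z ^ n) \<le> C * (pochhammer (2 * A + 1) n / fact n * norm z ^ n)"
      using mult_right_mono[OF C(2)[of "a u" "b u" "c u" n], of "norm z ^ n"] ru
      by (simp add: norm_mult norm_power mult.assoc)
  qed
qed

section \<open>Euler integrals\<close>

lemma holomorphic_on_set_lebesgue_integral:
  fixes F :: "complex \<Rightarrow> 'a \<Rightarrow> complex"
  assumes S: "open S"
    and meas: "\<And>w. w \<in> S \<Longrightarrow> set_borel_measurable M A (F w)"
    and hol: "\<And>t. t \<in> A \<Longrightarrow> (\<lambda>w. F w t) holomorphic_on S"
    and bd: "\<And>w. w \<in> S \<Longrightarrow> \<exists>r>0. \<exists>h. set_integrable M A h \<and>
      (\<forall>u\<in>ball w r \<inter> S. \<forall>t\<in>A. norm (F u t) \<le> h t)"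
  shows "(\<lambda>w. LINT t:A|M. F w t) holomorphic_on S"
  unfolding set_lebesgue_integral_def
proof (rule holomorphic_on_lebesgue_integral[OF S])
  show "(\<lambda>t. indicator A t *\<^sub>R F w t) \<in> borel_measurable M" if "w \<in> S" for w
    using meas[OF that] by (simp add: set_borel_measurable_def)
  show "(\<lambda>w. indicator A t *\<^sub>R F w t) holomorphic_on S" for t
    using hol[of t] by (cases "t \<in> A") auto
  fix w assume "w \<in> S"
  then obtain r h where "r > 0" "set_integrable M A h"
      "\<forall>u\<in>ball w r \<inter> S. \<forall>t\<in>A. norm (F u t) \<le> h t"
    using bd by blast
  then show "\<exists>r>0. \<exists>h. integrable M h \<and>
      (\<forall>u\<in>ball w r \<inter> S. \<forall>t\<in>space M. norm (indicator A t *\<^sub>R F u t) \<le> h t)"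
    by (intro exI[of _ r] conjI exI[of _ "\<lambda>t. indicator A t *\<^sub>R h t"])
      (auto simp: set_integrable_def indicator_def)
qed

text \<open>The identity theorem with a real interval as the set of agreement; its midpoint serves
  as the limit point. Every continuation in a parameter below is an instance.\<close>

lemma holomorphic_eq_from_reals:
  fixes f g :: "complex \<Rightarrow> complex"
  assumes hol: "f holomorphic_on S" "g holomorphic_on S" and S: "open S" "connected S"
    and lu: "l < u" "\<And>x. l < x \<Longrightarrow> x < u \<Longrightarrow> of_real x \<in> S"
    and eq: "\<And>x. l < x \<Longrightarrow> x < u \<Longrightarrow> f (of_real x) = g (of_real x)"
    and z: "z \<in> S"
  shows "f z = g z"
proof -
  define m where "m = (l + u) / 2"
  have m: "l < m" "m < u" using lu by (auto simp: m_def)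
  have "of_real m islimpt complex_of_real ` {l<..<u}"
    unfolding islimpt_approachable
  proof (intro allI impI)
    fix e :: real assume e: "e > 0"
    obtain d where "0 < d" "d < min e (u - m)"
      using dense[of 0 "min e (u - m)"] e m by auto
    then show "\<exists>x'\<in>complex_of_real ` {l<..<u}. x' \<noteq> of_real m \<and> dist x' (of_real m) < e"
      using m by (intro bexI[of _ "of_real (m + d)"]) (auto simp: dist_real_def simp del: of_real_add)
  qed
  then have "f z - g z = 0"
    by (rule analytic_continuation[where f = "\<lambda>w. f w - g w" and S = S and \<xi> = "of_real m"
          and U = "complex_of_real ` {l<..<u}", rotated 5])
      (use lu eq z m hol S in \<open>auto intro: holomorphic_on_diff\<close>)
  then show ?thesis by simp
qed

section \<open>Powers of positive reals and Beta integrals\<close>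

lemma norm_of_real_powr:
  assumes "t > 0" shows "norm (complex_of_real t powr z) = t powr Re z"
  using assms by (simp add: norm_powr_real_powr)

lemma continuous_on_of_real_powr [continuous_intros]:
  assumes "continuous_on A f" "\<And>t. t \<in> A \<Longrightarrow> f t > 0"
  shows "continuous_on A (\<lambda>t. complex_of_real (f t) powr z)"
proof (rule continuous_on_powr_complex)
  show "A \<subseteq> {t. 0 \<le> Re (complex_of_real (f t)) \<or> Im (complex_of_real (f t)) \<noteq> 0}"
    using assms(2) by (auto intro: less_imp_le)
  show "0 < Re z" if "t \<in> A" "complex_of_real (f t) = 0" for t
    using assms(2)[OF that(1)] that(2) by simp
qed (intro continuous_intros assms)+

lemma continuous_on_powr_slit:
  fixes f :: "'a::topological_space \<Rightarrow> complex"
  assumes "continuous_on A f" "\<And>t. t \<in> A \<Longrightarrow> f t \<notin> \<real>\<^sub>\<le>\<^sub>0"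
  shows "continuous_on A (\<lambda>t. f t powr z)"
proof -
  have "f t \<noteq> 0" if "t \<in> A" for t using assms(2)[OF that] by auto
  moreover have "continuous_on A (\<lambda>t. exp (z * Ln (f t)))"
    by (intro continuous_intros assms)
  ultimately show ?thesis by (subst continuous_on_cong[OF refl]) (auto simp: powr_def)
qed

lemma set_borel_measurable_lborel:
  fixes f :: "real \<Rightarrow> 'a::real_normed_vector"
  assumes "open A" "continuous_on A f"
  shows "set_borel_measurable lborel A f"
  using borel_measurable_continuous_on_indicator[of A f] assms
  by (simp add: set_borel_measurable_def)

lemma real_Beta_integral:
  assumes "a > 0" "b > (0::real)"
  shows "set_integrable lborel {0<..<1} (\<lambda>t. t powr (a - 1) * (1 - t) powr (b - 1))"
    and "(LBINT t:{0<..<1}. t powr (a - 1) * (1 - t) powr (b - 1)) = Beta a b"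
proof -
  show i: "set_integrable lborel {0<..<1} (\<lambda>t. t powr (a - 1) * (1 - t) powr (b - 1))"
    by (rule set_integrable_subset[OF integrable_Beta[OF assms]]) auto
  show "(LBINT t:{0<..<1}. t powr (a - 1) * (1 - t) powr (b - 1)) = Beta a b"
    using has_integral_Beta_real[OF assms] set_borel_integral_eq_integral(2)[OF i]
    by (simp add: has_integral_Icc_iff_Ioo integral_unique)
qed

lemma complex_Beta_integrable:
  assumes "Re a > 0" "Re b > 0"
  shows "set_integrable lborel {0<..<1} (\<lambda>t. complex_of_real t powr (a - 1) * of_real (1 - t) powr (b - 1))"
  by (rule set_integrable_bound[OF real_Beta_integral(1)[OF assms]])
    (auto intro!: set_borel_measurable_lborel continuous_intros AE_I2 simp: norm_mult norm_of_real_powr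
      simp del: of_real_diff)

lemma holomorphic_Beta_integral:
  assumes b: "Re b > 0"
  shows "(\<lambda>a. LBINT t:{0<..<1}. complex_of_real t powr (a - 1) * of_real (1 - t) powr (b - 1))
    holomorphic_on {a. Re a > 0}"
proof (rule holomorphic_on_set_lebesgue_integral)
  show "open {a. Re a > 0}" by (rule open_halfspace_Re_gt)
  fix w assume w: "w \<in> {a. Re a > 0}"
  show "set_borel_measurable lborel {0<..<1} (\<lambda>t. complex_of_real t powr (w - 1) * of_real (1 - t) powr (b - 1))"
    by (intro set_borel_measurable_lborel continuous_intros) auto
  show "\<exists>r>0. \<exists>h. set_integrable lborel {0<..<1} h \<and> (\<forall>u\<in>ball w r \<inter> {a. 0 < Re a}. \<forall>t\<in>{0<..<1}.
      norm (complex_of_real t powr (u - 1) * of_real (1 - t) powr (b - 1)) \<le> h t)"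
  proof (intro exI conjI ballI)
    show "Re w / 2 > 0" using w by simp
    then show "set_integrable lborel {0<..<1} (\<lambda>t. t powr (Re w / 2 - 1) * (1 - t) powr (Re b - 1))"
      by (intro real_Beta_integral(1) b)
    fix u t assume u: "u \<in> ball w (Re w / 2) \<inter> {a. 0 < Re a}" and t: "t \<in> {0<..<1::real}"
    have "Re w - Re u < Re w / 2"
      using u complex_Re_le_cmod[of "w - u"] by (simp add: dist_norm)
    then have "t powr (Re u - 1) \<le> t powr (Re w / 2 - 1)"
      using t by (intro powr_mono') auto
    then show "norm (complex_of_real t powr (u - 1) * of_real (1 - t) powr (b - 1))
        \<le> t powr (Re w / 2 - 1) * (1 - t) powr (Re b - 1)"
      using t by (auto simp: norm_mult norm_of_real_powr simp del: of_real_diff intro!: mult_right_mono)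
  qed
qed (auto intro!: holomorphic_intros)

lemma set_lebesgue_integral_reflect:
  fixes f :: "real \<Rightarrow> 'a::{banach, second_countable_topology}"
  shows "(LBINT t:{0<..<1}. f t) = (LBINT t:{0<..<1}. f (1 - t))"
proof -
  have "(LBINT t:{0<..<1}. f t) = (\<integral>t. indicator {0<..<1} (1 - t) *\<^sub>R f (1 - t) \<partial>lborel)"
    unfolding set_lebesgue_integral_def
    using lborel_integral_real_affine[of "- 1" "\<lambda>t. indicator {0<..<1} t *\<^sub>R f t" 1] by simp
  also have "\<dots> = (LBINT t:{0<..<1}. f (1 - t))"
    unfolding set_lebesgue_integral_def
    by (intro Bochner_Integration.integral_cong refl) (auto simp: indicator_def)
  finally show ?thesis .
qed

text \<open>Continuation in one argument at a time, starting from two positive reals. The reflection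
  t -> 1 - t makes the integral symmetric, so holomorphy in one argument serves for both.\<close>

lemma complex_Beta_integral:
  assumes "Re a > 0" "Re b > 0"
  shows "(LBINT t:{0<..<1}. complex_of_real t powr (a - 1) * of_real (1 - t) powr (b - 1)) = Beta a b"
proof -
  define I where "I = (\<lambda>a b. LBINT t:{0<..<1}. complex_of_real t powr (a - 1) * of_real (1 - t) powr (b - 1))"
  have sym: "I a b = I b a" for a b
    unfolding I_def by (subst set_lebesgue_integral_reflect) (simp add: mult.commute)
  have conn: "connected {a. Re a > 0}"
    by (intro convex_connected convex_halfspace_Re_gt)
  have nonpos: "z \<notin> \<int>\<^sub>\<le>\<^sub>0" if "Re z > 0" for z
    using that by (auto elim!: nonpos_Ints_cases)
  have real: "I (of_real a) (of_real b) = Beta (of_real a) (of_real b)" if "a > 0" "b > 0" for a b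
  proof -
    have "I (of_real a) (of_real b) = (LBINT t:{0<..<1}. complex_of_real (t powr (a - 1) * (1 - t) powr (b - 1)))"
      unfolding I_def by (intro set_lebesgue_integral_cong) (auto simp: powr_of_real[symmetric])
    also have "\<dots> = of_real (Beta a b)"
      unfolding set_integral_complex_of_real real_Beta_integral(2)[OF that] ..
    finally show ?thesis by (simp add: Beta_complex_of_real)
  qed
  have hol: "I c holomorphic_on {a. Re a > 0}" "(\<lambda>a. Beta c a) holomorphic_on {a. Re a > 0}" if "Re c > 0" for c
  proof -
    have "(\<lambda>a. I a c) holomorphic_on {a. Re a > 0}"
      unfolding I_def by (rule holomorphic_Beta_integral[OF that])
    then show "I c holomorphic_on {a. Re a > 0}" using sym[of _ c] by simp
    show "(\<lambda>a. Beta c a) holomorphic_on {a. Re a > 0}"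
      using that by (intro holomorphic_intros nonpos) auto
  qed
  have step: "I (of_real d) b = Beta (of_real d) b" if "d > 0" for d
    by (rule holomorphic_eq_from_reals[OF hol open_halfspace_Re_gt conn, where l = 0 and u = 1])
      (use that assms real in auto)
  have "I b a = Beta b a"
    by (rule holomorphic_eq_from_reals[OF hol open_halfspace_Re_gt conn, where l = 0 and u = 1])
      (use assms step sym Beta_commute in auto)
  then show ?thesis using sym[of a b] Beta_commute[of a b] by (simp add: I_def)
qed

text \<open>If 1 - z t = r <= 0 then z = (1 - r) / t >= 1 lies on the cut. Thus the principal power
  in Euler's integrand is holomorphic in z on the slit plane.\<close>

lemma one_minus_slit:
  assumes z: "z \<in> hyp2f1_slit" and t: "0 \<le> t" "t \<le> 1"
  shows "1 - z * of_real t \<notin> \<real>\<^sub>\<le>\<^sub>0"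
proof
  assume "1 - z * of_real t \<in> \<real>\<^sub>\<le>\<^sub>0"
  then obtain r where r: "r \<le> 0" "1 - z * of_real t = of_real r"
    by (auto simp: complex_nonpos_Reals_iff complex_eq_iff)
  have "t \<noteq> 0" using r by auto
  then have "z = of_real ((1 - r) / t)"
  proof -
    have "of_real t * z = of_real (1 - r)" using r(2) by (simp add: algebra_simps)
    then show ?thesis using \<open>t \<noteq> 0\<close> by (simp add: eq_divide_eq mult.commute)
  qed
  moreover have "(1 - r) / t \<ge> 1" using \<open>t \<noteq> 0\<close> t r(1) by (simp add: le_divide_eq)
  ultimately show False using z unfolding hyp2f1_slit_def by blast
qed

lemma real_mem_slit: "z < 1 \<Longrightarrow> complex_of_real z \<in> hyp2f1_slit"
  by (auto simp: hyp2f1_slit_def)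

text \<open>Euler's integrand: b and c - b are the parameters of the Beta density, and a is the
  exponent of the factor that depends on z.\<close>

definition euler_kernel :: "complex \<Rightarrow> complex \<Rightarrow> complex \<Rightarrow> complex \<Rightarrow> real \<Rightarrow> complex" where
  "euler_kernel a b c z t =
     of_real t powr (b - 1) * of_real (1 - t) powr (c - b - 1) * (1 - z * of_real t) powr (- a)"

lemma euler_kernel_measurable:
  assumes "z \<in> hyp2f1_slit"
  shows "set_borel_measurable lborel {0<..<1} (euler_kernel a b c z)"
proof -
  have "continuous_on {0<..<1} (\<lambda>t. (1 - z * of_real t) powr (- a))"
  proof (rule continuous_on_powr_slit)
    show "1 - z * of_real t \<notin> \<real>\<^sub>\<le>\<^sub>0" if "t \<in> {0<..<1}" for t
      using that by (intro one_minus_slit[OF assms]) auto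
  qed (intro continuous_intros)
  then have "continuous_on {0<..<1} (euler_kernel a b c z)" unfolding euler_kernel_def
    by (intro continuous_on_mult continuous_on_of_real_powr) (auto intro!: continuous_intros)
  then show ?thesis by (rule set_borel_measurable_lborel[OF open_greaterThanLessThan])
qed

text \<open>The factor with z is continuous on the compact set
  \<open>cball z r \<times> {0..1}\<close>, hence bounded there; what remains is a Beta
  density.\<close>

lemma euler_kernel_bound:
  assumes bc: "Re b > 0" "Re c > Re b" and z: "z \<in> hyp2f1_slit"
  shows "\<exists>r>0. \<exists>h. set_integrable lborel {0<..<1} h \<and>
    (\<forall>u\<in>ball z r \<inter> hyp2f1_slit. \<forall>t\<in>{0<..<1}. norm (euler_kernel a b c u t) \<le> h t)"
proof -
  obtain r where r: "r > 0" "cball z r \<subseteq> hyp2f1_slit"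
    using open_hyp2f1_slit z open_contains_cball by blast
  have "continuous_on (cball z r \<times> {0..1}) (\<lambda>(u, t). (1 - u * of_real t) powr (- a))"
  proof -
    have "1 - fst x * of_real (snd x) \<notin> \<real>\<^sub>\<le>\<^sub>0" if "x \<in> cball z r \<times> {0..1}" for x
      using that r by (intro one_minus_slit) auto
    then have "continuous_on (cball z r \<times> {0..1}) (\<lambda>x. (1 - fst x * of_real (snd x)) powr (- a))"
      by (intro continuous_on_powr_slit) (auto intro!: continuous_intros)
    then show ?thesis by (simp add: case_prod_beta)
  qed
  then have "bounded ((\<lambda>(u, t). (1 - u * of_real t) powr (- a)) ` (cball z r \<times> {0..1}))"
    by (intro compact_imp_bounded compact_continuous_image compact_Times) auto
  then obtain B where B: "\<And>u t. u \<in> cball z r \<Longrightarrow> t \<in> {0..1} \<Longrightarrow> norm ((1 - u * of_real t) powr (- a)) \<le> B"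
    unfolding bounded_iff by fastforce
  define h where "h = (\<lambda>t::real. B * (t powr (Re b - 1) * (1 - t) powr (Re c - Re b - 1)))"
  show ?thesis
  proof (intro exI[of _ r] conjI exI[of _ h] ballI)
    show "set_integrable lborel {0<..<1} h" unfolding h_def
      using bc by (intro set_integrable_mult_right real_Beta_integral(1)) auto
    fix u t assume ut: "u \<in> ball z r \<inter> hyp2f1_slit" "t \<in> {0<..<1::real}"
    have "norm (euler_kernel a b c u t) =
        norm ((1 - u * of_real t) powr (- a)) * (t powr (Re b - 1) * (1 - t) powr (Re c - Re b - 1))"
      using ut by (simp add: euler_kernel_def norm_mult norm_of_real_powr mult_ac del: of_real_diff)
    also have "\<dots> \<le> h t" unfolding h_def
      by (intro mult_right_mono B) (use ut in auto)
    finally show "norm (euler_kernel a b c u t) \<le> h t" .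
  qed (use r in auto)
qed

lemma euler_kernel_integrable:
  assumes bc: "Re b > 0" "Re c > Re b" and z: "z \<in> hyp2f1_slit"
  shows "set_integrable lborel {0<..<1} (euler_kernel a b c z)"
proof -
  obtain r h where h: "r > 0" "set_integrable lborel {0<..<1} h"
      "\<And>u t. u \<in> ball z r \<inter> hyp2f1_slit \<Longrightarrow> t \<in> {0<..<1} \<Longrightarrow> norm (euler_kernel a b c u t) \<le> h t"
    using euler_kernel_bound[OF assms, of a] by blast
  show ?thesis
    by (rule set_integrable_bound[OF h(2) euler_kernel_measurable[OF z]])
      (use h(1) z in \<open>auto intro!: AE_I2 order_trans[OF h(3)] abs_ge_self\<close>)
qed

lemma euler_integral_holomorphic:
  assumes bc: "Re b > 0" "Re c > Re b"
  shows "(\<lambda>z. LBINT t:{0<..<1}. euler_kernel a b c z t) holomorphic_on hyp2f1_slit"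
proof (rule holomorphic_on_set_lebesgue_integral[OF open_hyp2f1_slit])
  show "(\<lambda>z. euler_kernel a b c z t) holomorphic_on hyp2f1_slit" if "t \<in> {0<..<1}" for t
    unfolding euler_kernel_def using that
    by (intro holomorphic_intros one_minus_slit) auto
qed (use euler_kernel_measurable euler_kernel_bound[OF bc] in auto)

lemma Beta_add_of_nat_left:
  fixes b d :: complex
  assumes "Re b > 0" "Re d > 0"
  shows "Beta (b + of_nat n) d = Beta b d * pochhammer b n / pochhammer (b + d) n"
proof -
  have nonpos: "z \<notin> \<int>\<^sub>\<le>\<^sub>0" if "Re z > 0" for z
    using that by (auto elim!: nonpos_Ints_cases)
  have "Gamma b \<noteq> 0" "Gamma (b + d) \<noteq> 0" "Gamma (b + d + of_nat n) \<noteq> 0"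
    by (intro Gamma_nonzero nonpos; use assms in simp)+
  then show ?thesis
    using assms by (simp add: Beta_def pochhammer_Gamma[OF nonpos] field_simps)
qed

text \<open>Expand (1 - z t)^(-a) binomially and integrate termwise. Since t^n <= 1, the L1 norms of
  the terms are at most |p n| times one fixed Beta value, and the |p n| are summable.\<close>

lemma euler_integral_series:
  assumes bc: "Re b > 0" "Re c > Re b" and z: "norm z < 1"
  shows "(LBINT t:{0<..<1}. euler_kernel a b c z t) = Beta b (c - b) * gauss_series a b c z"
proof -
  define p where "p = (\<lambda>n. pochhammer a n / fact n * z ^ n)"
  define k where "k = (\<lambda>n t. p n * (of_real t powr (b + of_nat n - 1) * of_real (1 - t) powr (c - b - 1)))"
  define F where "F = (\<lambda>n t. indicator {0<..<1} t *\<^sub>R k n t)"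
  have ki: "set_integrable lborel {0<..<1} (k n)" for n
    unfolding k_def using bc by (intro set_integrable_mult_right complex_Beta_integrable) auto
  have sump: "summable (\<lambda>n. norm (p n))"
  proof (rule summable_comparison_test'[where N = 0])
    show "summable (\<lambda>n. pochhammer (norm a) n / fact n * norm z ^ n)"
      by (rule sums_summable[OF binomial_series_negative]) (use z in auto)
    show "norm (norm (p n)) \<le> pochhammer (norm a) n / fact n * norm z ^ n" for n
      using norm_pochhammer_le[of a "norm a" n]
      by (auto simp: p_def norm_mult norm_divide norm_power intro!: mult_right_mono divide_right_mono)
  qed
  have kt: "k n t = (of_real t powr (b - 1) * of_real (1 - t) powr (c - b - 1)) * (p n * of_real t ^ n)"
    if "t \<in> {0<..<1}" for n t
  proof -
    have e: "b + of_nat n - 1 = (b - 1) + of_nat n" by simp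
    have "complex_of_real t \<noteq> 0" using that by simp
    then show ?thesis unfolding k_def e powr_add powr_complexpow[OF \<open>complex_of_real t \<noteq> 0\<close>]
      by (simp only: mult_ac)
  qed
  have ks: "(\<lambda>n. k n t) sums euler_kernel a b c z t" if t: "t \<in> {0<..<1}" for t
  proof -
    have "(\<lambda>n. pochhammer a n / fact n * (z * of_real t) ^ n) sums (1 - z * of_real t) powr (- a)"
    proof (rule binomial_series_negative_complex)
      have "norm z * t \<le> norm z * 1" using t by (intro mult_left_mono) auto
      then show "norm (z * of_real t) < 1" using t z by (simp add: norm_mult)
    qed
    then have "(\<lambda>n. p n * of_real t ^ n) sums (1 - z * of_real t) powr (- a)"
      by (simp add: p_def power_mult_distrib mult_ac)
    then show ?thesis unfolding kt[OF t] euler_kernel_def by (rule sums_mult)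
  qed
  have "(\<lambda>n. integral\<^sup>L lborel (F n)) sums (\<integral>t. (\<Sum>n. F n t) \<partial>lborel)"
  proof (rule sums_integral)
    show "integrable lborel (F n)" for n
      using ki[of n] by (simp add: F_def set_integrable_def)
    show "AE t in lborel. summable (\<lambda>n. norm (F n t))"
    proof (rule AE_I2)
      fix t :: real
      show "summable (\<lambda>n. norm (F n t))"
      proof (cases "t \<in> {0<..<1}")
        case True
        have "summable (\<lambda>n. norm (of_real t powr (b - 1) * of_real (1 - t) powr (c - b - 1) :: complex) * norm (p n * of_real t ^ n))"
        proof (intro summable_mult summable_comparison_test'[OF sump, where N = 0])
          show "norm (norm (p n * of_real t ^ n)) \<le> norm (p n)" for n
            using True by (simp add: norm_mult norm_power mult_left_le power_le_one)
        qed
        then show ?thesis using True kt[OF True] by (simp add: F_def norm_mult)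
      qed (simp add: F_def)
    qed
    show "summable (\<lambda>n. \<integral>t. norm (F n t) \<partial>lborel)"
    proof (rule summable_comparison_test'[OF summable_mult2[OF sump, of "Beta (Re b) (Re c - Re b)"], where N = 0])
      fix n :: nat
      have "(\<integral>t. norm (F n t) \<partial>lborel) \<le> (\<integral>t. norm (p n) * (indicator {0<..<1} t *\<^sub>R (t powr (Re b - 1) * (1 - t) powr (Re c - Re b - 1))) \<partial>lborel)"
      proof (rule integral_mono)
        show "integrable lborel (\<lambda>t. norm (F n t))"
          using ki[of n] unfolding F_def set_integrable_def by (rule integrable_norm)
        show "integrable lborel (\<lambda>t. norm (p n) * (indicator {0<..<1} t *\<^sub>R (t powr (Re b - 1) * (1 - t) powr (Re c - Re b - 1))))"
          using real_Beta_integral(1)[of "Re b" "Re c - Re b"] bc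
          by (simp add: set_integrable_def)
        fix t :: real
        show "norm (F n t) \<le> norm (p n) * (indicator {0<..<1} t *\<^sub>R (t powr (Re b - 1) * (1 - t) powr (Re c - Re b - 1)))"
        proof (cases "t \<in> {0<..<1}")
          case True
          have "norm (k n t) = (t powr (Re b - 1) * (1 - t) powr (Re c - Re b - 1)) * (norm (p n) * t ^ n)"
            unfolding kt[OF True] using True by (simp add: norm_mult norm_of_real_powr norm_power del: of_real_diff)
          also have "\<dots> \<le> (t powr (Re b - 1) * (1 - t) powr (Re c - Re b - 1)) * (norm (p n) * 1)"
            using True by (intro mult_left_mono) (auto simp: power_le_one)
          finally show ?thesis using True by (simp add: F_def mult_ac)
        qed (simp add: F_def)
      qed
      also have "\<dots> = norm (p n) * Beta (Re b) (Re c - Re b)"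
        using real_Beta_integral(2)[of "Re b" "Re c - Re b"] bc
        by (simp add: set_lebesgue_integral_def)
      finally show "norm (\<integral>t. norm (F n t) \<partial>lborel) \<le> norm (p n) * Beta (Re b) (Re c - Re b)"
        by (simp add: integral_nonneg_AE)
    qed
  qed
  moreover have "integral\<^sup>L lborel (F n) = Beta b (c - b) * (gauss_coeff a b c n * z ^ n)" for n
  proof -
    have "integral\<^sup>L lborel (F n) = (LBINT t:{0<..<1}. k n t)"
      by (simp add: F_def set_lebesgue_integral_def)
    also have "\<dots> = p n * Beta (b + of_nat n) (c - b)"
      unfolding k_def set_integral_mult_right
      by (subst complex_Beta_integral) (use bc in auto)
    also have "\<dots> = Beta b (c - b) * (gauss_coeff a b c n * z ^ n)"
    proof -
      have "Beta (b + of_nat n) (c - b) = Beta b (c - b) * pochhammer b n / pochhammer c n"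
        using Beta_add_of_nat_left[of b "c - b" n] bc by simp
      then show ?thesis
        by (simp only: p_def gauss_coeff_def times_divide_eq_left times_divide_eq_right
            divide_divide_eq_left mult_ac)
    qed
    finally show ?thesis .
  qed
  moreover have "(\<integral>t. (\<Sum>n. F n t) \<partial>lborel) = (LBINT t:{0<..<1}. euler_kernel a b c z t)"
    unfolding set_lebesgue_integral_def
  proof (intro Bochner_Integration.integral_cong refl)
    fix t :: real
    show "(\<Sum>n. F n t) = indicator {0<..<1} t *\<^sub>R euler_kernel a b c z t"
    proof (cases "t \<in> {0<..<1}")
      case True
      show ?thesis using sums_unique[OF ks[OF True]] True by (simp add: F_def)
    qed (simp add: F_def)
  qed
  ultimately have "(\<lambda>n. Beta b (c - b) * (gauss_coeff a b c n * z ^ n)) sums (LBINT t:{0<..<1}. euler_kernel a b c z t)"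
    by (simp only:)
  moreover have "(\<lambda>n. Beta b (c - b) * (gauss_coeff a b c n * z ^ n)) sums (Beta b (c - b) * gauss_series a b c z)"
    unfolding gauss_series_def
    by (rule sums_mult[OF summable_sums[OF summable_gauss_series[OF _ z]]]) (use bc in auto)
  ultimately show ?thesis by (rule sums_unique2)
qed

section \<open>Analytic continuation of the Gauss series\<close>

declare fps_hypergeo_nth [simp del]

text \<open>The germ at 0 is recorded as a formal power series, so that contiguous relations, which
  involve derivatives and polynomial factors, reduce to identities between coefficients.\<close>

definition gauss_continuable :: "complex \<Rightarrow> complex \<Rightarrow> complex \<Rightarrow> bool" where
  "gauss_continuable a b c \<longleftrightarrow>
     (\<exists>f. f holomorphic_on hyp2f1_slit \<and> f has_fps_expansion fps_hypergeo [a, b] [c] 1)"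

lemma hypergeo_has_fps_expansion:
  assumes "Re c > 0"
  shows "gauss_series a b c has_fps_expansion fps_hypergeo [a, b] [c] 1"
proof -
  have "fps_conv_radius (fps_hypergeo [a, b] [c] 1) > 0"
    using fps_conv_radius_hypergeo[OF assms, of a b] by (rule order.strict_trans2[rotated]) simp
  then have "eval_fps (fps_hypergeo [a, b] [c] 1) has_fps_expansion fps_hypergeo [a, b] [c] 1"
    by (rule eval_fps_has_fps_expansion)
  then show ?thesis unfolding eval_fps_hypergeo[abs_def] .
qed

lemma gauss_continuable_euler:
  assumes "Re b > 0" "Re c > Re b"
  shows "gauss_continuable a b c"
proof -
  define f where "f = (\<lambda>z. (LBINT t:{0<..<1}. euler_kernel a b c z t) / Beta b (c - b))"
  have nonpos: "z \<notin> \<int>\<^sub>\<le>\<^sub>0" if "Re z > 0" for z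
    using that by (auto elim!: nonpos_Ints_cases)
  have B: "Beta b (c - b) \<noteq> 0"
    using assms by (auto simp: Beta_def Gamma_eq_zero_iff nonpos)
  have "f holomorphic_on hyp2f1_slit"
    unfolding f_def using B by (intro holomorphic_intros euler_integral_holomorphic assms) auto
  moreover have "f has_fps_expansion fps_hypergeo [a, b] [c] 1"
  proof -
    have "\<forall>\<^sub>F z in nhds 0. z \<in> ball (0::complex) 1"
      by (intro eventually_nhds_in_open) auto
    then have ev: "\<forall>\<^sub>F z in nhds 0. f z = gauss_series a b c z"
      by eventually_elim (use B euler_integral_series[OF assms] in \<open>auto simp: f_def\<close>)
    have "Re c > 0" using assms by simp
    from hypergeo_has_fps_expansion[OF this] show ?thesis
      using has_fps_expansion_cong[OF ev refl] by blast
  qed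
  ultimately show ?thesis unfolding gauss_continuable_def by blast
qed

lemma gauss_coeff_0 [simp]: "gauss_coeff a b c 0 = 1"
  by (simp add: gauss_coeff_def)

lemma
  fixes c :: complex
  assumes "Re c > 0"
  shows pochhammer_Re_pos_nonzero: "pochhammer c n \<noteq> 0"
    and add_of_nat_Re_pos_nonzero: "c + of_nat n \<noteq> 0"
proof -
  have "c \<noteq> - of_nat k" for k using assms by auto
  then show "pochhammer c n \<noteq> 0" by (simp add: pochhammer_eq_0_iff)
  have "Re (c + of_nat n) \<noteq> 0" using assms by simp
  then show "c + of_nat n \<noteq> 0" by (metis zero_complex.sel(1))
qed

text \<open>The contiguous relation F(c) = F(c + 1) + (z / c) F'(c + 1): the operator 1 + (z / c)
  d/dz multiplies the n-th coefficient by (c + n) / c.\<close>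

lemma gauss_continuable_lower_c:
  assumes c: "Re c > 0" and g: "gauss_continuable a b (c + 1)"
  shows "gauss_continuable a b c"
proof -
  let ?F = "fps_hypergeo [a, b] [c + 1] 1"
  obtain f where f: "f holomorphic_on hyp2f1_slit" "f has_fps_expansion ?F"
    using g unfolding gauss_continuable_def by blast
  have c0: "c \<noteq> 0" using c by auto
  let ?g = "\<lambda>z. f z + (1 / c) * (z * deriv f z)"
  have "?g holomorphic_on hyp2f1_slit"
    by (intro holomorphic_intros f holomorphic_deriv open_hyp2f1_slit)
  moreover have "?g has_fps_expansion (?F + fps_const (1 / c) * (fps_X * fps_deriv ?F))"
    by (intro fps_expansion_intros f)
  moreover have "?F + fps_const (1 / c) * (fps_X * fps_deriv ?F) = fps_hypergeo [a, b] [c] 1"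
  proof (rule fps_ext)
    fix n
    have nz: "pochhammer c n \<noteq> 0" "c + of_nat n \<noteq> 0"
      using pochhammer_Re_pos_nonzero[OF c] add_of_nat_Re_pos_nonzero[OF c] by auto
    have p: "pochhammer (c + 1) n = pochhammer c n * (c + of_nat n) / c"
      using c0 pochhammer_rec[of c n] by (simp add: pochhammer_Suc field_simps)
    have "(?F + fps_const (1 / c) * (fps_X * fps_deriv ?F)) $ n = gauss_coeff a b (c + 1) n * (1 + of_nat n / c)"
      by (cases n) (auto simp: algebra_simps add_divide_distrib)
    also have "gauss_coeff a b (c + 1) n = gauss_coeff a b c n * (c / (c + of_nat n))"
      unfolding gauss_coeff_def p by simp
    also have "1 + of_nat n / c = (c + of_nat n) / c"
      using c0 by (simp add: add_divide_distrib)
    also have "gauss_coeff a b c n * (c / (c + of_nat n)) * ((c + of_nat n) / c) = gauss_coeff a b c n"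
      using nz c0 by simp
    finally show "(?F + fps_const (1 / c) * (fps_X * fps_deriv ?F)) $ n = fps_hypergeo [a, b] [c] 1 $ n"
      by simp
  qed
  ultimately show ?thesis unfolding gauss_continuable_def by metis
qed

text \<open>The contiguous relation d F(b) = z (1 - z) F'(b + 1) + (d - a z) F(b + 1) with d = c - b
  - 1. Its multipliers are polynomials, so no singularity arises on the slit plane; one only has to
  divide by d.\<close>

lemma gauss_continuable_lower_b:
  assumes c: "Re c > 0" and bc: "c - b - 1 \<noteq> 0" and g: "gauss_continuable a (b + 1) c"
  shows "gauss_continuable a b c"
proof -
  let ?F = "fps_hypergeo [a, b + 1] [c] 1"
  obtain f where f: "f holomorphic_on hyp2f1_slit" "f has_fps_expansion ?F"
    using g unfolding gauss_continuable_def by blast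
  define d where "d = c - b - 1"
  let ?g = "\<lambda>z. (1 / d) * (z * deriv f z - z * (z * deriv f z) + d * f z - a * (z * f z))"
  let ?G = "fps_const (1 / d) * (fps_X * fps_deriv ?F - fps_X * (fps_X * fps_deriv ?F) + fps_const d * ?F
    - fps_const a * (fps_X * ?F))"
  have "?g holomorphic_on hyp2f1_slit"
    by (intro holomorphic_intros f holomorphic_deriv open_hyp2f1_slit)
  moreover have "?g has_fps_expansion ?G"
    by (intro fps_expansion_intros f)
  moreover have "?G = fps_hypergeo [a, b] [c] 1"
  proof (rule fps_ext)
    fix n
    show "?G $ n = fps_hypergeo [a, b] [c] 1 $ n"
    proof (cases n)
      case 0
      then show ?thesis using bc by (simp add: d_def)
    next
      case (Suc m)
      \<comment> \<open>The common factor of the three coefficients in the relation;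
        \<open>e1\<close>, \<open>e2\<close>, \<open>e3\<close> express each of them through
        \<open>T\<close>, after which the relation is linear algebra.\<close>
      define T where "T = pochhammer a (Suc m) * pochhammer (b + 1) m / (pochhammer c (Suc m) * fact (Suc m))"
      have nz: "pochhammer c m \<noteq> 0" "c + of_nat m \<noteq> 0"
        using pochhammer_Re_pos_nonzero[OF c] add_of_nat_Re_pos_nonzero[OF c] by auto
      have e1: "gauss_coeff a (b + 1) c (Suc m) = T * (b + 1 + of_nat m)"
        by (simp add: gauss_coeff_def T_def pochhammer_Suc mult_ac)
      have e2: "gauss_coeff a b c (Suc m) = T * b"
        by (simp add: gauss_coeff_def T_def pochhammer_rec[of b] mult_ac)
      have e3: "(a + of_nat m) * gauss_coeff a (b + 1) c m = T * ((c + of_nat m) * of_nat (Suc m))"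
      proof -
        have gen: "x / ((u * q) * (s * f)) * (q * s) = x / (u * f)" if "q \<noteq> 0" "s \<noteq> 0" for q s u f x :: complex
          using that by simp
        have "(a + of_nat m) * gauss_coeff a (b + 1) c m =
            (pochhammer a m * (a + of_nat m) * pochhammer (b + 1) m) / (pochhammer c m * fact m)"
          by (simp add: gauss_coeff_def mult_ac)
        also have "\<dots> = T * ((c + of_nat m) * of_nat (Suc m))"
          unfolding T_def pochhammer_Suc fact_Suc
          by (rule gen[symmetric]) (use nz in \<open>simp_all del: of_nat_Suc\<close>)
        finally show ?thesis .
      qed
      have "?G $ n = (1 / d) * (of_nat (Suc m) * gauss_coeff a (b + 1) c (Suc m)
          - of_nat m * gauss_coeff a (b + 1) c m + d * gauss_coeff a (b + 1) c (Suc m)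
          - a * gauss_coeff a (b + 1) c m)"
        unfolding Suc by (cases m) auto
      also have "\<dots> = (1 / d) * ((of_nat (Suc m) + d) * gauss_coeff a (b + 1) c (Suc m)
          - (a + of_nat m) * gauss_coeff a (b + 1) c m)"
        by (simp add: algebra_simps)
      also have "\<dots> = (1 / d) * (T * (d * b))"
        unfolding e1 e3 by (simp add: d_def algebra_simps)
      also have "\<dots> = gauss_coeff a b c (Suc m)"
        using bc by (simp add: e2 d_def)
      finally show ?thesis by (simp add: Suc)
    qed
  qed
  ultimately show ?thesis unfolding gauss_continuable_def by metis
qed

text \<open>Raise b by N and c by M until 0 < Re (b + N) < Re (c + M), where Euler's integral
  applies, then descend by the two contiguous relations.\<close>

lemma gauss_continuable:
  assumes c: "Re c > 0"
  shows "gauss_continuable a b c"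
proof -
  obtain N :: nat where N: "- Re b < real N" using reals_Archimedean2 by blast
  obtain M :: nat where M: "Re b + real N - Re c < real M" using reals_Archimedean2 by blast
  define C where "C = c + of_nat M"
  have C: "Re C > 0" "Re b + real N < Re C" using M c by (auto simp: C_def)
  \<comment> \<open>The descent in b takes place entirely at the large parameter \<open>C\<close>:
    as Re C > Re b + N, the divisor C - (b + k) - 1 cannot vanish for k < N. Only afterwards is c
    lowered.\<close>
  have 1: "gauss_continuable a (b + of_nat k) C" if "k \<le> N" for k
    using that
  proof (induction k rule: inc_induct)
    case base
    show ?case using N C by (intro gauss_continuable_euler) auto
  next
    case (step k)
    have "C - (b + of_nat k) - 1 \<noteq> 0"
    proof
      assume "C - (b + of_nat k) - 1 = 0"
      then have "Re C = Re b + real k + 1" by (simp add: complex_eq_iff)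
      then show False using C(2) step.hyps by linarith
    qed
    moreover have "b + of_nat (Suc k) = b + of_nat k + 1" by simp
    ultimately show ?case
      using step.IH gauss_continuable_lower_b[OF C(1)] by metis
  qed
  have 2: "gauss_continuable a b (c + of_nat k)" if "k \<le> M" for k
    using that
  proof (induction k rule: inc_induct)
    case base
    show ?case using 1[of 0] by (simp add: C_def)
  next
    case (step k)
    have "c + of_nat (Suc k) = c + of_nat k + 1" by simp
    moreover have "Re (c + of_nat k) > 0" using c by simp
    ultimately show ?case
      using step.IH gauss_continuable_lower_c by metis
  qed
  from 2[of 0] show ?thesis by simp
qed

text \<open>Existence of the continuation gives the definite description in \<open>hyp2f1\<close>
  its meaning; from here on \<open>hyp2f1\<close> is used only through these two facts.\<close>

lemma
  assumes c: "Re c > 0"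
  shows hyp2f1_holomorphic: "hyp2f1 a b c holomorphic_on hyp2f1_slit"
    and hyp2f1_eq_gauss_series: "norm z < 1 \<Longrightarrow> hyp2f1 a b c z = gauss_series a b c z"
proof -
  obtain f where f: "f holomorphic_on hyp2f1_slit" "f has_fps_expansion fps_hypergeo [a, b] [c] 1"
    using gauss_continuable[OF c, of a b] unfolding gauss_continuable_def by blast
  have gs: "gauss_series a b c holomorphic_on ball 0 1"
  proof -
    have "eval_fps (fps_hypergeo [a, b] [c] 1) holomorphic_on eball 0 1"
      by (rule holomorphic_on_eval_fps) (rule eball_mono[OF fps_conv_radius_hypergeo[OF c]])
    then show ?thesis unfolding eval_fps_hypergeo[abs_def] by (simp add: one_ereal_def)
  qed
  \<comment> \<open>The expansion compares f with the series only near 0, whereas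
    \<open>hyp2f1_eqI\<close> asks for agreement on the whole unit disc; the difference has zero
    expansion, so it vanishes on the disc.\<close>
  have "(\<lambda>z. f z - gauss_series a b c z) has_fps_expansion
      (fps_hypergeo [a, b] [c] 1 - fps_hypergeo [a, b] [c] 1)"
    by (intro fps_expansion_intros f hypergeo_has_fps_expansion c)
  then have exp: "(\<lambda>z. f z - gauss_series a b c z) has_fps_expansion 0" by simp
  have "(\<lambda>z. f z - gauss_series a b c z) holomorphic_on ball 0 1"
    by (intro holomorphic_on_diff gs holomorphic_on_subset[OF f(1) ball_subset_hyp2f1_slit])
  from has_fps_expansion_0_analytic_continuation[OF exp this]
  have "f u - gauss_series a b c u = 0" if "u \<in> ball 0 1" for u using that by auto
  then have eq: "f u = gauss_series a b c u" if "u \<in> ball 0 1" for u using that by simp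
  have hf: "hyp2f1 a b c z = f z" if "z \<in> hyp2f1_slit" for z
    by (rule hyp2f1_eqI[OF f(1) _ that]) (simp add: eq eval_fps_hypergeo)
  show "hyp2f1 a b c holomorphic_on hyp2f1_slit"
    by (rule holomorphic_transform[OF f(1)]) (simp add: hf)
  show "hyp2f1 a b c z = gauss_series a b c z" if "norm z < 1"
    using that hf[of z] eq[of z] ball_subset_hyp2f1_slit by auto
qed

lemma euler_integral_eq_hyp2f1:
  assumes bc: "Re b > 0" "Re c > Re b" and z: "z \<in> hyp2f1_slit"
  shows "(LBINT t:{0<..<1}. euler_kernel a b c z t) = Beta b (c - b) * hyp2f1 a b c z"
proof (rule analytic_continuation_open[OF open_ball open_hyp2f1_slit _ connected_hyp2f1_slit
      ball_subset_hyp2f1_slit euler_integral_holomorphic[OF bc] _ _ z])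
  have c: "Re c > 0" using bc by simp
  show "(\<lambda>z. Beta b (c - b) * hyp2f1 a b c z) holomorphic_on hyp2f1_slit"
    by (intro holomorphic_intros hyp2f1_holomorphic c)
  show "(LBINT t:{0<..<1}. euler_kernel a b c z t) = Beta b (c - b) * hyp2f1 a b c z"
    if "z \<in> ball 0 1" for z
    using that euler_integral_series[OF bc, of z a] hyp2f1_eq_gauss_series[OF c, of z a b] by simp
qed auto

section \<open>Pfaff's transformation and holomorphy of the Gauss function in its parameters\<close>

lemma euler_kernel_reflect:
  fixes z t :: real
  assumes "z < 1" "t \<in> {0<..<1}"
  shows "euler_kernel a b c (of_real z) (1 - t) =
    of_real (1 - z) powr (- a) * euler_kernel a (c - b) c (of_real (z / (z - 1))) t"
proof -
  \<comment> \<open>The factorisation behind Pfaff's transformation. Reflecting t exchanges the Beta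
    parameters b and c - b and extracts 1 - z; for real z < 1 both factors are positive, so the
    principal power splits.\<close>
  have e: "1 - complex_of_real z * of_real (1 - t) = of_real ((1 - z) * (1 - z / (z - 1) * t))"
  proof -
    have "(1 - z) * (z / (z - 1)) = - z" using assms by (simp add: divide_simps algebra_simps)
    then have "(1 - z) * (z / (z - 1) * t) = - z * t" by (simp only: mult.assoc[symmetric])
    then have "1 - z * (1 - t) = (1 - z) * (1 - z / (z - 1) * t)" by (simp add: right_diff_distrib)
    then have "complex_of_real (1 - z * (1 - t)) = of_real ((1 - z) * (1 - z / (z - 1) * t))"
      by (rule arg_cong)
    moreover have "complex_of_real (1 - z * (1 - t)) = 1 - of_real z * of_real (1 - t)" by simp
    ultimately show ?thesis by (simp only:)
  qed
  have pos: "1 - z / (z - 1) * t > 0"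
  proof (cases "z \<ge> 0")
    case True
    then have "z / (z - 1) * t \<le> 0" using assms by (intro mult_nonpos_nonneg divide_nonneg_neg) auto
    then show ?thesis by simp
  next
    case False
    then have "z / (z - 1) < 1" "0 < z / (z - 1)" using assms by (auto simp: divide_simps)
    then have "z / (z - 1) * t < 1 * 1" using assms by (intro mult_strict_mono) auto
    then show ?thesis by simp
  qed
  have "complex_of_real ((1 - z) * (1 - z / (z - 1) * t)) powr (- a) =
      of_real (1 - z) powr (- a) * of_real (1 - z / (z - 1) * t) powr (- a)"
    unfolding of_real_mult[of "1 - z"] using assms pos by (intro powr_times_real) (auto simp del: of_real_diff of_real_mult of_real_divide simp: less_imp_le)
  moreover have "1 - (1 - t) = t" "c - (c - b) = b"
      "1 - complex_of_real (z / (z - 1)) * of_real t = of_real (1 - z / (z - 1) * t)"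
    by simp_all
  ultimately show ?thesis unfolding euler_kernel_def e by (simp only: mult_ac)
qed

text \<open>For fixed c both sides are holomorphic in b, so it suffices to compare the Euler integrals
  of the two sides for real b between 0 and Re c.\<close>

lemma gauss_series_Pfaff:
  fixes z :: real
  assumes c: "Re c > 0" and z: "\<bar>z\<bar> < 1 / 2"
  shows "gauss_series a b c (of_real z) =
    of_real (1 - z) powr (- a) * gauss_series a (c - b) c (of_real (z / (z - 1)))"
proof -
  have nonpos: "z \<notin> \<int>\<^sub>\<le>\<^sub>0" if "Re z > 0" for z
    using that by (auto elim!: nonpos_Ints_cases)
  have z1: "z < 1" "\<bar>z\<bar> < 1" using z by auto
  \<comment> \<open>The restriction |z| < 1/2 keeps both z and z / (z - 1) in the unit disc, so that
    both sides are convergent series.\<close>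
  have w: "\<bar>z / (z - 1)\<bar> < 1" using z by (auto simp: abs_if divide_simps split: if_splits)
  then have w1: "z / (z - 1) < 1" by (rule order_le_less_trans[OF abs_ge_self])
  show ?thesis
  proof (rule holomorphic_eq_from_reals[where S = UNIV and l = 0 and u = "Re c" and z = b and
        f = "\<lambda>b. gauss_series a b c (of_real z)" and
        g = "\<lambda>b. of_real (1 - z) powr (- a) * gauss_series a (c - b) c (of_real (z / (z - 1)))"])
    show "(\<lambda>b. gauss_series a b c (of_real z)) holomorphic_on UNIV"
      by (rule holomorphic_gauss_series_params) (use c z1 in \<open>auto intro!: holomorphic_intros\<close>)
    show "(\<lambda>b. of_real (1 - z) powr (- a) * gauss_series a (c - b) c (of_real (z / (z - 1)))) holomorphic_on UNIV"
      by (intro holomorphic_on_mult holomorphic_on_const holomorphic_gauss_series_params)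
        (use c w in \<open>auto intro!: holomorphic_intros simp del: of_real_divide of_real_diff\<close>)
    fix x :: real assume x: "0 < x" "x < Re c"
    let ?b = "complex_of_real x"
    have B: "Beta ?b (c - ?b) \<noteq> 0"
      using x c by (auto simp: Beta_def Gamma_eq_zero_iff nonpos)
    have "Beta ?b (c - ?b) * gauss_series a ?b c (of_real z) = (LBINT t:{0<..<1}. euler_kernel a ?b c (of_real z) t)"
      by (rule euler_integral_series[symmetric]) (use x z1 in auto)
    also have "\<dots> = (LBINT t:{0<..<1}. euler_kernel a ?b c (of_real z) (1 - t))"
      by (rule set_lebesgue_integral_reflect)
    also have "\<dots> = (LBINT t:{0<..<1}. of_real (1 - z) powr (- a) * euler_kernel a (c - ?b) c (of_real (z / (z - 1))) t)"
      by (rule set_lebesgue_integral_cong) (use euler_kernel_reflect[OF z1(1)] in auto)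
    also have "\<dots> = of_real (1 - z) powr (- a) * (Beta (c - ?b) (c - (c - ?b)) * gauss_series a (c - ?b) c (of_real (z / (z - 1))))"
      by (subst set_integral_mult_right, subst euler_integral_series)
        (use x w in \<open>auto simp del: of_real_divide of_real_diff\<close>)
    also have "\<dots> = Beta ?b (c - ?b) * (of_real (1 - z) powr (- a) * gauss_series a (c - ?b) c (of_real (z / (z - 1))))"
      by (simp add: Beta_commute mult_ac)
    finally show "gauss_series a ?b c (of_real z) = of_real (1 - z) powr (- a) * gauss_series a (c - ?b) c (of_real (z / (z - 1)))"
      using B by simp
  qed (use c in auto)
qed

text \<open>The map z / (z - 1) sends the half-plane Re z < 1/2 into the unit disc, since there |z|
  < |z - 1|. Hence the right-hand side stays a convergent series for every negative z, however
  large, and the identity theorem extends the formula from |z| < 1/2.\<close>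

lemma hyp2f1_Pfaff:
  fixes z :: real
  assumes c: "Re c > 0" and z: "z < 1 / 2"
  shows "hyp2f1 a b c (of_real z) =
    of_real (1 - z) powr (- a) * gauss_series a (c - b) c (of_real (z / (z - 1)))"
proof -
  let ?S = "{z::complex. Re z < 1 / 2}"
  have w: "z / (z - 1) \<in> ball 0 1" if "z \<in> ?S" for z :: complex
  proof -
    have "(norm z)\<^sup>2 < (norm (z - 1))\<^sup>2"
      using that unfolding cmod_power2 by (simp add: power2_eq_square algebra_simps)
    then have "norm z < norm (z - 1)" by (rule power2_less_imp_less) simp
    then have "norm (z / (z - 1)) < 1" by (auto simp: norm_divide divide_less_eq)
    then show ?thesis by simp
  qed
  have gs: "gauss_series a (c - b) c holomorphic_on ball 0 1"
    by (rule holomorphic_transform[OF holomorphic_on_subset[OF hyp2f1_holomorphic[OF c] ball_subset_hyp2f1_slit]])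
      (simp add: hyp2f1_eq_gauss_series[OF c])
  have z0: "1 - z \<notin> \<real>\<^sub>\<le>\<^sub>0" if "z \<in> ?S" for z
    using that by (auto simp: complex_nonpos_Reals_iff)
  have "hyp2f1 a b c (of_real z) = (1 - of_real z) powr (- a) * gauss_series a (c - b) c (of_real z / (of_real z - 1))"
  proof (rule holomorphic_eq_from_reals[where S = ?S and l = "- 1 / 2" and u = "1 / 2" and z = "of_real z" and
        f = "hyp2f1 a b c" and g = "\<lambda>z. (1 - z) powr (- a) * gauss_series a (c - b) c (z / (z - 1))"])
    have "?S \<subseteq> hyp2f1_slit" by (auto simp: hyp2f1_slit_def)
    then show "hyp2f1 a b c holomorphic_on ?S"
      by (rule holomorphic_on_subset[OF hyp2f1_holomorphic[OF c]])
    have "(gauss_series a (c - b) c \<circ> (\<lambda>z. z / (z - 1))) holomorphic_on ?S"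
      by (rule holomorphic_on_compose_gen[OF _ gs]) (use w in \<open>auto intro!: holomorphic_intros\<close>)
    then show "(\<lambda>z. (1 - z) powr (- a) * gauss_series a (c - b) c (z / (z - 1))) holomorphic_on ?S"
      unfolding o_def using z0 by (intro holomorphic_intros) auto
    show "open ?S" by (rule open_halfspace_Re_lt)
    show "connected ?S" by (intro convex_connected convex_halfspace_Re_lt)
    show "hyp2f1 a b c (of_real x) = (1 - of_real x) powr (- a) * gauss_series a (c - b) c (of_real x / (of_real x - 1))"
      if "- 1 / 2 < x" "x < 1 / 2" for x
      using that gauss_series_Pfaff[OF c, of x a b] hyp2f1_eq_gauss_series[OF c, of "of_real x" a b] by simp
  qed (use z in auto)
  then show ?thesis by simp
qed

text \<open>The definition of \<open>hyp2f1\<close> is pointwise in the parameters. Holomorphy comes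
  from a convergent series instead: the Gauss series for 0 <= z < 1 and Pfaff's series for z <
  0.\<close>

lemma holomorphic_hyp2f1_params:
  fixes z :: real
  assumes W: "open W" and hol: "a holomorphic_on W" "b holomorphic_on W" "c holomorphic_on W"
    and c: "\<And>w. w \<in> W \<Longrightarrow> Re (c w) > 0" and z: "z < 1"
  shows "(\<lambda>w. hyp2f1 (a w) (b w) (c w) (of_real z)) holomorphic_on W"
proof (cases "z \<ge> 0")
  case True
  have "(\<lambda>w. gauss_series (a w) (b w) (c w) (of_real z)) holomorphic_on W"
    by (rule holomorphic_gauss_series_params[OF W hol c]) (use z True in auto)
  then show ?thesis
    by (rule holomorphic_transform) (use True z in \<open>simp add: hyp2f1_eq_gauss_series[OF c]\<close>)
next
  case False
  then have w: "\<bar>z / (z - 1)\<bar> < 1" by (auto simp: abs_if divide_simps split: if_splits)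
  have "(\<lambda>w. of_real (1 - z) powr (- a w) *
      gauss_series (a w) (c w - b w) (c w) (of_real (z / (z - 1)))) holomorphic_on W"
    by (intro holomorphic_intros hol holomorphic_gauss_series_params[OF W] c)
      (use w in \<open>auto simp del: of_real_divide of_real_diff\<close>)
  then show ?thesis
    by (rule holomorphic_transform) (use False in \<open>simp add: hyp2f1_Pfaff[OF c]\<close>)
qed

lemma continuous_on_hyp2f1:
  fixes f :: "real \<Rightarrow> real"
  assumes c: "Re c > 0" and f: "continuous_on A f" "\<And>t. t \<in> A \<Longrightarrow> f t < 1"
  shows "continuous_on A (\<lambda>t. hyp2f1 a b c (of_real (f t)))"
  by (rule continuous_on_compose2[OF holomorphic_on_imp_continuous_on[OF hyp2f1_holomorphic[OF c]]])
    (auto intro!: continuous_intros f real_mem_slit)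

section \<open>Nonnegative integrals\<close>

text \<open>Values in \<open>ennreal\<close> allow substitution, Tonelli and termwise integration
  without integrability conditions; \<open>nn_int_eq_ennreal_iff\<close> leads back to Lebesgue
  integrals.\<close>

abbreviation nn_int :: "real set \<Rightarrow> (real \<Rightarrow> real) \<Rightarrow> ennreal" where
  "nn_int A f \<equiv> (\<integral>\<^sup>+t. ennreal (f t) * indicator A t \<partial>lborel)"

lemma nn_int_cong: "(\<And>t. t \<in> A \<Longrightarrow> f t = g t) \<Longrightarrow> nn_int A f = nn_int A g"
  by (intro nn_integral_cong) (auto simp: indicator_def)

lemma nn_int_cmult:
  assumes "c \<ge> 0" and [measurable]: "f \<in> borel_measurable borel" "A \<in> sets borel"
  shows "nn_int A (\<lambda>t. c * f t) = ennreal c * nn_int A f"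
  using assms(1) by (subst nn_integral_cmult[symmetric]) (auto simp: ennreal_mult' mult.assoc)

lemma nn_int_eq_ennreal_iff:
  assumes f: "set_borel_measurable lborel A f" "\<And>t. t \<in> A \<Longrightarrow> f t \<ge> 0" and b: "b \<ge> 0"
  shows "nn_int A f = ennreal b \<longleftrightarrow> set_integrable lborel A f \<and> (LBINT t:A. f t) = b"
proof -
  have "nn_int A f = (\<integral>\<^sup>+t. ennreal (indicator A t *\<^sub>R f t) \<partial>lborel)"
    by (intro nn_integral_cong) (auto simp: indicator_def)
  also have "\<dots> = ennreal b \<longleftrightarrow> integrable lborel (\<lambda>t. indicator A t *\<^sub>R f t) \<and> (\<integral>t. indicator A t *\<^sub>R f t \<partial>lborel) = b"
    by (rule nn_integral_eq_integrable[OF _ _ b])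
      (use f in \<open>auto simp: set_borel_measurable_def indicator_def\<close>)
  finally show ?thesis by (simp add: set_integrable_def set_lebesgue_integral_def)
qed

text \<open>A bridge to integration over the completed measure, in whose terms the
  change-of-variables theorem is formulated.\<close>

lemma set_integrable_lborel_iff_absolutely:
  fixes f :: "real \<Rightarrow> real"
  assumes "set_borel_measurable lborel A f"
  shows "set_integrable lborel A f \<and> (LBINT t:A. f t) = b \<longleftrightarrow>
    f absolutely_integrable_on A \<and> integral A f = b"
proof -
  have "set_integrable lborel A f \<longleftrightarrow> f absolutely_integrable_on A"
    using assms unfolding set_integrable_def set_borel_measurable_def
    by (intro integrable_completion[symmetric]) auto
  then show ?thesis using set_borel_integral_eq_integral(2)[of A f] by auto
qed


text \<open>The theorem on absolutely integrable functions says, for every finite b, that one side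
  equals b iff the other does. Two elements of \<open>ennreal\<close> with this property coincide,
  so divergent integrals are covered too. The integrand k is a separate argument so that callers can
  state it in simplified form.\<close>

lemma nn_int_change_of_variables:
  fixes f g g' h :: "real \<Rightarrow> real"
  assumes S: "open S" and T: "open T"
    and g: "\<And>v. v \<in> S \<Longrightarrow> g v \<in> T" "\<And>v. v \<in> S \<Longrightarrow> h (g v) = v"
    and h: "\<And>t. t \<in> T \<Longrightarrow> h t \<in> S" "\<And>t. t \<in> T \<Longrightarrow> g (h t) = t"
    and der: "\<And>v. v \<in> S \<Longrightarrow> (g has_real_derivative g' v) (at v)"
    and f: "continuous_on T f" "\<And>t. t \<in> T \<Longrightarrow> f t \<ge> 0"
    and g': "continuous_on S g'"
    and k: "\<And>v. v \<in> S \<Longrightarrow> k v = \<bar>g' v\<bar> * f (g v)"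
  shows "nn_int T f = nn_int S k"
proof -
  let ?k = "\<lambda>v. \<bar>g' v\<bar> * f (g v)"
  have contg: "continuous_on S g"
    using der by (intro continuous_at_imp_continuous_on ballI DERIV_isCont)
  have mf: "set_borel_measurable lborel T f"
    by (rule set_borel_measurable_lborel[OF T f(1)])
  have "continuous_on S ?k"
    by (intro continuous_intros g' continuous_on_compose2[OF f(1) contg]) (use g in auto)
  then have mk: "set_borel_measurable lborel S ?k"
    by (rule set_borel_measurable_lborel[OF S])
  have img: "g ` S = T"
  proof safe
    fix t assume "t \<in> T"
    then show "t \<in> g ` S" using h by (intro image_eqI[of t g "h t"]) auto
  qed (rule g(1))
  have inj: "inj_on g S" by (rule inj_on_inverseI[of S h]) (rule g(2))
  have iff: "nn_int S ?k = ennreal b \<longleftrightarrow> nn_int T f = ennreal b" if "b \<ge> 0" for b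
  proof -
    have "nn_int S ?k = ennreal b \<longleftrightarrow> ?k absolutely_integrable_on S \<and> integral S ?k = b"
      unfolding set_integrable_lborel_iff_absolutely[OF mk, symmetric]
      by (rule nn_int_eq_ennreal_iff[OF mk _ that]) (use f g in auto)
    also have "\<dots> \<longleftrightarrow> f absolutely_integrable_on (g ` S) \<and> integral (g ` S) f = b"
      using S der inj by (intro has_absolute_integral_change_of_variables_1')
        (auto intro: has_field_derivative_at_within)
    also have "\<dots> \<longleftrightarrow> nn_int T f = ennreal b"
      unfolding img set_integrable_lborel_iff_absolutely[OF mf, symmetric]
      by (rule nn_int_eq_ennreal_iff[OF mf _ that, symmetric]) (use f in auto)
    finally show ?thesis .
  qed
  have "nn_int T f = nn_int S ?k"
  proof (cases "nn_int T f")
    case (real b)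
    then show ?thesis using iff[of b] by simp
  next
    case top
    show ?thesis
    proof (cases "nn_int S ?k")
      case (real b)
      then show ?thesis using iff[of b] top by simp
    qed (simp add: top)
  qed
  also have "\<dots> = nn_int S k" by (rule nn_int_cong) (simp add: k)
  finally show ?thesis .
qed

section \<open>Gamma and Gaussian integrals\<close>

lemma nn_int_Gamma:
  assumes "x > 0"
  shows "nn_int {0<..} (\<lambda>t. t powr (x - 1) * exp (- t)) = ennreal (Gamma x)"
proof -
  let ?f = "\<lambda>t::real. t powr (x - 1) * exp (- t)"
  have m: "set_borel_measurable lborel {0<..} ?f"
    by (intro set_borel_measurable_lborel continuous_intros) auto
  have "(?f has_integral Gamma x) {0..}"
    using Gamma_integral_real[OF assms] by (simp add: exp_minus divide_inverse)
  then have "((\<lambda>t. if t \<in> {0<..} then ?f t else 0) has_integral Gamma x) {0..}"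
    by (rule has_integral_spike[of "{0}", rotated 2]) auto
  then have hi: "(?f has_integral Gamma x) {0<..}"
    by (subst (asm) has_integral_restrict) auto
  then have "?f integrable_on {0<..}" by (rule has_integral_integrable)
  then have "?f absolutely_integrable_on {0<..}"
    by (rule nonnegative_absolutely_integrable_1) simp
  with hi have "?f absolutely_integrable_on {0<..} \<and> integral {0<..} ?f = Gamma x"
    by (simp add: integral_unique)
  then have "set_integrable lborel {0<..} ?f \<and> (LBINT t:{0<..}. ?f t) = Gamma x"
    by (rule set_integrable_lborel_iff_absolutely[OF m, THEN iffD2])
  then show ?thesis
    by (rule nn_int_eq_ennreal_iff[OF m, THEN iffD2, rotated 2])
      (use assms in \<open>auto simp: Gamma_real_pos less_imp_le\<close>)
qed

lemma nn_int_Gauss_moment: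
  assumes x: "x > 0" and c: "c > 0"
  shows "nn_int {0<..} (\<lambda>s. s powr (2 * x - 1) * exp (- c * s\<^sup>2 / 2)) = ennreal (Gamma x / 2 * (2 / c) powr x)"
proof -
  have "nn_int {0<..} (\<lambda>s. s powr (2 * x - 1) * exp (- c * s\<^sup>2 / 2)) =
      nn_int {0<..} (\<lambda>t. (2 / c) powr x / 2 * (t powr (x - 1) * exp (- t)))"
  proof (rule nn_int_change_of_variables[where g = "\<lambda>t. sqrt (2 * t / c)" and h = "\<lambda>s. c * s\<^sup>2 / 2"
        and g' = "\<lambda>t. 1 / (c * sqrt (2 * t / c))"])
    fix v :: real assume v: "v \<in> {0<..}"
    then have v0: "v > 0" by simp
    show "((\<lambda>t. sqrt (2 * t / c)) has_real_derivative 1 / (c * sqrt (2 * v / c))) (at v)"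
      using v0 c by (auto intro!: derivative_eq_intros simp: field_simps)
    define u where "u = 2 * v / c"
    have u: "u > 0" "v = c * u / 2" using v0 c by (auto simp: u_def)
    have "sqrt u powr (2 * x - 1) = u powr (x - 1 / 2)"
    proof -
      have "sqrt u powr (2 * x - 1) = u powr (1 / 2 * (2 * x - 1))"
        using u(1) by (simp add: powr_half_sqrt[symmetric] powr_powr)
      then show ?thesis by (simp add: right_diff_distrib)
    qed
    moreover have "\<bar>1 / (c * sqrt u)\<bar> = u powr (- 1 / 2) / c"
      using u(1) c by (simp add: powr_minus_divide powr_half_sqrt[symmetric])
    moreover have "u powr (- 1 / 2) / c * u powr (x - 1 / 2) = u powr (x - 1) / c"
      by (simp add: powr_add[symmetric])
    moreover have "u powr (x - 1) / c = (2 / c) powr x / 2 * v powr (x - 1)"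
    proof -
      have "u powr (x - 1) = (2 / c) powr (x - 1) * v powr (x - 1)"
        using c v0 powr_mult[of "2 / c" v "x - 1"] by (simp add: u_def)
      also have "(2 / c) powr (x - 1) = (2 / c) powr x * c / 2"
        using c by (simp add: powr_diff)
      finally show ?thesis using c by simp
    qed
    ultimately have A: "\<bar>1 / (c * sqrt u)\<bar> * sqrt u powr (2 * x - 1) = (2 / c) powr x / 2 * v powr (x - 1)"
      by (simp only:)
    have B: "- c * (sqrt u)\<^sup>2 / 2 = - v" using u(1) c by (simp add: u_def)
    show "(2 / c) powr x / 2 * (v powr (x - 1) * exp (- v)) =
        \<bar>1 / (c * sqrt (2 * v / c))\<bar> * (sqrt (2 * v / c) powr (2 * x - 1) * exp (- c * (sqrt (2 * v / c))\<^sup>2 / 2))"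
      unfolding u_def[symmetric] B mult.assoc[symmetric] A ..
  qed (use c in \<open>auto intro!: continuous_intros simp: power_mult_distrib real_sqrt_mult real_sqrt_divide power_divide\<close>)
  also have "\<dots> = ennreal ((2 / c) powr x / 2) * ennreal (Gamma x)"
    by (subst nn_int_cmult) (auto simp: nn_int_Gamma[OF x])
  also have "\<dots> = ennreal (Gamma x / 2 * (2 / c) powr x)"
    by (subst ennreal_mult[symmetric]) (use x in \<open>auto simp: Gamma_real_pos less_imp_le mult_ac\<close>)
  finally show ?thesis .
qed

lemma nn_int_UNIV_split:
  fixes f :: "real \<Rightarrow> real"
  assumes [measurable]: "f \<in> borel_measurable borel"
  shows "nn_int UNIV f = nn_int {0<..} f + nn_int {0<..} (\<lambda>w. f (- w))"
proof -
  have "nn_int UNIV f = (\<integral>\<^sup>+t. ennreal (f t) * indicator {0<..} t + ennreal (f t) * indicator {..<0} t \<partial>lborel)"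
    by (rule nn_integral_cong_AE, rule AE_mp[OF AE_lborel_singleton[of 0]])
      (auto simp: indicator_def)
  also have "\<dots> = nn_int {0<..} f + nn_int {..<0} f"
    by (rule nn_integral_add) auto
  also have "nn_int {..<0} f = nn_int {0<..} (\<lambda>w. f (- w))"
    by (subst nn_integral_real_affine[where c = "- 1" and t = 0]) (auto simp: indicator_def intro!: nn_integral_cong)
  finally show ?thesis .
qed

lemma nn_int_Gaussian: "nn_int UNIV (\<lambda>w. exp (- w\<^sup>2)) = ennreal (sqrt pi)"
proof -
  have "nn_int {0<..} (\<lambda>w. exp (- w\<^sup>2)) = nn_int {0<..} (\<lambda>s. s powr (2 * (1 / 2) - 1) * exp (- 2 * s\<^sup>2 / 2))"
    by (rule nn_int_cong) auto
  also have "\<dots> = ennreal (sqrt pi / 2)"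
    by (subst nn_int_Gauss_moment) (auto simp: Gamma_one_half_real)
  finally have h: "nn_int {0<..} (\<lambda>w. exp (- w\<^sup>2)) = ennreal (sqrt pi / 2)" .
  show ?thesis
    by (subst nn_int_UNIV_split) (auto simp: h simp flip: ennreal_plus)
qed

text \<open>The reflection w -> -w exchanges the two integrals, and their sum is twice the Gaussian
  integral because the odd parts cancel.\<close>

lemma nn_int_skew_Gaussian:
  assumes m: "m > 0"
  shows "nn_int UNIV (\<lambda>w. (1 + w / sqrt (w\<^sup>2 + m)) * exp (- w\<^sup>2)) = ennreal (sqrt pi)"
    and "nn_int UNIV (\<lambda>w. (1 - w / sqrt (w\<^sup>2 + m)) * exp (- w\<^sup>2)) = ennreal (sqrt pi)"
proof -
  let ?f = "\<lambda>w. (1 + w / sqrt (w\<^sup>2 + m)) * exp (- w\<^sup>2)"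
  let ?g = "\<lambda>w. (1 - w / sqrt (w\<^sup>2 + m)) * exp (- w\<^sup>2)"
  have nn: "\<bar>w / sqrt (w\<^sup>2 + m)\<bar> \<le> 1" for w
  proof -
    have "\<bar>w\<bar> \<le> sqrt (w\<^sup>2 + m)" using m by (intro real_le_rsqrt) auto
    then show ?thesis by (auto simp: abs_divide divide_le_eq)
  qed
  have fg: "nn_int UNIV ?f = nn_int UNIV ?g"
  proof -
    have "nn_int UNIV ?f = nn_int {0<..} ?f + nn_int {0<..} (\<lambda>w. ?f (- w))"
      by (rule nn_int_UNIV_split) measurable
    moreover have "nn_int UNIV ?g = nn_int {0<..} ?g + nn_int {0<..} (\<lambda>w. ?g (- w))"
      by (rule nn_int_UNIV_split) measurable
    ultimately show ?thesis by (simp add: add.commute)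
  qed
  have pos: "?f w \<ge> 0" "?g w \<ge> 0" for w
  proof -
    have "1 + w / sqrt (w\<^sup>2 + m) \<ge> 0" "1 - w / sqrt (w\<^sup>2 + m) \<ge> 0"
      using abs_le_D1[OF nn[of w]] abs_le_D2[OF nn[of w]] by linarith+
    then show "?f w \<ge> 0" "?g w \<ge> 0" by (simp_all only: mult_nonneg_nonneg exp_ge_zero)
  qed
  have "nn_int UNIV ?f + nn_int UNIV ?g = (\<integral>\<^sup>+w. ennreal (?f w) + ennreal (?g w) \<partial>lborel)"
    by (subst nn_integral_add) auto
  also have "\<dots> = nn_int UNIV (\<lambda>w. 2 * exp (- w\<^sup>2))"
    using pos by (intro nn_integral_cong) (simp add: algebra_simps flip: ennreal_plus)
  also have "\<dots> = ennreal (2 * sqrt pi)"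
    by (subst nn_int_cmult) (use nn_int_Gaussian in \<open>auto simp: ennreal_mult\<close>)
  finally have s: "nn_int UNIV ?f + nn_int UNIV ?f = ennreal (2 * sqrt pi)" using fg by simp
  show f: "nn_int UNIV ?f = ennreal (sqrt pi)"
  \<comment> \<open>Halving the sum is a cancellation in \<open>ennreal\<close>, so the value
    infinity has to be excluded separately.\<close>
  proof (cases "nn_int UNIV ?f")
    case (real r)
    then have "ennreal (r + r) = ennreal (2 * sqrt pi)" using s by (simp only: ennreal_plus)
    then have "r + r = 2 * sqrt pi" using real(1) by (subst (asm) ennreal_inj) auto
    then show ?thesis using real by (simp only: mult_2[symmetric] mult_cancel_left) simp
  next
    case top
    then show ?thesis using s by simp
  qed
  show "nn_int UNIV ?g = ennreal (sqrt pi)" using f fg by simp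
qed

text \<open>The substitution \<open>w = sqrt p * sqrt t - sqrt k / sqrt t\<close> maps the half-line onto the
  whole line and completes the square in the exponent.\<close>

lemma
  assumes k: "k > 0" and p: "p > 0"
  shows nn_int_exp_reciprocal_half:
      "nn_int {0<..} (\<lambda>t. t powr (- 1 / 2) * exp (- k / t - p * t)) = ennreal (sqrt (pi / p) * exp (- 2 * sqrt (k * p)))"
    and nn_int_exp_reciprocal_three_halves:
      "nn_int {0<..} (\<lambda>t. t powr (- 3 / 2) * exp (- k / t - p * t)) = ennreal (sqrt (pi / k) * exp (- 2 * sqrt (k * p)))"
proof -
  define a b where "a = sqrt p" and "b = sqrt k"
  have a: "a > 0" "a\<^sup>2 = p" and b: "b > 0" "b\<^sup>2 = k" using k p by (auto simp: a_def b_def)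
  have ab: "sqrt (k * p) = a * b" "sqrt (pi / p) = sqrt pi / a" "sqrt (pi / k) = sqrt pi / b"
    by (simp_all add: a_def b_def real_sqrt_mult real_sqrt_divide)
  \<comment> \<open>With s = sqrt t the substitution w = a s - b / s is the quadratic equation a s^2
    - w s - b = 0; \<open>R w\<close> is the root of its discriminant and \<open>u w\<close> its
    positive solution s.\<close>
  define R where "R = (\<lambda>w. sqrt (w\<^sup>2 + 4 * a * b))"
  define u where "u = (\<lambda>w. (w + R w) / (2 * a))"
  have R: "R w > \<bar>w\<bar>" "(R w)\<^sup>2 = w\<^sup>2 + 4 * a * b" for w
  proof -
    have "\<bar>w\<bar> = sqrt (w\<^sup>2)" by simp
    also have "\<dots> < R w" unfolding R_def using a b by (intro real_sqrt_less_mono) auto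
    finally show "R w > \<bar>w\<bar>" .
    show "(R w)\<^sup>2 = w\<^sup>2 + 4 * a * b" using a b by (simp add: R_def)
  qed
  have R0: "R w > 0" for w using R(1)[of w] by linarith
  have u0: "u w > 0" for w unfolding u_def using R(1)[of w] a by (intro divide_pos_pos) auto
  have quad: "a * u w - b / u w = w" for w
  proof -
    have "R w * R w = w * w + 4 * a * b" using R(2)[of w] by (simp add: power2_eq_square)
    moreover have "R w = 2 * a * u w - w" using a by (simp add: u_def)
    ultimately have "4 * a * (a * u w * u w) = 4 * a * (w * u w + b)" by (simp add: algebra_simps)
    then have "a * u w * u w = w * u w + b" using a by simp
    then show ?thesis using u0[of w] by (simp add: field_simps)
  qed
  have inv: "1 / u w = (R w - w) / (2 * b)" for w
  proof -
    have "(R w - w) * (w + R w) = 4 * a * b"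
      using R(2)[of w] by (simp add: algebra_simps power2_eq_square)
    then have "(R w - w) * u w = 2 * b" using a by (simp add: u_def field_simps)
    then show ?thesis using u0[of w] b by (simp add: field_simps)
  qed
  have der: "((\<lambda>w. (u w)\<^sup>2) has_real_derivative 2 * (u w)\<^sup>2 / R w) (at w)" for w
  proof -
    have d: "((\<lambda>w. w\<^sup>2 + 4 * a * b) has_real_derivative 2 * w) (at w)"
      by (auto intro!: derivative_eq_intros)
    have pos: "w\<^sup>2 + 4 * a * b > 0" using R0[of w] by (simp add: R_def)
    have "inverse (R w) / 2 * (2 * w) = w / R w" by (simp add: inverse_eq_divide)
    then have dR: "(R has_real_derivative w / R w) (at w)"
      using DERIV_chain2[OF DERIV_real_sqrt[OF pos] d] unfolding R_def by (simp only:)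
    have "(1 + w / R w) / (2 * a) = u w / R w"
      using R0[of w] by (simp add: u_def add_divide_distrib)
    then have du: "(u has_real_derivative u w / R w) (at w)"
      using DERIV_cdivide[OF DERIV_add[OF DERIV_ident dR], of "2 * a"] unfolding u_def by (simp only:)
    have "of_nat 2 * (u w / R w * u w ^ (2 - Suc 0)) = 2 * (u w)\<^sup>2 / R w"
      by (simp add: power2_eq_square)
    then show ?thesis using DERIV_power[OF du, of 2] by (simp only:)
  qed
  have contR: "continuous_on UNIV R" unfolding R_def by (intro continuous_intros)
  have contu: "continuous_on UNIV u" unfolding u_def using a by (intro continuous_intros contR) auto
  \<comment> \<open>In the new variable the density is 2 u^(2r+2) / R. For r = -1/2 it equals (1 + w
    / R) / a, and for r = -3/2, by \<open>inv\<close>, (1 - w / R) / b: the two skew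
    Gaussians.\<close>
  have cov: "nn_int {0<..} (\<lambda>t. t powr r * exp (- k / t - p * t)) =
      nn_int UNIV (\<lambda>w. 2 * u w powr (2 * r + 2) / R w * exp (- w\<^sup>2 - 2 * (a * b)))" for r
  proof (rule nn_int_change_of_variables[where g = "\<lambda>w. (u w)\<^sup>2" and h = "\<lambda>t. a * sqrt t - b / sqrt t"
        and g' = "\<lambda>w. 2 * (u w)\<^sup>2 / R w"])
    fix w :: real
    show "(u w)\<^sup>2 \<in> {0<..}" using u0[of w] by simp
    show "a * sqrt ((u w)\<^sup>2) - b / sqrt ((u w)\<^sup>2) = w" using u0[of w] quad[of w] by simp
    show "((\<lambda>w. (u w)\<^sup>2) has_real_derivative 2 * (u w)\<^sup>2 / R w) (at w)" by (rule der)
    have "- k / (u w)\<^sup>2 - p * (u w)\<^sup>2 = - (a * u w - b / u w)\<^sup>2 - 2 * (a * b)"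
      using u0[of w] a(2) b(2) by (simp add: power2_diff power_mult_distrib power_divide)
    then have e: "- k / (u w)\<^sup>2 - p * (u w)\<^sup>2 = - w\<^sup>2 - 2 * (a * b)" unfolding quad .
    have q: "(u w)\<^sup>2 * ((u w)\<^sup>2) powr r = u w powr (2 * r + 2)"
    proof -
      have p2: "u w powr 2 = (u w)\<^sup>2" using u0[of w] by simp
      have "u w powr (2 * r + 2) = u w powr (2 * r) * u w powr 2" by (rule powr_add)
      also have "u w powr (2 * r) = (u w powr 2) powr r" by (rule powr_powr[symmetric])
      finally show ?thesis unfolding p2 by (simp only: mult.commute)
    qed
    show "2 * u w powr (2 * r + 2) / R w * exp (- w\<^sup>2 - 2 * (a * b)) =
        \<bar>2 * (u w)\<^sup>2 / R w\<bar> * (((u w)\<^sup>2) powr r * exp (- k / (u w)\<^sup>2 - p * (u w)\<^sup>2))"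
      unfolding e q[symmetric] using R0[of w] by simp
  next
    fix t :: real assume "t \<in> {0<..}"
    define s where "s = sqrt t"
    have s: "s > 0" "t = s\<^sup>2" using \<open>t \<in> {0<..}\<close> by (auto simp: s_def)
    have "R (a * s - b / s) = a * s + b / s"
    proof -
      have sq: "(x + y)\<^sup>2 = (x - y)\<^sup>2 + 4 * (x * y)" for x y :: real
        by (simp add: power2_eq_square algebra_simps)
      have "4 * (a * s * (b / s)) = 4 * a * b" using s(1) by simp
      then have "(a * s + b / s)\<^sup>2 = (a * s - b / s)\<^sup>2 + 4 * a * b" unfolding sq by (simp only:)
      moreover have "0 \<le> a * s + b / s" using a(1) b(1) s(1) by simp
      ultimately show ?thesis unfolding R_def by (rule real_sqrt_unique)
    qed
    then have "u (a * s - b / s) = s" using a by (simp add: u_def)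
    then show "(u (a * sqrt t - b / sqrt t))\<^sup>2 = t"
      unfolding s_def[symmetric] using s(2) by (simp only:)
  next
    show "continuous_on UNIV (\<lambda>w. 2 * (u w)\<^sup>2 / R w)"
    proof -
      have "R w \<noteq> 0" for w using R0[of w] by simp
      then show ?thesis by (intro continuous_intros contR contu) auto
    qed
  qed (auto intro!: continuous_intros)
  have Rm[measurable]: "R \<in> borel_measurable borel" by (rule borel_measurable_continuous_onI[OF contR])
  have skew: "nn_int UNIV (\<lambda>w. (1 + w / R w) * exp (- w\<^sup>2)) = ennreal (sqrt pi)"
      "nn_int UNIV (\<lambda>w. (1 - w / R w) * exp (- w\<^sup>2)) = ennreal (sqrt pi)"
    unfolding R_def by (intro nn_int_skew_Gaussian; use a b in simp)+
  have e2: "exp (- w\<^sup>2 - 2 * (a * b)) = exp (- 2 * (a * b)) * exp (- w\<^sup>2)" for w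
    by (simp flip: exp_add)
  have "nn_int {0<..} (\<lambda>t. t powr (- 1 / 2) * exp (- k / t - p * t)) =
      nn_int UNIV (\<lambda>w. exp (- 2 * (a * b)) / a * ((1 + w / R w) * exp (- w\<^sup>2)))"
    unfolding cov
  proof (rule nn_int_cong)
    fix w :: real
    have "2 * u w powr (2 * (- 1 / 2) + 2) / R w = (1 + w / R w) / a"
    proof -
      have "2 * u w powr (2 * (- 1 / 2) + 2) / R w = 2 * u w / R w" using u0[of w] by simp
      also have "\<dots> = (1 + w / R w) / a"
        using R0[of w] a by (simp add: u_def add_divide_distrib)
      finally show ?thesis .
    qed
    then show "2 * u w powr (2 * (- 1 / 2) + 2) / R w * exp (- w\<^sup>2 - 2 * (a * b)) =
        exp (- 2 * (a * b)) / a * ((1 + w / R w) * exp (- w\<^sup>2))"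
      unfolding e2 by simp
  qed
  also have "\<dots> = ennreal (exp (- 2 * (a * b)) / a) * ennreal (sqrt pi)"
    unfolding skew(1)[symmetric] by (rule nn_int_cmult) (use a b in auto)
  also have "\<dots> = ennreal (exp (- 2 * (a * b)) / a * sqrt pi)"
    using a by (intro ennreal_mult[symmetric]) auto
  also have "exp (- 2 * (a * b)) / a * sqrt pi = sqrt (pi / p) * exp (- 2 * sqrt (k * p))"
    unfolding ab by simp
  finally show "nn_int {0<..} (\<lambda>t. t powr (- 1 / 2) * exp (- k / t - p * t)) = ennreal (sqrt (pi / p) * exp (- 2 * sqrt (k * p)))" .
  have "nn_int {0<..} (\<lambda>t. t powr (- 3 / 2) * exp (- k / t - p * t)) =
      nn_int UNIV (\<lambda>w. exp (- 2 * (a * b)) / b * ((1 - w / R w) * exp (- w\<^sup>2)))"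
    unfolding cov
  proof (rule nn_int_cong)
    fix w :: real
    have "2 * u w powr (2 * (- 3 / 2) + 2) / R w = 2 * (1 / u w) / R w"
      using u0[of w] by (simp add: powr_minus_divide)
    also have "\<dots> = (1 - w / R w) / b"
      unfolding inv using R0[of w] b by (simp add: field_simps)
    finally show "2 * u w powr (2 * (- 3 / 2) + 2) / R w * exp (- w\<^sup>2 - 2 * (a * b)) =
        exp (- 2 * (a * b)) / b * ((1 - w / R w) * exp (- w\<^sup>2))"
      unfolding e2 by simp
  qed
  also have "\<dots> = ennreal (exp (- 2 * (a * b)) / b) * ennreal (sqrt pi)"
    unfolding skew(2)[symmetric] by (rule nn_int_cmult) (use a b in auto)
  also have "\<dots> = ennreal (exp (- 2 * (a * b)) / b * sqrt pi)"
    using b by (intro ennreal_mult[symmetric]) auto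
  also have "exp (- 2 * (a * b)) / b * sqrt pi = sqrt (pi / k) * exp (- 2 * sqrt (k * p))"
    unfolding ab by simp
  finally show "nn_int {0<..} (\<lambda>t. t powr (- 3 / 2) * exp (- k / t - p * t)) = ennreal (sqrt (pi / k) * exp (- 2 * sqrt (k * p)))" .
qed

section \<open>Parabolic cylinder functions\<close>

lemma summable_kummer_majorant:
  fixes A e R :: real
  assumes "A \<ge> 0" "e > 0" "R \<ge> 0"
  shows "summable (\<lambda>n. pochhammer A n / pochhammer e n * R ^ n / fact n)"
proof -
  \<comment> \<open>\<open>K\<close> bounds every quotient (A + n) / (e + n), so the ratio of
    consecutive terms is at most K R / (n + 1).\<close>
  define K where "K = max 1 (A / e)"
  obtain N :: nat where N: "2 * K * R \<le> real N" using real_arch_simple by blast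
  show ?thesis
  proof (rule summable_ratio_test[where c = "1 / 2" and N = N])
    fix n assume n: "n \<ge> N"
    have t0: "pochhammer A n / pochhammer e n * R ^ n / fact n \<ge> 0" for n
      using assms by (intro divide_nonneg_nonneg mult_nonneg_nonneg pochhammer_nonneg zero_le_power) auto
    have "A + n \<le> K * (e + n)"
    proof -
      have "A / e * e \<le> K * e" using assms by (intro mult_right_mono) (auto simp: K_def)
      moreover have "1 * real n \<le> K * real n" by (intro mult_right_mono) (auto simp: K_def)
      ultimately show ?thesis using assms by (simp add: distrib_left)
    qed
    then have "(A + n) / (e + n) * (R / (Suc n)) \<le> K * (R / Suc n)"
      using assms by (intro mult_right_mono) (auto simp: divide_le_eq)
    also have "\<dots> \<le> 1 / 2"
    proof -
      have "2 * (K * R) \<le> real (Suc n)" using N n by simp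
      then show ?thesis by (simp add: divide_le_eq)
    qed
    finally have r: "(A + n) / (e + n) * (R / (Suc n)) \<le> 1 / 2" .
    have "pochhammer A (Suc n) / pochhammer e (Suc n) * R ^ Suc n / fact (Suc n) =
        ((A + n) / (e + n) * (R / (Suc n))) * (pochhammer A n / pochhammer e n * R ^ n / fact n)"
      by (simp add: pochhammer_Suc mult_ac)
    also have "\<dots> \<le> 1 / 2 * (pochhammer A n / pochhammer e n * R ^ n / fact n)"
      by (rule mult_right_mono[OF r t0])
    finally show "norm (pochhammer A (Suc n) / pochhammer e (Suc n) * R ^ Suc n / fact (Suc n))
        \<le> 1 / 2 * norm (pochhammer A n / pochhammer e n * R ^ n / fact n)"
      using t0[of n] t0[of "Suc n"] by (simp only: real_norm_def abs_of_nonneg)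
  qed simp
qed

lemma norm_kummer_term_le:
  fixes a b z :: complex
  assumes a: "norm a \<le> A" and b: "0 < e" "e \<le> Re b" and z: "norm z \<le> R"
  shows "norm (pochhammer a n / pochhammer b n * z ^ n / fact n) \<le> pochhammer A n / pochhammer e n * R ^ n / fact n"
proof -
  have A: "A \<ge> 0" "R \<ge> 0" using a z norm_ge_zero order_trans by blast+
  have "norm (pochhammer a n / pochhammer b n * z ^ n / fact n) =
      norm (pochhammer a n) / norm (pochhammer b n) * norm z ^ n / fact n"
    by (simp add: norm_mult norm_divide norm_power)
  also have "\<dots> \<le> pochhammer A n / pochhammer e n * R ^ n / fact n"
    using A b by (intro divide_right_mono mult_mono frac_le norm_pochhammer_le[OF a] pochhammer_le_norm
        power_mono z pochhammer_pos pochhammer_nonneg divide_nonneg_nonneg zero_le_power) auto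
  finally show ?thesis .
qed

lemma holomorphic_kummer_Phi:
  assumes W: "open W" and hol: "a holomorphic_on W" "z holomorphic_on W" and b: "Re b > 0"
  shows "(\<lambda>w. kummer_Phi (a w) b (z w)) holomorphic_on W"
  unfolding kummer_Phi_eq_suminf
proof (rule holomorphic_on_suminf_local[OF W])
  show "(\<lambda>w. pochhammer (a w) n / pochhammer b n * z w ^ n / fact n) holomorphic_on W" for n
    unfolding pochhammer_prod using pochhammer_Re_pos_nonzero[OF b, of n]
    by (intro holomorphic_intros hol) (auto simp: pochhammer_prod)
next
  fix w assume w: "w \<in> W"
  obtain r where r: "r > 0" "cball w r \<subseteq> W" using W w open_contains_cball by blast
  have bdd: "\<exists>B\<ge>0. \<forall>u\<in>cball w r. norm (f u) \<le> B" if "f holomorphic_on W" for f :: "complex \<Rightarrow> complex"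
  proof -
    have "bounded (f ` cball w r)"
      using that r(2) holomorphic_on_subset holomorphic_on_imp_continuous_on
      by (intro compact_imp_bounded compact_continuous_image) auto
    then show ?thesis unfolding bounded_pos by (auto intro: less_imp_le)
  qed
  obtain A where A: "A \<ge> 0" "\<And>u. u \<in> cball w r \<Longrightarrow> norm (a u) \<le> A" using bdd[OF hol(1)] by blast
  obtain R where R: "R \<ge> 0" "\<And>u. u \<in> cball w r \<Longrightarrow> norm (z u) \<le> R" using bdd[OF hol(2)] by blast
  show "\<exists>r>0. \<exists>M. summable M \<and> (\<forall>n. \<forall>u\<in>cball w r \<inter> W.
      norm (pochhammer (a u) n / pochhammer b n * z u ^ n / fact n) \<le> M n)"
  proof (intro exI conjI allI ballI)
    show "r > 0" by fact
    show "summable (\<lambda>n. pochhammer A n / pochhammer (Re b) n * R ^ n / fact n)"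
      by (rule summable_kummer_majorant[OF A(1) b R(1)])
    fix n u assume "u \<in> cball w r \<inter> W"
    then show "norm (pochhammer (a u) n / pochhammer b n * z u ^ n / fact n) \<le>
        pochhammer A n / pochhammer (Re b) n * R ^ n / fact n"
      using A(2) R(2) b by (intro norm_kummer_term_le) auto
  qed
qed

lemma holomorphic_parabolic_cylinder_D:
  assumes W: "open W" and hol: "\<nu> holomorphic_on W" "z holomorphic_on W"
  shows "(\<lambda>w. parabolic_cylinder_D (\<nu> w) (z w)) holomorphic_on W"
  unfolding parabolic_cylinder_D_def
  by (intro holomorphic_intros holomorphic_kummer_Phi W hol) auto

section \<open>Real parabolic cylinder functions and their integral representation\<close>

definition kummer_real :: "real \<Rightarrow> real \<Rightarrow> real \<Rightarrow> real" where
  "kummer_real a b x = (\<Sum>n. pochhammer a n / pochhammer b n * x ^ n / fact n)"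

lemma kummer_real_sums:
  assumes "b > 0"
  shows "(\<lambda>n. pochhammer a n / pochhammer b n * x ^ n / fact n) sums kummer_real a b x"
proof -
  have "norm (pochhammer a n / pochhammer b n * x ^ n / fact n) \<le> pochhammer \<bar>a\<bar> n / pochhammer b n * \<bar>x\<bar> ^ n / fact n" for n
    using norm_kummer_term_le[of "of_real a" "\<bar>a\<bar>" b "of_real b" "of_real x" "\<bar>x\<bar>" n] assms
    by (simp add: pochhammer_of_real norm_mult norm_divide norm_power abs_mult power_abs)
  then have "summable (\<lambda>n. pochhammer a n / pochhammer b n * x ^ n / fact n)"
    by (rule summable_comparison_test'[OF summable_kummer_majorant[OF abs_ge_zero assms abs_ge_zero]])
  then show ?thesis unfolding kummer_real_def by (rule summable_sums)
qed

lemma kummer_Phi_of_real: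
  assumes "b > 0"
  shows "kummer_Phi (of_real a) (of_real b) (of_real x) = of_real (kummer_real a b x)"
proof -
  have "(\<lambda>n. complex_of_real (pochhammer a n / pochhammer b n * x ^ n / fact n)) sums of_real (kummer_real a b x)"
    by (rule sums_of_real[OF kummer_real_sums[OF assms]])
  then show ?thesis unfolding kummer_Phi_eq_suminf
    by (intro sums_unique[symmetric]) (simp add: pochhammer_of_real)
qed

text \<open>\<open>parabolic_cylinder_D\<close> at real arguments with
  \<open>Gamma (1 / 2) = sqrt pi\<close>, \<open>Gamma (- 1 / 2) = - 2 * sqrt pi\<close> and
  \<open>2 / sqrt 2 = sqrt 2\<close> inserted, whence the minus sign.\<close>

definition D_real :: "real \<Rightarrow> real \<Rightarrow> real" where
  "D_real \<nu> z = 2 powr (\<nu> / 2) * exp (- z\<^sup>2 / 4) *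
     (sqrt pi * rGamma ((1 - \<nu>) / 2) * kummer_real (- \<nu> / 2) (1 / 2) (z\<^sup>2 / 2)
      - z * sqrt 2 * sqrt pi * rGamma (- \<nu> / 2) * kummer_real ((1 - \<nu>) / 2) (3 / 2) (z\<^sup>2 / 2))"

lemma parabolic_cylinder_D_of_real:
  "parabolic_cylinder_D (of_real \<nu>) (of_real z) = of_real (D_real \<nu> z)"
proof -
  have G: "Gamma (- 1 / 2 :: complex) = of_real (- 2 * sqrt pi)"
  proof -
    have "(- 1 / 2 :: complex) \<notin> \<int>\<^sub>\<le>\<^sub>0"
    proof
      assume "(- 1 / 2 :: complex) \<in> \<int>\<^sub>\<le>\<^sub>0"
      then obtain n where "(- 1 / 2 :: complex) = of_int n" by (auto elim!: nonpos_Ints_cases)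
      then have "(- 1 / 2 :: real) = of_int n" by (metis Re_complex_of_real complex_Re_of_int of_real_divide of_real_minus of_real_1 of_real_numeral)
      then have "- 1 = (of_int (2 * n) :: real)" by simp
      then have "- 1 = 2 * n" by linarith
      then show False by presburger
    qed
    from Gamma_plus1[OF this] show ?thesis
      by (simp add: Gamma_one_half_complex field_simps)
  qed
  have k1: "kummer_Phi (- of_real \<nu> / 2) (1 / 2) ((of_real z)\<^sup>2 / 2) = of_real (kummer_real (- \<nu> / 2) (1 / 2) (z\<^sup>2 / 2))"
    using kummer_Phi_of_real[of "1 / 2" "- \<nu> / 2" "z\<^sup>2 / 2"] by simp
  have k2: "kummer_Phi ((1 - of_real \<nu>) / 2) (3 / 2) ((of_real z)\<^sup>2 / 2) = of_real (kummer_real ((1 - \<nu>) / 2) (3 / 2) (z\<^sup>2 / 2))"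
    using kummer_Phi_of_real[of "3 / 2" "(1 - \<nu>) / 2" "z\<^sup>2 / 2"] by simp
  have r1: "rGamma ((1 - complex_of_real \<nu>) / 2) = of_real (rGamma ((1 - \<nu>) / 2))"
    by (simp flip: rGamma_complex_of_real)
  have r2: "rGamma (- complex_of_real \<nu> / 2) = of_real (rGamma (- \<nu> / 2))"
    by (simp flip: rGamma_complex_of_real)
  have p1: "2 powr (complex_of_real \<nu> / 2) = of_real (2 powr (\<nu> / 2))"
    using powr_of_real[of 2 "\<nu> / 2"] by simp
  have p2: "(2 :: complex) powr (1 / 2) = of_real (sqrt 2)"
    using powr_of_real[of 2 "1 / 2"] by (simp add: powr_half_sqrt)
  have e: "exp (- ((complex_of_real z)\<^sup>2) / 4) = of_real (exp (- z\<^sup>2 / 4))"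
    by (simp flip: exp_of_real)
  have s2: "z / sqrt 2 * (- 2 * sqrt pi) = - (z * sqrt 2 * sqrt pi)"
  proof -
    have "2 / sqrt 2 = sqrt 2" by (rule real_div_sqrt) simp
    then show ?thesis by (metis (no_types, opaque_lifting) minus_mult_left minus_mult_right mult.assoc mult.commute times_divide_eq_left)
  qed
  have "parabolic_cylinder_D (of_real \<nu>) (of_real z) = of_real (2 powr (\<nu> / 2) * exp (- z\<^sup>2 / 4) *
     (sqrt pi * rGamma ((1 - \<nu>) / 2) * kummer_real (- \<nu> / 2) (1 / 2) (z\<^sup>2 / 2)
      + z / sqrt 2 * (- 2 * sqrt pi * rGamma (- \<nu> / 2)) * kummer_real ((1 - \<nu>) / 2) (3 / 2) (z\<^sup>2 / 2)))"
    unfolding parabolic_cylinder_D_def k1 k2 r1 r2 p1 p2 e G Gamma_one_half_complex by simp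
  also have "z / sqrt 2 * (- 2 * sqrt pi * rGamma (- \<nu> / 2)) = - (z * sqrt 2 * sqrt pi) * rGamma (- \<nu> / 2)"
    unfolding s2[symmetric] by simp
  finally show ?thesis unfolding D_real_def by simp
qed

lemma Gamma_duplication_real:
  assumes "x > (0::real)"
  shows "Gamma (x / 2) * Gamma ((x + 1) / 2) = 2 powr (1 - x) * sqrt pi * Gamma x"
proof -
  have nonpos: "z \<notin> \<int>\<^sub>\<le>\<^sub>0" if "Re z > 0" for z
    using that by (auto elim!: nonpos_Ints_cases)
  have "Gamma (complex_of_real (x / 2)) * Gamma (complex_of_real (x / 2) + 1 / 2) =
      exp ((1 - 2 * complex_of_real (x / 2)) * of_real (ln 2)) * of_real (sqrt pi) * Gamma (2 * complex_of_real (x / 2))"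
    by (rule Gamma_legendre_duplication; rule nonpos; use assms in simp)
  moreover have "complex_of_real (x / 2) + 1 / 2 = of_real ((x + 1) / 2)" by (simp add: add_divide_distrib)
  moreover have "2 * complex_of_real (x / 2) = of_real x" by simp
  moreover have "exp ((1 - complex_of_real x) * of_real (ln 2)) = of_real (2 powr (1 - x))"
    by (simp add: powr_def flip: exp_of_real)
  ultimately have "complex_of_real (Gamma (x / 2) * Gamma ((x + 1) / 2)) = of_real (2 powr (1 - x) * sqrt pi * Gamma x)"
    by (simp only: Gamma_complex_of_real of_real_mult)
  then show ?thesis by (simp only: of_real_eq_iff)
qed

text \<open>\<open>c n\<close> is the n-th term when exp (Z s) is expanded and integrated against
  s^(2x-1) exp (-s^2 / 2). The even and odd subseries are Kummer series because (2k)! = 4^k (1/2)_k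
  k! and (2k+1)! = 4^k (3/2)_k k!.\<close>

lemma Gauss_series_terms:
  fixes x Z :: real
  assumes x: "x > 0"
  defines "c \<equiv> \<lambda>n. Z ^ n / fact n * (Gamma (x + n / 2) / 2 * 2 powr (x + n / 2))"
  shows "c (2 * k) = 2 powr x * Gamma x / 2 * (pochhammer x k / pochhammer (1 / 2) k * (Z\<^sup>2 / 2) ^ k / fact k)"
    and "c (2 * k + 1) = Z * 2 powr (x + 1 / 2) * Gamma (x + 1 / 2) / 2 *
      (pochhammer (x + 1 / 2) k / pochhammer (3 / 2) k * (Z\<^sup>2 / 2) ^ k / fact k)"
proof -
  have np: "z \<notin> \<int>\<^sub>\<le>\<^sub>0" if "z > 0" for z :: real
    using that by (auto elim!: nonpos_Ints_cases)
  have G: "Gamma (y + k) = pochhammer y k * Gamma y" if "y > 0" for y :: real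
    using pochhammer_Gamma[OF np[OF that], of k] Gamma_real_pos[OF that] by (simp add: field_simps)
  have f: "fact (2 * k) = 4 ^ k * pochhammer (1 / 2) k * (fact k :: real)"
    using fact_double[of k, where 'a = real] by (simp add: power_mult)
  have h: "pochhammer (1 / 2) k > (0::real)" by (rule pochhammer_pos) simp
  have h3: "pochhammer (3 / 2) k = (2 * k + 1) * pochhammer (1 / 2 :: real) k"
    using pochhammer_Suc[of "1 / 2 :: real" k] pochhammer_rec[of "1 / 2 :: real" k] by (simp add: field_simps)
  have p4: "(2::real) ^ k / 4 ^ k = 1 / 2 ^ k" by (simp add: power_divide[symmetric] flip: power_one_over)
  have pw: "2 powr (y + real k) = 2 powr y * 2 ^ k" for y :: real
    by (simp add: powr_add powr_realpow)
  have "c (2 * k) = Z ^ (2 * k) / (4 ^ k * pochhammer (1 / 2) k * fact k) * (pochhammer x k * Gamma x / 2 * (2 powr x * 2 ^ k))"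
    unfolding c_def f[symmetric] using G[OF x] pw[of x] by simp
  also have "\<dots> = 2 powr x * Gamma x / 2 * (pochhammer x k / pochhammer (1 / 2) k * (Z ^ (2 * k) * (2 ^ k / 4 ^ k)) / fact k)"
    by (simp add: mult_ac)
  also have "Z ^ (2 * k) * (2 ^ k / 4 ^ k) = (Z\<^sup>2 / 2) ^ k"
    unfolding p4 by (simp add: power_mult power_divide)
  finally show "c (2 * k) = 2 powr x * Gamma x / 2 * (pochhammer x k / pochhammer (1 / 2) k * (Z\<^sup>2 / 2) ^ k / fact k)" .
  have f1: "fact (2 * k + 1) = 4 ^ k * pochhammer (3 / 2) k * (fact k :: real)"
    unfolding h3 using f by simp
  have e: "x + real (2 * k + 1) / 2 = (x + 1 / 2) + real k" by simp
  have "c (2 * k + 1) = Z ^ (2 * k + 1) / (4 ^ k * pochhammer (3 / 2) k * fact k) *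
      (pochhammer (x + 1 / 2) k * Gamma (x + 1 / 2) / 2 * (2 powr (x + 1 / 2) * 2 ^ k))"
    unfolding c_def f1[symmetric] e using G[of "x + 1 / 2"] pw[of "x + 1 / 2"] x by simp
  also have "\<dots> = Z * 2 powr (x + 1 / 2) * Gamma (x + 1 / 2) / 2 *
      (pochhammer (x + 1 / 2) k / pochhammer (3 / 2) k * (Z ^ (2 * k) * (2 ^ k / 4 ^ k)) / fact k)"
    by (simp add: mult_ac)
  also have "Z ^ (2 * k) * (2 ^ k / 4 ^ k) = (Z\<^sup>2 / 2) ^ k"
    unfolding p4 by (simp add: power_mult power_divide)
  finally show "c (2 * k + 1) = Z * 2 powr (x + 1 / 2) * Gamma (x + 1 / 2) / 2 *
      (pochhammer (x + 1 / 2) k / pochhammer (3 / 2) k * (Z\<^sup>2 / 2) ^ k / fact k)" .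
qed

text \<open>Termwise integration of exp (-Z s): the even terms give the first Kummer series, the odd
  ones the second with a minus sign. That the difference I is nonnegative cannot be seen from the
  two series; it follows from the integral.\<close>

lemma nn_int_parabolic:
  assumes x: "x > 0" and Z: "Z > 0"
  defines "I \<equiv> 2 powr x * Gamma x / 2 * kummer_real x (1 / 2) (Z\<^sup>2 / 2)
    - Z * 2 powr (x + 1 / 2) * Gamma (x + 1 / 2) / 2 * kummer_real (x + 1 / 2) (3 / 2) (Z\<^sup>2 / 2)"
  shows "nn_int {0<..} (\<lambda>s. s powr (2 * x - 1) * exp (- s\<^sup>2 / 2) * exp (- Z * s)) = ennreal I \<and> I \<ge> 0"
proof -
  define w where "w = (\<lambda>s::real. s powr (2 * x - 1) * exp (- s\<^sup>2 / 2))"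
  define c where "c = (\<lambda>n. Z ^ n / fact n * (Gamma (x + n / 2) / 2 * 2 powr (x + n / 2)))"
  define F where "F = (\<lambda>n s. indicator {0<..} s *\<^sub>R ((- Z * s) ^ n / fact n * w s))"
  define E where "E = 2 powr x * Gamma x / 2 * kummer_real x (1 / 2) (Z\<^sup>2 / 2)"
  define Q where "Q = Z * 2 powr (x + 1 / 2) * Gamma (x + 1 / 2) / 2 * kummer_real (x + 1 / 2) (3 / 2) (Z\<^sup>2 / 2)"
  have wm[measurable]: "w \<in> borel_measurable borel" unfolding w_def by measurable
  have w0: "w s \<ge> 0" for s by (simp add: w_def)
  have even: "(\<lambda>k. c (2 * k)) sums E"
    unfolding c_def Gauss_series_terms(1)[OF x] E_def by (intro sums_mult kummer_real_sums) simp
  have odd: "(\<lambda>k. c (2 * k + 1)) sums Q"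
    unfolding c_def Gauss_series_terms(2)[OF x] Q_def by (intro sums_mult kummer_real_sums) simp
  have c0: "c n \<ge> 0" for n
    using x Z Gamma_real_pos[of "x + n / 2"] by (auto simp: c_def intro!: mult_nonneg_nonneg)
  have alt: "(\<lambda>n. (- 1) ^ n * c n) sums (E - Q)"
  proof -
    have "(\<lambda>n. if even n then c (2 * (n div 2)) else - c (2 * ((n - 1) div 2) + 1)) sums (- Q + E)"
      using sums_if[OF sums_minus[OF odd] even] by simp
    moreover have "(\<lambda>n. if even n then c (2 * (n div 2)) else - c (2 * ((n - 1) div 2) + 1)) = (\<lambda>n. (- 1) ^ n * c n)"
      by (rule ext) (auto elim!: oddE)
    ultimately show ?thesis by simp
  qed
  have sumc: "summable c"
  proof -
    have "(\<lambda>n. if even n then c (2 * (n div 2)) else c (2 * ((n - 1) div 2) + 1)) sums (Q + E)"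
      using sums_if[OF odd even] by simp
    moreover have "(\<lambda>n. if even n then c (2 * (n div 2)) else c (2 * ((n - 1) div 2) + 1)) = c"
      by (rule ext) (auto elim!: oddE)
    ultimately show ?thesis by (simp add: sums_iff)
  qed
  \<comment> \<open>Computing the moments without signs in \<open>ennreal\<close> yields
    integrability and value at once; together with \<open>sumc\<close> this is the absolute
    convergence that termwise integration needs.\<close>
  have abs: "set_integrable lborel {0<..} (\<lambda>s. (Z * s) ^ n / fact n * w s) \<and>
      (LBINT s:{0<..}. (Z * s) ^ n / fact n * w s) = c n" for n
  proof -
    have "nn_int {0<..} (\<lambda>s. (Z * s) ^ n / fact n * w s) =
        nn_int {0<..} (\<lambda>s. Z ^ n / fact n * (s powr (2 * (x + n / 2) - 1) * exp (- 1 * s\<^sup>2 / 2)))"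
    proof (rule nn_int_cong)
      fix s :: real assume "s \<in> {0<..}"
      then have "s powr (2 * (x + n / 2) - 1) = s powr (2 * x - 1) * s ^ n"
        by (simp add: powr_add[symmetric] powr_realpow[symmetric] algebra_simps)
      then show "(Z * s) ^ n / fact n * w s = Z ^ n / fact n * (s powr (2 * (x + n / 2) - 1) * exp (- 1 * s\<^sup>2 / 2))"
        by (simp add: w_def power_mult_distrib)
    qed
    also have "\<dots> = ennreal (Z ^ n / fact n) * ennreal (Gamma (x + n / 2) / 2 * (2 / 1) powr (x + n / 2))"
      by (subst nn_int_cmult, use Z in simp, measurable, subst nn_int_Gauss_moment) (use x in auto)
    also have "\<dots> = ennreal (c n)"
      using Z by (simp add: c_def ennreal_mult'[symmetric])
    finally show ?thesis
      by (rule nn_int_eq_ennreal_iff[THEN iffD1, rotated 3])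
        (use w0 Z c0 in \<open>auto simp: set_borel_measurable_def\<close>)
  qed
  have normF: "norm (F n s) = indicator {0<..} s *\<^sub>R ((Z * s) ^ n / fact n * w s)" for n s
    using w0[of s] Z by (auto simp: F_def indicator_def abs_mult power_abs)
  have Feq: "F n s = (- 1) ^ n * (indicator {0<..} s *\<^sub>R ((Z * s) ^ n / fact n * w s))" for n s
    by (simp add: F_def power_minus[of "Z * s"])
  have "(\<lambda>n. integral\<^sup>L lborel (F n)) sums (\<integral>s. (\<Sum>n. F n s) \<partial>lborel)"
    and int: "integrable lborel (\<lambda>s. \<Sum>n. F n s)"
  proof -
    have 1: "integrable lborel (F n)" for n
      unfolding Feq by (intro integrable_mult_right impI abs[of n, THEN conjunct1, unfolded set_integrable_def])
    have 2: "AE s in lborel. summable (\<lambda>n. norm (F n s))"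
    proof (rule AE_I2)
      fix s :: real
      have "summable (\<lambda>n. (Z * s) ^ n / fact n)"
        using summable_exp[of "Z * s"] by (simp add: divide_inverse mult.commute)
      then show "summable (\<lambda>n. norm (F n s))"
        unfolding normF real_scaleR_def by (intro summable_mult summable_mult2)
    qed
    have 3: "summable (\<lambda>n. \<integral>s. norm (F n s) \<partial>lborel)"
      unfolding normF using sumc abs by (simp add: set_lebesgue_integral_def)
    show "(\<lambda>n. integral\<^sup>L lborel (F n)) sums (\<integral>s. (\<Sum>n. F n s) \<partial>lborel)"
      by (rule sums_integral[OF 1 2 3])
    show "integrable lborel (\<lambda>s. \<Sum>n. F n s)" by (rule integrable_suminf[OF 1 2 3])
  qed
  moreover have "integral\<^sup>L lborel (F n) = (- 1) ^ n * c n" for n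
    unfolding Feq integral_mult_right_zero
    by (simp only: abs[of n, THEN conjunct2, unfolded set_lebesgue_integral_def])
  ultimately have "(\<lambda>n. (- 1) ^ n * c n) sums (\<integral>s. (\<Sum>n. F n s) \<partial>lborel)" by (simp only:)
  then have I: "(\<integral>s. (\<Sum>n. F n s) \<partial>lborel) = E - Q" using alt by (rule sums_unique2)
  have S: "(\<lambda>s. \<Sum>n. F n s) = (\<lambda>s. indicator {0<..} s *\<^sub>R (w s * exp (- Z * s)))"
  proof
    fix s :: real
    have "(\<lambda>n. (- Z * s) ^ n / fact n) sums exp (- Z * s)"
      using exp_converges[of "- Z * s"] by (simp add: divide_inverse mult.commute)
    then have "(\<lambda>n. indicator {0<..} s * ((- Z * s) ^ n / fact n * w s)) sums (indicator {0<..} s * (exp (- Z * s) * w s))"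
      by (intro sums_mult sums_mult2)
    then show "(\<Sum>n. F n s) = indicator {0<..} s *\<^sub>R (w s * exp (- Z * s))"
      unfolding F_def real_scaleR_def by (subst mult.commute[of "w s"]) (rule sums_unique[symmetric])
  qed
  have pos: "E - Q \<ge> 0"
  proof -
    have "(\<integral>s. (\<Sum>n. F n s) \<partial>lborel) \<ge> 0" unfolding S using w0 by (intro integral_nonneg_AE) auto
    then show "E - Q \<ge> 0" unfolding I .
  qed
  have "nn_int {0<..} (\<lambda>s. w s * exp (- Z * s)) = ennreal (E - Q)"
  proof (rule nn_int_eq_ennreal_iff[THEN iffD2])
    show "set_borel_measurable lborel {0<..} (\<lambda>s. w s * exp (- Z * s))"
      by (simp add: set_borel_measurable_def)
    show "w s * exp (- Z * s) \<ge> 0" for s using w0[of s] by simp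
    show "E - Q \<ge> 0" by (rule pos)
    show "set_integrable lborel {0<..} (\<lambda>s. w s * exp (- Z * s)) \<and> (LBINT s:{0<..}. w s * exp (- Z * s)) = E - Q"
      using int I unfolding S set_integrable_def set_lebesgue_integral_def by simp
  qed
  with pos show ?thesis unfolding w_def I_def E_def Q_def by simp
qed

section \<open>Laplace transforms\<close>

lemma nn_int_swap:
  fixes f :: "real \<Rightarrow> real \<Rightarrow> real"
  assumes [measurable]: "(\<lambda>(s, t). f s t) \<in> borel_measurable (borel \<Otimes>\<^sub>M borel)"
    "A \<in> sets borel" "B \<in> sets borel"
  shows "(\<integral>\<^sup>+s. nn_int B (f s) * indicator A s \<partial>lborel) =
    (\<integral>\<^sup>+t. nn_int A (\<lambda>s. f s t) * indicator B t \<partial>lborel)"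
proof -
  have [measurable]: "(\<lambda>(s, t). f s t) \<in> borel_measurable (lborel \<Otimes>\<^sub>M lborel)"
    using assms(1) by (simp cong: measurable_cong_sets sets_pair_measure_cong)
  have "(\<integral>\<^sup>+s. nn_int B (f s) * indicator A s \<partial>lborel) =
      (\<integral>\<^sup>+s. \<integral>\<^sup>+t. ennreal (f s t) * indicator B t * indicator A s \<partial>lborel \<partial>lborel)"
    by (intro nn_integral_cong, subst nn_integral_multc) auto
  also have "\<dots> = (\<integral>\<^sup>+t. \<integral>\<^sup>+s. ennreal (f s t) * indicator B t * indicator A s \<partial>lborel \<partial>lborel)"
    by (rule lborel_pair.Fubini'[symmetric]) measurable
  also have "\<dots> = (\<integral>\<^sup>+t. \<integral>\<^sup>+s. ennreal (f s t) * indicator A s * indicator B t \<partial>lborel \<partial>lborel)"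
    by (simp only: mult.assoc mult.commute[of "indicator A _"])
  also have "\<dots> = (\<integral>\<^sup>+t. nn_int A (\<lambda>s. f s t) * indicator B t \<partial>lborel)"
    by (intro nn_integral_cong, subst nn_integral_multc) auto
  finally show ?thesis .
qed

text \<open>After Tonelli the two Gaussians in s combine to exp (-c s^2 / 2) with c = 1 + y / t, and
  the moment factor (2 / c)^x produces t^x (y + t)^(-x).\<close>

lemma nn_int_Gauss_subordination:
  assumes x: "x > 0" and y: "y > 0"
  shows "(\<integral>\<^sup>+s. nn_int {0<..} (\<lambda>t. (s powr (2 * x - 1) * exp (- s\<^sup>2 / 2)) *
        (t powr r * exp (- (y * s\<^sup>2 / 2) / t - p * t))) * indicator {0<..} s \<partial>lborel) =
    ennreal (Gamma x / 2 * 2 powr x) * nn_int {0<..} (\<lambda>t. t powr (r + x) * (y + t) powr (- x) * exp (- p * t))"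
proof -
  have "(\<integral>\<^sup>+s. nn_int {0<..} (\<lambda>t. (s powr (2 * x - 1) * exp (- s\<^sup>2 / 2)) *
        (t powr r * exp (- (y * s\<^sup>2 / 2) / t - p * t))) * indicator {0<..} s \<partial>lborel) =
      (\<integral>\<^sup>+t. nn_int {0<..} (\<lambda>s. (s powr (2 * x - 1) * exp (- s\<^sup>2 / 2)) *
        (t powr r * exp (- (y * s\<^sup>2 / 2) / t - p * t))) * indicator {0<..} t \<partial>lborel)"
    by (rule nn_int_swap) measurable
  also have "\<dots> = nn_int {0<..} (\<lambda>t. Gamma x / 2 * 2 powr x * (t powr (r + x) * (y + t) powr (- x) * exp (- p * t)))"
  proof (rule nn_integral_cong)
    fix t :: real
    show "nn_int {0<..} (\<lambda>s. (s powr (2 * x - 1) * exp (- s\<^sup>2 / 2)) *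
        (t powr r * exp (- (y * s\<^sup>2 / 2) / t - p * t))) * indicator {0<..} t =
      ennreal (Gamma x / 2 * 2 powr x * (t powr (r + x) * (y + t) powr (- x) * exp (- p * t))) * indicator {0<..} t"
    proof (cases "t > 0")
      case True
      define c where "c = 1 + y / t"
      have c: "c > 0" "2 / c = 2 * t / (y + t)" using True y by (auto simp: c_def field_simps)
      have "nn_int {0<..} (\<lambda>s. (s powr (2 * x - 1) * exp (- s\<^sup>2 / 2)) * (t powr r * exp (- (y * s\<^sup>2 / 2) / t - p * t))) =
          nn_int {0<..} (\<lambda>s. (t powr r * exp (- p * t)) * (s powr (2 * x - 1) * exp (- c * s\<^sup>2 / 2)))"
      proof (rule nn_int_cong)
        fix s :: real
        have e: "- s\<^sup>2 / 2 + (- (y * s\<^sup>2 / 2) / t - p * t) = - p * t + (- c * s\<^sup>2 / 2)"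
          using True by (simp add: c_def field_simps)
        have "exp (- s\<^sup>2 / 2) * exp (- (y * s\<^sup>2 / 2) / t - p * t) = exp (- p * t) * exp (- c * s\<^sup>2 / 2)"
          unfolding exp_add[symmetric] e ..
        then show "(s powr (2 * x - 1) * exp (- s\<^sup>2 / 2)) * (t powr r * exp (- (y * s\<^sup>2 / 2) / t - p * t)) =
            (t powr r * exp (- p * t)) * (s powr (2 * x - 1) * exp (- c * s\<^sup>2 / 2))"
          by (simp only: mult_ac)
      qed
      also have "\<dots> = ennreal (t powr r * exp (- p * t)) * ennreal (Gamma x / 2 * (2 / c) powr x)"
        unfolding nn_int_Gauss_moment[OF x c(1), symmetric] by (rule nn_int_cmult) auto
      also have "\<dots> = ennreal ((t powr r * exp (- p * t)) * (Gamma x / 2 * (2 / c) powr x))"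
        by (rule ennreal_mult'[symmetric]) simp
      also have "(2 / c) powr x = 2 powr x * t powr x * (y + t) powr (- x)"
        unfolding c(2) using True y by (simp add: powr_divide powr_mult powr_minus_divide)
      finally show ?thesis using True by (simp add: powr_add mult_ac)
    qed simp
  qed
  also have "\<dots> = ennreal (Gamma x / 2 * 2 powr x) * nn_int {0<..} (\<lambda>t. t powr (r + x) * (y + t) powr (- x) * exp (- p * t))"
    using Gamma_real_pos[OF x] by (intro nn_int_cmult) auto
  finally show ?thesis .
qed

text \<open>The classical integral representation of the parabolic cylinder function of negative
  order. Legendre duplication for Gamma(-\<mu>) matches the coefficients of the two Kummer functions
  with those in \<open>nn_int_parabolic\<close> at x = -\<mu> / 2.\<close>

lemma nn_int_D_real:
  assumes \<mu>: "\<mu> < 0" and Z: "Z > 0"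
  shows "nn_int {0<..} (\<lambda>s. s powr (- \<mu> - 1) * exp (- s\<^sup>2 / 2) * exp (- Z * s)) =
      ennreal (exp (Z\<^sup>2 / 4) * Gamma (- \<mu>) * D_real \<mu> Z) \<and> exp (Z\<^sup>2 / 4) * Gamma (- \<mu>) * D_real \<mu> Z \<ge> 0"
proof -
  define x where "x = - \<mu> / 2"
  have x: "x > 0" "2 * x = - \<mu>" using \<mu> by (auto simp: x_def)
  define K1 where "K1 = kummer_real x (1 / 2) (Z\<^sup>2 / 2)"
  define K2 where "K2 = kummer_real (x + 1 / 2) (3 / 2) (Z\<^sup>2 / 2)"
  define G where "G = Gamma (- \<mu>)"
  define G1 where "G1 = Gamma x"
  define G2 where "G2 = Gamma (x + 1 / 2)"
  have pos: "G > 0" "G1 > 0" "G2 > 0"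
    unfolding G_def G1_def G2_def using x(1) \<mu> by (auto intro!: Gamma_real_pos)
  have dup: "G1 * G2 = 2 powr (1 + \<mu>) * sqrt pi * G"
    using Gamma_duplication_real[of "- \<mu>"] \<mu> unfolding G_def G1_def G2_def x_def by (simp add: add_divide_distrib diff_divide_distrib)
  have args: "(1 - \<mu>) / 2 = x + 1 / 2" by (simp add: x_def diff_divide_distrib)
  have r: "rGamma (x + 1 / 2) = 1 / G2" "rGamma x = 1 / G1"
    unfolding G1_def G2_def by (simp_all add: rGamma_inverse_Gamma inverse_eq_divide)
  define Y where "Y = sqrt pi * (1 / G2) * K1 - Z * sqrt 2 * sqrt pi * (1 / G1) * K2"
  have D: "D_real \<mu> Z = 2 powr (\<mu> / 2) * exp (- Z\<^sup>2 / 4) * Y"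
    unfolding D_real_def args x_def[symmetric] r K1_def K2_def Y_def ..
  have "exp (Z\<^sup>2 / 4) * Gamma (- \<mu>) * D_real \<mu> Z = (exp (- Z\<^sup>2 / 4) * exp (Z\<^sup>2 / 4)) * (2 powr (\<mu> / 2) * G * Y)"
    unfolding D G_def by (simp only: mult_ac)
  also have "exp (- Z\<^sup>2 / 4) * exp (Z\<^sup>2 / 4) = 1" by (simp add: exp_minus)
  also have "1 * (2 powr (\<mu> / 2) * G * Y) =
      2 powr (\<mu> / 2) * G * (sqrt pi * (1 / G2) * K1 - Z * sqrt 2 * sqrt pi * (1 / G1) * K2)"
    unfolding Y_def by simp
  also have "\<dots> = (2 powr (\<mu> / 2) * (sqrt pi * G / G2)) * K1 - Z * (2 powr (\<mu> / 2) * sqrt 2) * (sqrt pi * G / G1) * K2"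
    by (simp add: algebra_simps)
  also have "sqrt pi * G / G2 = G1 / 2 powr (1 + \<mu>)"
    using dup pos by (simp add: field_simps)
  also have "sqrt pi * G / G1 = G2 / 2 powr (1 + \<mu>)"
    using dup pos by (simp add: field_simps)
  also have "2 powr (\<mu> / 2) * (G1 / 2 powr (1 + \<mu>)) = 2 powr x * G1 / 2"
  proof -
    have "2 powr (1 + \<mu>) = 2 * (2 powr (\<mu> / 2) * 2 powr (\<mu> / 2))" by (simp add: powr_add[symmetric]) (simp add: powr_add)
    moreover have "2 powr x * 2 powr (\<mu> / 2) = 1" by (simp add: powr_add[symmetric] x_def)
    ultimately show ?thesis by (simp add: field_simps)
  qed
  also have "Z * (2 powr (\<mu> / 2) * sqrt 2) * (G2 / 2 powr (1 + \<mu>)) = Z * 2 powr (x + 1 / 2) * G2 / 2"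
  proof -
    have "2 powr (1 + \<mu>) = 2 * (2 powr (\<mu> / 2) * 2 powr (\<mu> / 2))" by (simp add: powr_add[symmetric]) (simp add: powr_add)
    moreover have "2 powr (x + 1 / 2) = 2 powr x * sqrt 2" by (simp add: powr_add powr_half_sqrt)
    moreover have "2 powr x * 2 powr (\<mu> / 2) = 1" by (simp add: powr_add[symmetric] x_def)
    ultimately show ?thesis by (simp add: field_simps)
  qed
  finally have I: "exp (Z\<^sup>2 / 4) * Gamma (- \<mu>) * D_real \<mu> Z =
      2 powr x * Gamma x / 2 * kummer_real x (1 / 2) (Z\<^sup>2 / 2)
      - Z * 2 powr (x + 1 / 2) * Gamma (x + 1 / 2) / 2 * kummer_real (x + 1 / 2) (3 / 2) (Z\<^sup>2 / 2)"
    by (simp only: G1_def G2_def K1_def K2_def)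
  show ?thesis unfolding I using nn_int_parabolic[OF x(1) Z] unfolding x(2) by simp
qed

lemma ennreal_mult_eq_cancel:
  assumes "ennreal \<kappa> * X = ennreal G" "\<kappa> > 0" "G \<ge> 0"
  shows "X = ennreal (G / \<kappa>)"
proof (cases X)
  case (real r)
  then have "ennreal (\<kappa> * r) = ennreal G" using assms by (simp add: ennreal_mult)
  then have "\<kappa> * r = G" using real assms by (subst (asm) ennreal_inj) auto
  then show ?thesis using real assms by (auto simp: field_simps)
next
  case top
  then show ?thesis using assms by (simp add: ennreal_mult_top)
qed

text \<open>In the representation of D, the factor exp (-Z s) with Z = sqrt (2 y p) is itself a
  Laplace transform in t, with k = y s^2 / 2 in \<open>nn_int_exp_reciprocal_half\<close> or
  \<open>nn_int_exp_reciprocal_three_halves\<close>. Normalising the first costs sqrt p, the second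
  involves no p; this freedom later cancels the powers of p.\<close>

lemma D_real_laplace:
  fixes \<mu> y p :: real
  assumes \<mu>: "\<mu> < 0" and y: "y > 0" and p: "p > 0"
  obtains a1 a2 where "a1 \<ge> 0" "a2 \<ge> 0"
    "nn_int {0<..} (\<lambda>t. t powr (- \<mu> / 2 - 1) * (y + t) powr ((\<mu> - 1) / 2) * exp (- p * t)) = ennreal a1"
    "nn_int {0<..} (\<lambda>t. t powr (- (1 + \<mu>) / 2) * (y + t) powr (\<mu> / 2) * exp (- p * t)) = ennreal a2"
    "D_real \<mu> (sqrt (2 * y * p)) * exp (y * p / 2) = 2 powr (\<mu> / 2) * sqrt y / Gamma (- \<mu> / 2) * a1"
    "D_real \<mu> (sqrt (2 * y * p)) * exp (y * p / 2) = 2 powr (\<mu> / 2) * sqrt p / Gamma ((1 - \<mu>) / 2) * a2"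
proof -
  define Z where "Z = sqrt (2 * y * p)"
  have Z: "Z > 0" "Z\<^sup>2 / 4 = y * p / 2" using y p by (auto simp: Z_def)
  define V where "V = exp (y * p / 2) * Gamma (- \<mu>) * D_real \<mu> Z"
  have V: "nn_int {0<..} (\<lambda>s. s powr (- \<mu> - 1) * exp (- s\<^sup>2 / 2) * exp (- Z * s)) = ennreal V" "V \<ge> 0"
    using nn_int_D_real[OF \<mu> Z(1)] unfolding Z(2) V_def[symmetric] by auto
  define x1 where "x1 = (1 - \<mu>) / 2"
  define x2 where "x2 = - \<mu> / 2"
  have x: "x1 > 0" "x2 > 0" using \<mu> by (auto simp: x1_def x2_def)
  define G where "G = Gamma (- \<mu>)"
  have G: "G > 0" "Gamma x1 > 0" "Gamma x2 > 0"
    unfolding G_def using x \<mu> by (auto intro!: Gamma_real_pos)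
  have dup: "Gamma x2 * Gamma x1 = 2 powr (1 + \<mu>) * sqrt pi * G"
    using Gamma_duplication_real[of "- \<mu>"] \<mu> unfolding G_def x1_def x2_def by simp
  have k: "sqrt (y * s\<^sup>2 / 2 * p) * 2 = Z * s" if "s > 0" for s
  proof -
    have "Z * s = sqrt (2 * y * p * s\<^sup>2)" using that by (simp add: Z_def real_sqrt_mult)
    also have "2 * y * p * s\<^sup>2 = (y * s\<^sup>2 / 2 * p) * 2\<^sup>2" by simp
    also have "sqrt \<dots> = sqrt (y * s\<^sup>2 / 2 * p) * 2" by (simp only: real_sqrt_mult real_sqrt_abs abs_numeral)
    finally show ?thesis ..
  qed
  have k': "exp (- 2 * sqrt (y * s\<^sup>2 / 2 * p)) = exp (- Z * s)" if "s > 0" for s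
    using k[OF that] by (simp add: mult.commute)
  let ?A = "\<lambda>r x. nn_int {0<..} (\<lambda>t. t powr (r + x) * (y + t) powr (- x) * exp (- p * t))"
  \<comment> \<open>The first factor normalises the t-integral to exp (-Z s), the second is the
    constant from \<open>nn_int_Gauss_subordination\<close>; \<open>\<kappa>1\<close> is built
    likewise.\<close>
  define \<kappa>2 where "\<kappa>2 = sqrt (p / pi) * (Gamma x2 / 2 * 2 powr x2)"
  have \<kappa>2: "\<kappa>2 > 0" using p G x by (auto simp: \<kappa>2_def)
  have "ennreal \<kappa>2 * ?A (- 1 / 2) x2 = ennreal (sqrt (p / pi)) * (\<integral>\<^sup>+s. nn_int {0<..} (\<lambda>t. (s powr (2 * x2 - 1) * exp (- s\<^sup>2 / 2)) *
        (t powr (- 1 / 2) * exp (- (y * s\<^sup>2 / 2) / t - p * t))) * indicator {0<..} s \<partial>lborel)"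
    unfolding nn_int_Gauss_subordination[OF x(2) y] \<kappa>2_def using p by (subst ennreal_mult') (auto simp: mult.assoc)
  also have "\<dots> = (\<integral>\<^sup>+s. ennreal (sqrt (p / pi)) * (nn_int {0<..} (\<lambda>t. (s powr (2 * x2 - 1) * exp (- s\<^sup>2 / 2)) *
        (t powr (- 1 / 2) * exp (- (y * s\<^sup>2 / 2) / t - p * t))) * indicator {0<..} s) \<partial>lborel)"
    by (rule nn_integral_cmult[symmetric]) measurable
  also have "\<dots> = nn_int {0<..} (\<lambda>s. s powr (- \<mu> - 1) * exp (- s\<^sup>2 / 2) * exp (- Z * s))"
  proof (rule nn_integral_cong)
    fix s :: real
    show "ennreal (sqrt (p / pi)) * (nn_int {0<..} (\<lambda>t. (s powr (2 * x2 - 1) * exp (- s\<^sup>2 / 2)) *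
        (t powr (- 1 / 2) * exp (- (y * s\<^sup>2 / 2) / t - p * t))) * indicator {0<..} s) =
        ennreal (s powr (- \<mu> - 1) * exp (- s\<^sup>2 / 2) * exp (- Z * s)) * indicator {0<..} s"
    proof (cases "s > 0")
      case True
      then have ys: "y * s\<^sup>2 / 2 > 0" using y by simp
      have "nn_int {0<..} (\<lambda>t. (s powr (2 * x2 - 1) * exp (- s\<^sup>2 / 2)) * (t powr (- 1 / 2) * exp (- (y * s\<^sup>2 / 2) / t - p * t))) =
          ennreal (s powr (2 * x2 - 1) * exp (- s\<^sup>2 / 2)) * ennreal (sqrt (pi / p) * exp (- Z * s))"
        unfolding nn_int_exp_reciprocal_half[OF ys p, unfolded k'[OF True], symmetric] by (rule nn_int_cmult) auto
      moreover have "sqrt (p / pi) * ((s powr (2 * x2 - 1) * exp (- s\<^sup>2 / 2)) * (sqrt (pi / p) * exp (- Z * s))) =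
          s powr (- \<mu> - 1) * exp (- s\<^sup>2 / 2) * exp (- Z * s)"
        using p by (simp add: real_sqrt_divide x2_def)
      ultimately show ?thesis using True p by (simp add: ennreal_mult'[symmetric])
    qed simp
  qed
  finally have "ennreal \<kappa>2 * ?A (- 1 / 2) x2 = ennreal V" unfolding V(1) .
  from ennreal_mult_eq_cancel[OF this \<kappa>2 V(2)] have A2: "?A (- 1 / 2) x2 = ennreal (V / \<kappa>2)" .
  \<comment> \<open>Here sqrt (pi / k) contains 1 / s. The choice x1 = x2 + 1/2 pays for it: 2 x1 -
    1 = -\<mu> exceeds the desired exponent -\<mu> - 1 by one.\<close>
  define \<kappa>1 where "\<kappa>1 = sqrt (y / (2 * pi)) * (Gamma x1 / 2 * 2 powr x1)"
  have \<kappa>1: "\<kappa>1 > 0" using y G x by (auto simp: \<kappa>1_def)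
  have "ennreal \<kappa>1 * ?A (- 3 / 2) x1 = ennreal (sqrt (y / (2 * pi))) * (\<integral>\<^sup>+s. nn_int {0<..} (\<lambda>t. (s powr (2 * x1 - 1) * exp (- s\<^sup>2 / 2)) *
        (t powr (- 3 / 2) * exp (- (y * s\<^sup>2 / 2) / t - p * t))) * indicator {0<..} s \<partial>lborel)"
    unfolding nn_int_Gauss_subordination[OF x(1) y] \<kappa>1_def using y by (subst ennreal_mult') (auto simp: mult.assoc)
  also have "\<dots> = (\<integral>\<^sup>+s. ennreal (sqrt (y / (2 * pi))) * (nn_int {0<..} (\<lambda>t. (s powr (2 * x1 - 1) * exp (- s\<^sup>2 / 2)) *
        (t powr (- 3 / 2) * exp (- (y * s\<^sup>2 / 2) / t - p * t))) * indicator {0<..} s) \<partial>lborel)"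
    by (rule nn_integral_cmult[symmetric]) measurable
  also have "\<dots> = nn_int {0<..} (\<lambda>s. s powr (- \<mu> - 1) * exp (- s\<^sup>2 / 2) * exp (- Z * s))"
  proof (rule nn_integral_cong)
    fix s :: real
    show "ennreal (sqrt (y / (2 * pi))) * (nn_int {0<..} (\<lambda>t. (s powr (2 * x1 - 1) * exp (- s\<^sup>2 / 2)) *
        (t powr (- 3 / 2) * exp (- (y * s\<^sup>2 / 2) / t - p * t))) * indicator {0<..} s) =
        ennreal (s powr (- \<mu> - 1) * exp (- s\<^sup>2 / 2) * exp (- Z * s)) * indicator {0<..} s"
    proof (cases "s > 0")
      case True
      then have ys: "y * s\<^sup>2 / 2 > 0" using y by simp
      have "nn_int {0<..} (\<lambda>t. (s powr (2 * x1 - 1) * exp (- s\<^sup>2 / 2)) * (t powr (- 3 / 2) * exp (- (y * s\<^sup>2 / 2) / t - p * t))) =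
          ennreal (s powr (2 * x1 - 1) * exp (- s\<^sup>2 / 2)) * ennreal (sqrt (pi / (y * s\<^sup>2 / 2)) * exp (- Z * s))"
        unfolding nn_int_exp_reciprocal_three_halves[OF ys p, unfolded k'[OF True], symmetric] by (rule nn_int_cmult) auto
      moreover have "sqrt (y / (2 * pi)) * ((s powr (2 * x1 - 1) * exp (- s\<^sup>2 / 2)) * (sqrt (pi / (y * s\<^sup>2 / 2)) * exp (- Z * s))) =
          s powr (- \<mu> - 1) * exp (- s\<^sup>2 / 2) * exp (- Z * s)"
      proof -
        have "sqrt (y / (2 * pi)) * sqrt (pi / (y * s\<^sup>2 / 2)) = sqrt (1 / s\<^sup>2)"
          unfolding real_sqrt_mult[symmetric] using y by simp
        also have "\<dots> = 1 / s" using True by (simp add: real_sqrt_divide)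
        finally have q: "sqrt (y / (2 * pi)) * sqrt (pi / (y * s\<^sup>2 / 2)) = 1 / s" .
        have e: "2 * x1 - 1 = (- \<mu> - 1) + 1" by (simp add: x1_def diff_divide_distrib)
        have "s powr (2 * x1 - 1) = s powr (- \<mu> - 1) * s"
          unfolding e powr_add using True by simp
        then have *: "s powr (2 * x1 - 1) * (sqrt (y / (2 * pi)) * sqrt (pi / (y * s\<^sup>2 / 2))) = s powr (- \<mu> - 1)"
          unfolding q using True by simp
        have "sqrt (y / (2 * pi)) * ((s powr (2 * x1 - 1) * exp (- s\<^sup>2 / 2)) * (sqrt (pi / (y * s\<^sup>2 / 2)) * exp (- Z * s))) =
            (s powr (2 * x1 - 1) * (sqrt (y / (2 * pi)) * sqrt (pi / (y * s\<^sup>2 / 2)))) * exp (- s\<^sup>2 / 2) * exp (- Z * s)"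
          by (simp only: mult_ac)
        with * show ?thesis by (simp only:)
      qed
      ultimately show ?thesis using True y by (simp add: ennreal_mult'[symmetric])
    qed simp
  qed
  finally have "ennreal \<kappa>1 * ?A (- 3 / 2) x1 = ennreal V" unfolding V(1) .
  from ennreal_mult_eq_cancel[OF this \<kappa>1 V(2)] have A1: "?A (- 3 / 2) x1 = ennreal (V / \<kappa>1)" .
  have VD: "D_real \<mu> Z * exp (y * p / 2) = V / G"
    using G by (simp add: V_def G_def)
  have pw: "2 powr (1 + \<mu>) = 2 * (2 powr (\<mu> / 2) * 2 powr (\<mu> / 2))"
    by (simp add: powr_add[symmetric]) (simp add: powr_add)
  have pw2: "2 powr x2 * 2 powr (\<mu> / 2) = 1" by (simp add: powr_add[symmetric] x2_def)
  have pw1: "2 powr x1 = 2 powr x2 * sqrt 2"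
    by (simp add: powr_half_sqrt[symmetric] powr_add[symmetric] x1_def x2_def diff_divide_distrib)
  show ?thesis
  proof (rule that[of "V / \<kappa>1" "V / \<kappa>2"])
    show "V / \<kappa>1 \<ge> 0" "V / \<kappa>2 \<ge> 0" using V \<kappa>1 \<kappa>2 by auto
    have e: "- 3 / 2 + x1 = - \<mu> / 2 - 1" "- x1 = (\<mu> - 1) / 2" "- 1 / 2 + x2 = - (1 + \<mu>) / 2" "- x2 = \<mu> / 2"
      by (simp_all add: x1_def x2_def field_simps)
    show "nn_int {0<..} (\<lambda>t. t powr (- \<mu> / 2 - 1) * (y + t) powr ((\<mu> - 1) / 2) * exp (- p * t)) = ennreal (V / \<kappa>1)"
      using A1 unfolding e .
    show "nn_int {0<..} (\<lambda>t. t powr (- (1 + \<mu>) / 2) * (y + t) powr (\<mu> / 2) * exp (- p * t)) = ennreal (V / \<kappa>2)"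
      using A2 unfolding e .
    have 1: "1 / G = 2 powr (\<mu> / 2) * sqrt y / Gamma x2 / \<kappa>1"
    proof -
      have "2 powr (\<mu> / 2) * sqrt y * G = Gamma x2 * \<kappa>1"
      proof -
        have "Gamma x2 * \<kappa>1 = sqrt y / (sqrt 2 * sqrt pi) * (Gamma x2 * Gamma x1) / 2 * 2 powr x1"
          by (simp add: \<kappa>1_def real_sqrt_divide real_sqrt_mult)
        also have "\<dots> = sqrt y * G * (2 powr x2 * 2 powr (\<mu> / 2)) * 2 powr (\<mu> / 2)"
          unfolding dup pw pw1 by simp
        finally show ?thesis unfolding pw2 by simp
      qed
      then show ?thesis using G \<kappa>1 by (simp add: field_simps)
    qed
    have 2: "1 / G = 2 powr (\<mu> / 2) * sqrt p / Gamma x1 / \<kappa>2"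
    proof -
      have "2 powr (\<mu> / 2) * sqrt p * G = Gamma x1 * \<kappa>2"
      proof -
        have "Gamma x1 * \<kappa>2 = sqrt p / sqrt pi * (Gamma x2 * Gamma x1) / 2 * 2 powr x2"
          by (simp add: \<kappa>2_def real_sqrt_divide)
        also have "\<dots> = sqrt p * G * (2 powr x2 * 2 powr (\<mu> / 2)) * 2 powr (\<mu> / 2)"
          unfolding dup pw by simp
        finally show ?thesis unfolding pw2 by simp
      qed
      then show ?thesis using G \<kappa>2 by (simp add: field_simps)
    qed
    show "D_real \<mu> (sqrt (2 * y * p)) * exp (y * p / 2) = 2 powr (\<mu> / 2) * sqrt y / Gamma (- \<mu> / 2) * (V / \<kappa>1)"
      using VD 1 unfolding Z_def[symmetric] x2_def[symmetric] by (metis (no_types, opaque_lifting) mult.commute mult_1 times_divide_eq_right times_divide_eq_left)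
    show "D_real \<mu> (sqrt (2 * y * p)) * exp (y * p / 2) = 2 powr (\<mu> / 2) * sqrt p / Gamma ((1 - \<mu>) / 2) * (V / \<kappa>2)"
      using VD 2 unfolding Z_def[symmetric] x1_def[symmetric] by (metis (no_types, opaque_lifting) mult.commute mult_1 times_divide_eq_right times_divide_eq_left)
  qed
qed

lemma Beta_add_of_nat_left_real:
  fixes a d :: real
  assumes "a > 0" "d > 0"
  shows "Beta (a + n) d = Beta a d * pochhammer a n / pochhammer (a + d) n"
proof -
  have np: "z \<notin> \<int>\<^sub>\<le>\<^sub>0" if "z > 0" for z :: real
    using that by (auto elim!: nonpos_Ints_cases)
  have nz: "Gamma z \<noteq> 0" if "z > 0" for z :: real
    using Gamma_real_pos[OF that] by simp
  have "Gamma a \<noteq> 0" "Gamma (a + d) \<noteq> 0" "Gamma (a + d + n) \<noteq> 0"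
    by (intro nz; use assms in simp)+
  then show ?thesis
    using assms by (simp add: Beta_def pochhammer_Gamma[OF np] field_simps)
qed

lemma nn_int_Beta:
  assumes "a > 0" "b > (0::real)"
  shows "nn_int {0<..<1} (\<lambda>t. t powr (a - 1) * (1 - t) powr (b - 1)) = ennreal (Beta a b)"
proof (rule nn_int_eq_ennreal_iff[THEN iffD2])
  show "Beta a b \<ge> 0" unfolding Beta_def
    using assms by (intro divide_nonneg_nonneg mult_nonneg_nonneg less_imp_le[OF Gamma_real_pos]) auto
qed (use real_Beta_integral[OF assms] in \<open>auto simp: set_borel_measurable_def\<close>)

text \<open>The reflection s = x (1 - v) turns exp (-p s) into exp (-p x) exp (p x v), whose power
  series has nonnegative terms. It may therefore be integrated termwise in \<open>ennreal\<close>;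
  each term is a Beta integral and the sum is Kummer's series.\<close>

lemma nn_int_Beta_exp:
  fixes a d x p :: real
  assumes a: "a > 0" and d: "d > 0" and x: "x > 0" and p: "p > 0"
  shows "nn_int {0<..<x} (\<lambda>s. s powr (d - 1) * (x - s) powr (a - 1) * exp (- p * s)) =
    ennreal (x powr (a + d - 1) * exp (- p * x) * Beta a d * kummer_real a (a + d) (p * x))"
proof -
  define C where "C = x powr (a + d - 1) * exp (- p * x)"
  define q where "q = p * x"
  have q: "q > 0" using p x by (simp add: q_def)
  have B: "Beta (a + n) d \<ge> 0" for n :: nat unfolding Beta_def
    using a d by (intro divide_nonneg_nonneg mult_nonneg_nonneg less_imp_le[OF Gamma_real_pos]) auto
  have "nn_int {0<..<x} (\<lambda>s. s powr (d - 1) * (x - s) powr (a - 1) * exp (- p * s)) =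
      nn_int {0<..<1} (\<lambda>v. C * (exp (q * v) * (v powr (a - 1) * (1 - v) powr (d - 1))))"
  proof (rule nn_int_change_of_variables[where g = "\<lambda>v. x * (1 - v)" and h = "\<lambda>s. 1 - s / x" and g' = "\<lambda>v. - x"])
    fix v :: real assume v: "v \<in> {0<..<1}"
    have F: "\<bar>- x\<bar> * ((x * (1 - v)) powr (d - 1) * (x - x * (1 - v)) powr (a - 1) * exp (- p * (x * (1 - v)))) =
        (x * x powr (d - 1) * x powr (a - 1)) * exp (- p * (x * (1 - v))) * (v powr (a - 1) * (1 - v) powr (d - 1))"
    proof -
      have "x - x * (1 - v) = x * v" by (simp add: algebra_simps)
      then have e: "(x - x * (1 - v)) powr (a - 1) = x powr (a - 1) * v powr (a - 1)"
        using v x by (simp add: powr_mult)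
      have e': "(x * (1 - v)) powr (d - 1) = x powr (d - 1) * (1 - v) powr (d - 1)"
        using v x by (simp add: powr_mult)
      have "\<bar>- x\<bar> = x" using x by simp
      then show ?thesis unfolding e e' by (simp only: mult_ac)
    qed
    have P: "x * x powr (d - 1) * x powr (a - 1) = x powr (a + d - 1)"
      using x powr_add[of x 1 "d - 1"] powr_add[of x d "a - 1"] by (simp add: algebra_simps)
    have E: "exp (- p * (x * (1 - v))) = exp (- p * x) * exp (q * v)"
      by (simp add: q_def exp_add[symmetric] algebra_simps)
    show "C * (exp (q * v) * (v powr (a - 1) * (1 - v) powr (d - 1))) =
        \<bar>- x\<bar> * ((x * (1 - v)) powr (d - 1) * (x - x * (1 - v)) powr (a - 1) * exp (- p * (x * (1 - v))))"
      unfolding F unfolding P E C_def by (simp only: mult_ac)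
  qed (use x in \<open>auto intro!: continuous_intros derivative_eq_intros simp: divide_less_eq mult_less_cancel_left1\<close>)
  also have "\<dots> = ennreal C * nn_int {0<..<1} (\<lambda>v. exp (q * v) * (v powr (a - 1) * (1 - v) powr (d - 1)))"
    by (rule nn_int_cmult) (auto simp: C_def)
  also have "nn_int {0<..<1} (\<lambda>v. exp (q * v) * (v powr (a - 1) * (1 - v) powr (d - 1))) =
      (\<integral>\<^sup>+v. (\<Sum>n. ennreal (q ^ n / fact n * (v powr (a + n - 1) * (1 - v) powr (d - 1))) * indicator {0<..<1} v) \<partial>lborel)"
  proof (rule nn_integral_cong)
    fix v :: real
    show "ennreal (exp (q * v) * (v powr (a - 1) * (1 - v) powr (d - 1))) * indicator {0<..<1} v =
        (\<Sum>n. ennreal (q ^ n / fact n * (v powr (a + n - 1) * (1 - v) powr (d - 1))) * indicator {0<..<1} v)"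
    proof (cases "v \<in> {0<..<1}")
      case True
      have "(\<lambda>n. (q * v) ^ n / fact n) sums exp (q * v)"
        using exp_converges[of "q * v"] by (simp add: divide_inverse mult.commute)
      then have "(\<lambda>n. (q * v) ^ n / fact n * (v powr (a - 1) * (1 - v) powr (d - 1))) sums (exp (q * v) * (v powr (a - 1) * (1 - v) powr (d - 1)))"
        by (rule sums_mult2)
      moreover have "(q * v) ^ n / fact n * (v powr (a - 1) * (1 - v) powr (d - 1)) =
          q ^ n / fact n * (v powr (a + n - 1) * (1 - v) powr (d - 1))" for n
      proof -
        have "v powr (a + n - 1) = v powr (a - 1) * v ^ n"
          using True by (simp add: powr_realpow[symmetric] powr_add[symmetric] algebra_simps)
        then show ?thesis by (simp add: power_mult_distrib)
      qed
      ultimately have "(\<lambda>n. q ^ n / fact n * (v powr (a + n - 1) * (1 - v) powr (d - 1))) sums (exp (q * v) * (v powr (a - 1) * (1 - v) powr (d - 1)))"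
        by (simp only:)
      then have "(\<Sum>n. ennreal (q ^ n / fact n * (v powr (a + n - 1) * (1 - v) powr (d - 1)))) = ennreal (exp (q * v) * (v powr (a - 1) * (1 - v) powr (d - 1)))"
        by (rule suminf_ennreal_eq[rotated]) (use q in \<open>auto intro!: mult_nonneg_nonneg\<close>)
      then show ?thesis by (simp only: indicator_simps(1)[OF True] mult_1_right)
    qed simp
  qed
  also have "\<dots> = (\<Sum>n. \<integral>\<^sup>+v. ennreal (q ^ n / fact n * (v powr (a + n - 1) * (1 - v) powr (d - 1))) * indicator {0<..<1} v \<partial>lborel)"
    by (rule nn_integral_suminf) measurable
  also have "\<dots> = (\<Sum>n. ennreal (Beta a d * (pochhammer a n / pochhammer (a + d) n * q ^ n / fact n)))"
  proof (rule suminf_cong)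
    fix n
    have "nn_int {0<..<1} (\<lambda>v. q ^ n / fact n * (v powr (a + n - 1) * (1 - v) powr (d - 1))) =
        ennreal (q ^ n / fact n) * ennreal (Beta (a + n) d)"
      using a d q by (subst nn_int_cmult) (auto simp: nn_int_Beta)
    also have "\<dots> = ennreal (q ^ n / fact n * Beta (a + n) d)"
      using q by (intro ennreal_mult'[symmetric]) simp
    also have "q ^ n / fact n * Beta (a + n) d = Beta a d * (pochhammer a n / pochhammer (a + d) n * q ^ n / fact n)"
      unfolding Beta_add_of_nat_left_real[OF a d] by (simp add: mult_ac)
    finally show "nn_int {0<..<1} (\<lambda>v. q ^ n / fact n * (v powr (a + n - 1) * (1 - v) powr (d - 1))) =
        ennreal (Beta a d * (pochhammer a n / pochhammer (a + d) n * q ^ n / fact n))" .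
  qed
  also have "\<dots> = ennreal (Beta a d * kummer_real a (a + d) q)"
  proof (rule suminf_ennreal_eq)
    show "(\<lambda>n. Beta a d * (pochhammer a n / pochhammer (a + d) n * q ^ n / fact n)) sums (Beta a d * kummer_real a (a + d) q)"
      using a d by (intro sums_mult kummer_real_sums) simp
    show "Beta a d * (pochhammer a n / pochhammer (a + d) n * q ^ n / fact n) \<ge> 0" for n
      using B[of 0] a d q by (intro mult_nonneg_nonneg divide_nonneg_nonneg pochhammer_nonneg) auto
  qed
  also have "ennreal C * \<dots> = ennreal (C * (Beta a d * kummer_real a (a + d) q))"
    by (rule ennreal_mult'[symmetric]) (simp add: C_def)
  finally show ?thesis by (simp add: C_def q_def mult.assoc)
qed

section \<open>Euler integrals with four branch points\<close>

text \<open>The real part is only a device for obtaining a real-valued function: in Euler's range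
  with z < 1 nothing is lost, by the third part of \<open>hyp2f1_real_euler\<close>.\<close>

definition hyp2f1_real :: "real \<Rightarrow> real \<Rightarrow> real \<Rightarrow> real \<Rightarrow> real" where
  "hyp2f1_real a b c z = Re (hyp2f1 (of_real a) (of_real b) (of_real c) (of_real z))"

lemma hyp2f1_real_commute: "hyp2f1_real a b c z = hyp2f1_real b a c z"
  unfolding hyp2f1_real_def by (subst hyp2f1_commute) (rule refl)

lemma continuous_on_hyp2f1_real:
  fixes f :: "real \<Rightarrow> real"
  assumes "c > 0" "continuous_on A f" "\<And>t. t \<in> A \<Longrightarrow> f t < 1"
  shows "continuous_on A (\<lambda>t. hyp2f1_real a b c (f t))"
  unfolding hyp2f1_real_def
proof (rule continuous_on_Re)
  show "continuous_on A (\<lambda>t. hyp2f1 (of_real a) (of_real b) (of_real c) (of_real (f t)))"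
    by (rule continuous_on_hyp2f1) (use assms in auto)
qed

lemma hyp2f1_real_euler:
  assumes b: "b > 0" "c > b" and z: "z < 1"
  shows "nn_int {0<..<1} (\<lambda>v. v powr (b - 1) * (1 - v) powr (c - b - 1) * (1 - z * v) powr (- a)) =
      ennreal (Beta b (c - b) * hyp2f1_real a b c z)" (is "?E")
    and "hyp2f1_real a b c z \<ge> 0" (is "?N")
    and "hyp2f1 (of_real a) (of_real b) (of_real c) (of_real z) = of_real (hyp2f1_real a b c z)" (is "?R")
proof -
  define k where "k = (\<lambda>v::real. v powr (b - 1) * (1 - v) powr (c - b - 1) * (1 - z * v) powr (- a))"
  have B: "Beta b (c - b) > 0" unfolding Beta_def
    using b by (intro divide_pos_pos mult_pos_pos Gamma_real_pos) auto
  have zs: "complex_of_real z \<in> hyp2f1_slit" by (rule real_mem_slit[OF z])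
  have pos: "1 - z * v > 0" if "v \<in> {0<..<1}" for v
  proof (cases "z \<ge> 0")
    case True
    then have "z * v \<le> z * 1" using that by (intro mult_left_mono) auto
    then show ?thesis using z by simp
  next
    case False
    then have "z * v < 0" using that by (intro mult_neg_pos) auto
    then show ?thesis by simp
  qed
  have ek: "euler_kernel (of_real a) (of_real b) (of_real c) (of_real z) v = of_real (k v)" if v: "v \<in> {0<..<1}" for v
  proof -
    have "complex_of_real v powr (of_real b - 1) = of_real (v powr (b - 1))"
      using v powr_of_real[of v "b - 1"] by simp
    moreover have "complex_of_real (1 - v) powr (of_real c - of_real b - 1) = of_real ((1 - v) powr (c - b - 1))"
      using v powr_of_real[of "1 - v" "c - b - 1"] by simp
    moreover have "(1 - complex_of_real z * of_real v) powr (- of_real a) = of_real ((1 - z * v) powr (- a))"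
      using pos[OF v] powr_of_real[of "1 - z * v" "- a"] by simp
    ultimately show ?thesis unfolding euler_kernel_def k_def by (simp only: of_real_mult)
  qed
  have eq: "(\<lambda>v. indicator {0<..<1} v *\<^sub>R euler_kernel (of_real a) (of_real b) (of_real c) (of_real z) v) =
      (\<lambda>v. complex_of_real (indicator {0<..<1} v *\<^sub>R k v))"
    using ek by (auto simp: indicator_def fun_eq_iff)
  have "set_integrable lborel {0<..<1} (euler_kernel (of_real a) (of_real b) (of_real c) (of_real z))"
    by (rule euler_kernel_integrable) (use b zs in auto)
  then have int: "set_integrable lborel {0<..<1} k"
    unfolding set_integrable_def eq complex_of_real_integrable_eq .
  define I where "I = (LBINT v:{0<..<1}. k v)"
  have I0: "I \<ge> 0" unfolding I_def set_lebesgue_integral_def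
    by (intro integral_nonneg_AE) (auto simp: k_def)
  have "complex_of_real I = (LBINT v:{0<..<1}. euler_kernel (of_real a) (of_real b) (of_real c) (of_real z) v)"
    unfolding I_def set_lebesgue_integral_def eq by (rule integral_complex_of_real[symmetric])
  also have "\<dots> = Beta (of_real b) (of_real c - of_real b) * hyp2f1 (of_real a) (of_real b) (of_real c) (of_real z)"
    by (rule euler_integral_eq_hyp2f1) (use b zs in auto)
  also have "Beta (complex_of_real b) (of_real c - of_real b) = of_real (Beta b (c - b))"
    using Beta_complex_of_real[of b "c - b"] by simp
  finally have h: "hyp2f1 (of_real a) (of_real b) (of_real c) (of_real z) = of_real (I / Beta b (c - b))"
    using B by (simp add: field_simps)
  then have hr: "hyp2f1_real a b c z = I / Beta b (c - b)" by (simp add: hyp2f1_real_def)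
  show ?R unfolding hr h ..
  show ?N unfolding hr using I0 B by simp
  have "Beta b (c - b) * hyp2f1_real a b c z = I" unfolding hr using B by simp
  moreover have "nn_int {0<..<1} k = ennreal I"
    by (rule nn_int_eq_ennreal_iff[THEN iffD2])
      (use int I0 in \<open>auto simp: I_def k_def set_borel_measurable_def\<close>)
  ultimately show ?E unfolding k_def by simp
qed

text \<open>D is the denominator of the Moebius map. The four factors contribute D^(-e1-e2-e3-e4) =
  D^2, which cancels the Jacobian; this is where the exponent sum -2 enters. Logarithms make the
  identity linear in the exponents.\<close>

lemma Moebius_powr_left:
  fixes T P M Q D u v w e1 e2 e3 e4 :: real
  assumes pos: "T > 0" "P > 0" "M > 0" "Q > 0" "D > 0" "u > 0" "v > 0" "w > 0"
    and e: "e1 + e2 + e3 + e4 = - 2"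
  shows "T * P * M / D\<^sup>2 * ((T * P * v / D) powr e1 * (P * M / D) powr e2 * (T * M * u / D) powr e3 * (Q * M * w / D) powr e4) =
    T powr (e1 + e3 + 1) * P powr (e1 + e2 + 1) * M powr (e2 + e3 + e4 + 1) * Q powr e4 * (v powr e1 * u powr e3 * w powr e4)"
proof (rule ln_inj_iff[THEN iffD1])
  have e4: "e4 = - 2 - e1 - e2 - e3" using e by simp
  show "ln (T * P * M / D\<^sup>2 * ((T * P * v / D) powr e1 * (P * M / D) powr e2 * (T * M * u / D) powr e3 * (Q * M * w / D) powr e4)) =
    ln (T powr (e1 + e3 + 1) * P powr (e1 + e2 + 1) * M powr (e2 + e3 + e4 + 1) * Q powr e4 * (v powr e1 * u powr e3 * w powr e4))"
    using pos unfolding e4 by (simp add: ln_mult ln_div ln_powr ln_realpow) (simp add: algebra_simps)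
qed (use pos in auto)

lemma Moebius_powr_right:
  fixes T P M N D u v w e1 e2 e3 e4 :: real
  assumes pos: "T > 0" "P > 0" "M > 0" "N > 0" "D > 0" "u > 0" "v > 0" "w > 0"
    and e: "e1 + e2 + e3 + e4 = - 2"
  shows "T * P * M / D\<^sup>2 * ((T * P * u / D) powr e1 * (P * M / D) powr e2 * (T * M * v / D) powr e3 * (P * N * w / D) powr e4) =
    T powr (e1 + e3 + 1) * P powr (e1 + e2 + e4 + 1) * M powr (e2 + e3 + 1) * N powr e4 * (v powr e3 * u powr e1 * w powr e4)"
proof (rule ln_inj_iff[THEN iffD1])
  have e4: "e4 = - 2 - e1 - e2 - e3" using e by simp
  show "ln (T * P * M / D\<^sup>2 * ((T * P * u / D) powr e1 * (P * M / D) powr e2 * (T * M * v / D) powr e3 * (P * N * w / D) powr e4)) =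
    ln (T powr (e1 + e3 + 1) * P powr (e1 + e2 + e4 + 1) * M powr (e2 + e3 + 1) * N powr e4 * (v powr e3 * u powr e1 * w powr e4))"
    using pos unfolding e4 by (simp add: ln_mult ln_div ln_powr ln_realpow) (simp add: algebra_simps)
qed (use pos in auto)

text \<open>An Euler integral with four finite branch points 0, T, P, Q whose exponents add up to -2 is
  regular at infinity, so a Moebius map sending P to infinity reduces it to the Gauss function of
  the cross ratio. The two lemmas differ in whether 0 or T is mapped to 0.\<close>

lemma nn_int_four_points_left:
  fixes T P Q e1 e2 e3 e4 :: real
  assumes T: "0 < T" "T < P" "T < Q" and e: "e1 + e2 + e3 + e4 = - 2"
    and e13: "e1 > - 1" "e3 > - 1"
  defines "z \<equiv> T * (P - Q) / (Q * (P - T))"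
  shows "nn_int {0<..<T} (\<lambda>s. s powr e1 * (P - s) powr e2 * (T - s) powr e3 * (Q - s) powr e4) =
    ennreal (T powr (e1 + e3 + 1) * P powr (e1 + e2 + 1) * (P - T) powr (e2 + e3 + e4 + 1) * Q powr e4 *
      (Beta (e1 + 1) (e3 + 1) * hyp2f1_real (- e4) (e1 + 1) (e1 + e3 + 2) z))"
proof -
  define M where "M = P - T"
  have pos: "T > 0" "P > 0" "M > 0" "Q > 0" using T by (auto simp: M_def)
  define C where "C = T powr (e1 + e3 + 1) * P powr (e1 + e2 + 1) * M powr (e2 + e3 + e4 + 1) * Q powr e4"
  \<comment> \<open>g maps 0, 1, infinity to 0, T, P. The preimage of Q is 1 / z (infinity if P =
    Q), so Q - g v carries the factor 1 - z v.\<close>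
  define g where "g = (\<lambda>v. T * P * v / (M + T * v))"
  have D: "M + T * v > 0" if "v \<in> {0<..<1}" for v using that pos by (intro add_pos_pos) auto
  have z: "z < 1" "Q * M * z = T * (P - Q)"
  proof -
    show *: "Q * M * z = T * (P - Q)" using pos by (simp add: z_def M_def)
    have "T * (P - Q) < Q * M" using T by (simp add: M_def algebra_simps)
    then show "z < 1" unfolding *[symmetric] using pos by simp
  qed
  have gT: "T - g v = T * M * (1 - v) / (M + T * v)" "P - g v = P * M / (M + T * v)"
      "Q - g v = Q * M * (1 - z * v) / (M + T * v)" "g v > 0" if v: "v \<in> {0<..<1}" for v
  proof -
    show "T - g v = T * M * (1 - v) / (M + T * v)"
      using D[OF v] by (simp add: g_def M_def field_simps)
    show "P - g v = P * M / (M + T * v)"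
      using D[OF v] by (simp add: g_def field_simps)
    have "Q * M * (1 - z * v) = Q * M - (Q * M * z) * v" by (simp add: algebra_simps)
    also have "\<dots> = Q * (M + T * v) - T * P * v"
      unfolding z(2) by (simp add: algebra_simps)
    finally show "Q - g v = Q * M * (1 - z * v) / (M + T * v)"
      using D[OF v] by (simp add: g_def diff_divide_distrib)
    show "g v > 0" unfolding g_def using D[OF v] pos v by (intro divide_pos_pos mult_pos_pos) auto
  qed
  have w: "1 - z * v > 0" if v: "v \<in> {0<..<1}" for v
  proof -
    have "T - g v > 0" unfolding gT(1)[OF v] using D[OF v] pos v by (intro divide_pos_pos mult_pos_pos) auto
    then have "Q - g v > 0" using T by simp
    then have "Q * M * (1 - z * v) > 0" unfolding gT(3)[OF v] using D[OF v] by (simp add: zero_less_divide_iff)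
    moreover have "Q * M > 0" using pos by simp
    ultimately show ?thesis by (simp only: zero_less_mult_pos)
  qed
  have "nn_int {0<..<T} (\<lambda>s. s powr e1 * (P - s) powr e2 * (T - s) powr e3 * (Q - s) powr e4) =
      nn_int {0<..<1} (\<lambda>v. C * (v powr e1 * (1 - v) powr e3 * (1 - z * v) powr e4))"
  proof (rule nn_int_change_of_variables[where g = g and h = "\<lambda>s. s * M / (T * (P - s))"
        and g' = "\<lambda>v. T * P * M / (M + T * v)\<^sup>2"])
    fix v :: real assume v: "v \<in> {0<..<1}"
    have "T - g v > 0" unfolding gT(1)[OF v] using D[OF v] pos v by (intro divide_pos_pos mult_pos_pos) auto
    then show "g v \<in> {0<..<T}" using gT(4)[OF v] by simp
    show "g v * M / (T * (P - g v)) = v"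
      unfolding gT(2)[OF v] using D[OF v] pos by (simp add: g_def)
    have "((\<lambda>v. T * P * v / (M + T * v)) has_real_derivative (T * P * (M + T * v) - T * P * v * T) / ((M + T * v) * (M + T * v))) (at v)"
      using D[OF v] by (auto intro!: derivative_eq_intros)
    moreover have "(T * P * (M + T * v) - T * P * v * T) / ((M + T * v) * (M + T * v)) = T * P * M / (M + T * v)\<^sup>2"
      by (simp add: power2_eq_square algebra_simps)
    ultimately show "(g has_real_derivative T * P * M / (M + T * v)\<^sup>2) (at v)"
      unfolding g_def by (simp only:)
    have A: "\<bar>T * P * M / (M + T * v)\<^sup>2\<bar> = T * P * M / (M + T * v)\<^sup>2" using pos D[OF v] by simp
    show "C * (v powr e1 * (1 - v) powr e3 * (1 - z * v) powr e4) =
        \<bar>T * P * M / (M + T * v)\<^sup>2\<bar> * (g v powr e1 * (P - g v) powr e2 * (T - g v) powr e3 * (Q - g v) powr e4)"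
      unfolding A gT(1-3)[OF v] C_def unfolding g_def
      by (rule Moebius_powr_left[OF pos D[OF v] _ _ w[OF v] e, symmetric]) (use v in auto)
  next
    fix s assume s: "s \<in> {0<..<T}"
    have Ps: "P - s > 0" using s T by simp
    have "s * M < T * (P - s)" using s T by (simp add: M_def algebra_simps)
    then show "s * M / (T * (P - s)) \<in> {0<..<1}" using Ps s pos by (simp add: divide_less_eq)
    have "M + T * (s * M / (T * (P - s))) = P * M / (P - s)"
      using Ps pos by (simp add: M_def field_simps)
    then show "g (s * M / (T * (P - s))) = s"
      unfolding g_def using Ps pos by simp
  next
    show "continuous_on {0<..<1} (\<lambda>v. T * P * M / (M + T * v)\<^sup>2)"
      using D by (intro continuous_intros) (auto simp: less_le)
    show "continuous_on {0<..<T} (\<lambda>s. s powr e1 * (P - s) powr e2 * (T - s) powr e3 * (Q - s) powr e4)"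
      using T by (intro continuous_intros) auto
  qed auto
  also have "\<dots> = ennreal C * nn_int {0<..<1} (\<lambda>v. v powr e1 * (1 - v) powr e3 * (1 - z * v) powr e4)"
    by (rule nn_int_cmult) (auto simp: C_def)
  also have "nn_int {0<..<1} (\<lambda>v. v powr e1 * (1 - v) powr e3 * (1 - z * v) powr e4) =
      ennreal (Beta (e1 + 1) (e3 + 1) * hyp2f1_real (- e4) (e1 + 1) (e1 + e3 + 2) z)"
    using hyp2f1_real_euler(1)[of "e1 + 1" "e1 + e3 + 2" z "- e4"] e13 z by (simp add: algebra_simps)
  also have "ennreal C * \<dots> = ennreal (C * (Beta (e1 + 1) (e3 + 1) * hyp2f1_real (- e4) (e1 + 1) (e1 + e3 + 2) z))"
    by (rule ennreal_mult'[symmetric]) (simp add: C_def)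
  finally show ?thesis by (simp only: C_def M_def)
qed

lemma nn_int_four_points_right:
  fixes T P Q e1 e2 e3 e4 :: real
  assumes T: "0 < T" "T < P" "T < Q" and e: "e1 + e2 + e3 + e4 = - 2"
    and e13: "e1 > - 1" "e3 > - 1"
  defines "z \<equiv> T * (Q - P) / (P * (Q - T))"
  shows "nn_int {0<..<T} (\<lambda>s. s powr e1 * (P - s) powr e2 * (T - s) powr e3 * (Q - s) powr e4) =
    ennreal (T powr (e1 + e3 + 1) * P powr (e1 + e2 + e4 + 1) * (P - T) powr (e2 + e3 + 1) * (Q - T) powr e4 *
      (Beta (e3 + 1) (e1 + 1) * hyp2f1_real (- e4) (e3 + 1) (e1 + e3 + 2) z))"
proof -
  define M where "M = P - T"
  define N where "N = Q - T"
  have pos: "T > 0" "P > 0" "M > 0" "N > 0" using T by (auto simp: M_def N_def)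
  define C where "C = T powr (e1 + e3 + 1) * P powr (e1 + e2 + e4 + 1) * M powr (e2 + e3 + 1) * N powr e4"
  \<comment> \<open>g maps 0, 1, infinity to T, 0, P, and again the preimage of Q is 1 / z. It
    decreases, so the exponents at 0 and T change places in the Beta density.\<close>
  define g where "g = (\<lambda>v. T * P * (1 - v) / (P - T * v))"
  have D: "P - T * v > 0" if "v \<in> {0<..<1}" for v
  proof -
    have "T * v < T * 1" using that pos by (intro mult_strict_left_mono) auto
    then show ?thesis using T by linarith
  qed
  have z: "z < 1" "P * N * z = T * (Q - P)"
  proof -
    show *: "P * N * z = T * (Q - P)" using pos by (simp add: z_def N_def)
    have "T * (Q - P) < P * N" using T by (simp add: N_def algebra_simps)
    then show "z < 1" unfolding *[symmetric] using pos by simp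
  qed
  have gT: "T - g v = T * M * v / (P - T * v)" "P - g v = P * M / (P - T * v)"
      "Q - g v = P * N * (1 - z * v) / (P - T * v)" "g v > 0" if v: "v \<in> {0<..<1}" for v
  proof -
    show "T - g v = T * M * v / (P - T * v)"
      using D[OF v] by (simp add: g_def M_def field_simps)
    show "P - g v = P * M / (P - T * v)"
      using D[OF v] by (simp add: g_def M_def field_simps)
    have "P * N * (1 - z * v) = P * N - (P * N * z) * v" by (simp add: algebra_simps)
    also have "\<dots> = Q * (P - T * v) - T * P * (1 - v)"
      unfolding z(2) by (simp add: N_def algebra_simps)
    finally show "Q - g v = P * N * (1 - z * v) / (P - T * v)"
      using D[OF v] by (simp add: g_def diff_divide_distrib)
    show "g v > 0" unfolding g_def using D[OF v] pos v by (intro divide_pos_pos mult_pos_pos) auto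
  qed
  have w: "1 - z * v > 0" if v: "v \<in> {0<..<1}" for v
  proof -
    have "T - g v > 0" unfolding gT(1)[OF v] using D[OF v] pos v by (intro divide_pos_pos mult_pos_pos) auto
    then have "Q - g v > 0" using T by simp
    then have "P * N * (1 - z * v) > 0" unfolding gT(3)[OF v] using D[OF v] by (simp add: zero_less_divide_iff)
    moreover have "P * N > 0" using pos by simp
    ultimately show ?thesis by (simp only: zero_less_mult_pos)
  qed
  have "nn_int {0<..<T} (\<lambda>s. s powr e1 * (P - s) powr e2 * (T - s) powr e3 * (Q - s) powr e4) =
      nn_int {0<..<1} (\<lambda>v. C * (v powr e3 * (1 - v) powr e1 * (1 - z * v) powr e4))"
  proof (rule nn_int_change_of_variables[where g = g and h = "\<lambda>s. P * (T - s) / (T * (P - s))"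
        and g' = "\<lambda>v. - (T * P * M / (P - T * v)\<^sup>2)"])
    fix v :: real assume v: "v \<in> {0<..<1}"
    have "T - g v > 0" unfolding gT(1)[OF v] using D[OF v] pos v by (intro divide_pos_pos mult_pos_pos) auto
    then show "g v \<in> {0<..<T}" using gT(4)[OF v] by simp
    show "P * (T - g v) / (T * (P - g v)) = v"
      unfolding gT(1,2)[OF v] using D[OF v] pos by simp
    have "((\<lambda>v. T * P * (1 - v) / (P - T * v)) has_real_derivative (- (T * P) * (P - T * v) - T * P * (1 - v) * - T) / ((P - T * v) * (P - T * v))) (at v)"
      using D[OF v] by (auto intro!: derivative_eq_intros)
    moreover have "(- (T * P) * (P - T * v) - T * P * (1 - v) * - T) / ((P - T * v) * (P - T * v)) = - (T * P * M / (P - T * v)\<^sup>2)"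
      unfolding minus_divide_left by (simp add: M_def power2_eq_square algebra_simps)
    ultimately show "(g has_real_derivative - (T * P * M / (P - T * v)\<^sup>2)) (at v)"
      unfolding g_def by (simp only:)
    have A: "\<bar>- (T * P * M / (P - T * v)\<^sup>2)\<bar> = T * P * M / (P - T * v)\<^sup>2" using pos D[OF v] by simp
    show "C * (v powr e3 * (1 - v) powr e1 * (1 - z * v) powr e4) =
        \<bar>- (T * P * M / (P - T * v)\<^sup>2)\<bar> * (g v powr e1 * (P - g v) powr e2 * (T - g v) powr e3 * (Q - g v) powr e4)"
      unfolding A gT(1-3)[OF v] C_def unfolding g_def
      by (rule Moebius_powr_right[OF pos D[OF v] _ _ w[OF v] e, symmetric]) (use v in auto)
  next
    fix s assume s: "s \<in> {0<..<T}"
    have Ps: "P - s > 0" using s T by simp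
    have "P * (T - s) < T * (P - s)" using s T by (simp add: algebra_simps)
    then show "P * (T - s) / (T * (P - s)) \<in> {0<..<1}" using Ps s pos by (simp add: divide_less_eq)
    have 1: "P - T * (P * (T - s) / (T * (P - s))) = P * M / (P - s)"
      using Ps pos by (simp add: M_def field_simps)
    have 2: "1 - P * (T - s) / (T * (P - s)) = s * M / (T * (P - s))"
      using Ps pos by (simp add: M_def field_simps)
    show "g (P * (T - s) / (T * (P - s))) = s"
      unfolding g_def 1 2 using Ps pos by simp
  next
    show "continuous_on {0<..<1} (\<lambda>v. - (T * P * M / (P - T * v)\<^sup>2))"
      using D by (intro continuous_intros) (auto simp: less_le)
    show "continuous_on {0<..<T} (\<lambda>s. s powr e1 * (P - s) powr e2 * (T - s) powr e3 * (Q - s) powr e4)"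
      using T by (intro continuous_intros) auto
  qed auto
  also have "\<dots> = ennreal C * nn_int {0<..<1} (\<lambda>v. v powr e3 * (1 - v) powr e1 * (1 - z * v) powr e4)"
    by (rule nn_int_cmult) (auto simp: C_def)
  also have "nn_int {0<..<1} (\<lambda>v. v powr e3 * (1 - v) powr e1 * (1 - z * v) powr e4) =
      ennreal (Beta (e3 + 1) (e1 + 1) * hyp2f1_real (- e4) (e3 + 1) (e1 + e3 + 2) z)"
    using hyp2f1_real_euler(1)[of "e3 + 1" "e1 + e3 + 2" z "- e4"] e13 z by (simp add: algebra_simps)
  also have "ennreal C * \<dots> = ennreal (C * (Beta (e3 + 1) (e1 + 1) * hyp2f1_real (- e4) (e3 + 1) (e1 + e3 + 2) z))"
    by (rule ennreal_mult'[symmetric]) (simp add: C_def)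
  finally show ?thesis by (simp only: C_def M_def N_def)
qed

text \<open>Tonelli and the shift t -> t - s. The density \<alpha> enters only at t - s > 0 and
  \<beta> only on (0, x), so the inner integral stops at min t x; this is why the final formula
  breaks at t = x.\<close>

lemma nn_int_laplace_convolution:
  fixes \<alpha> \<beta> :: "real \<Rightarrow> real"
  assumes [measurable]: "\<alpha> \<in> borel_measurable borel" "\<beta> \<in> borel_measurable borel"
    and \<alpha>: "\<And>t. \<alpha> t \<ge> 0" and \<beta>: "\<And>t. \<beta> t \<ge> 0"
  shows "nn_int {0<..} (\<lambda>t. \<alpha> t * exp (- p * t)) * nn_int {0<..<x} (\<lambda>s. \<beta> s * exp (- p * s)) =
    (\<integral>\<^sup>+t. ennreal (exp (- p * t)) * nn_int {0<..<min t x} (\<lambda>s. \<beta> s * \<alpha> (t - s)) * indicator {0<..} t \<partial>lborel)"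
proof -
  let ?F = "\<lambda>s t. \<beta> s * \<alpha> (t - s) * exp (- p * t) * indicator {0<..} (t - s)"
  have "nn_int {0<..} (\<lambda>t. \<alpha> t * exp (- p * t)) * nn_int {0<..<x} (\<lambda>s. \<beta> s * exp (- p * s)) =
      (\<integral>\<^sup>+s. nn_int {0<..} (\<lambda>t. \<alpha> t * exp (- p * t)) * (ennreal (\<beta> s * exp (- p * s)) * indicator {0<..<x} s) \<partial>lborel)"
    by (rule nn_integral_cmult[symmetric]) measurable
  also have "\<dots> = (\<integral>\<^sup>+s. nn_int UNIV (?F s) * indicator {0<..<x} s \<partial>lborel)"
  proof (rule nn_integral_cong)
    fix s :: real
    have "nn_int {0<..} (\<lambda>t. \<alpha> t * exp (- p * t)) * ennreal (\<beta> s * exp (- p * s)) =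
        (\<integral>\<^sup>+t. ennreal (\<alpha> t * exp (- p * t)) * indicator {0<..} t * ennreal (\<beta> s * exp (- p * s)) \<partial>lborel)"
      by (rule nn_integral_multc[symmetric]) measurable
    also have "\<dots> = (\<integral>\<^sup>+t. ennreal (\<alpha> (t - s) * exp (- p * (t - s))) * indicator {0<..} (t - s) * ennreal (\<beta> s * exp (- p * s)) \<partial>lborel)"
      by (subst nn_integral_real_affine[where c = 1 and t = "- s"]) (simp_all add: add.commute)
    also have "\<dots> = nn_int UNIV (?F s)"
    proof (rule nn_integral_cong)
      fix t :: real
      have "exp (- p * (t - s)) * exp (- p * s) = exp (- p * t)" by (simp add: exp_add[symmetric] algebra_simps)
      then have *: "\<alpha> (t - s) * exp (- p * (t - s)) * (\<beta> s * exp (- p * s)) = \<beta> s * \<alpha> (t - s) * exp (- p * t)"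
        by (metis (no_types, opaque_lifting) mult.assoc mult.commute)
      then have "ennreal (\<alpha> (t - s) * exp (- p * (t - s))) * ennreal (\<beta> s * exp (- p * s)) = ennreal (\<beta> s * \<alpha> (t - s) * exp (- p * t))"
        by (subst *[symmetric], intro ennreal_mult'[symmetric]) (use \<alpha>[of "t - s"] in auto)
      then show "ennreal (\<alpha> (t - s) * exp (- p * (t - s))) * indicator {0<..} (t - s) * ennreal (\<beta> s * exp (- p * s)) =
          ennreal (?F s t) * indicator UNIV t"
        by (simp add: indicator_def)
    qed
    finally show "nn_int {0<..} (\<lambda>t. \<alpha> t * exp (- p * t)) * (ennreal (\<beta> s * exp (- p * s)) * indicator {0<..<x} s) =
        nn_int UNIV (?F s) * indicator {0<..<x} s"
      by (simp only: mult.assoc[symmetric])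
  qed
  also have "\<dots> = (\<integral>\<^sup>+t. nn_int {0<..<x} (\<lambda>s. ?F s t) * indicator UNIV t \<partial>lborel)"
    by (rule nn_int_swap) measurable
  also have "\<dots> = (\<integral>\<^sup>+t. ennreal (exp (- p * t)) * nn_int {0<..<min t x} (\<lambda>s. \<beta> s * \<alpha> (t - s)) * indicator {0<..} t \<partial>lborel)"
  proof (rule nn_integral_cong)
    fix t :: real
    have "nn_int {0<..<x} (\<lambda>s. ?F s t) = nn_int {0<..<min t x} (\<lambda>s. exp (- p * t) * (\<beta> s * \<alpha> (t - s)))"
      by (rule nn_integral_cong) (auto simp: indicator_def mult_ac)
    also have "\<dots> = ennreal (exp (- p * t)) * nn_int {0<..<min t x} (\<lambda>s. \<beta> s * \<alpha> (t - s))"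
      by (rule nn_int_cmult) auto
    finally show "nn_int {0<..<x} (\<lambda>s. ?F s t) * indicator UNIV t =
        ennreal (exp (- p * t)) * nn_int {0<..<min t x} (\<lambda>s. \<beta> s * \<alpha> (t - s)) * indicator {0<..} t"
      by (cases "t > 0") (auto simp: min_def)
  qed
  finally show ?thesis .
qed

section \<open>The product formula for real parameters\<close>

lemma set_measurable_ennreal:
  assumes "set_borel_measurable lborel A f"
  shows "(\<lambda>t. ennreal (f t) * indicator A t) \<in> borel_measurable lborel"
proof -
  have "(\<lambda>t. ennreal (indicator A t *\<^sub>R f t)) \<in> borel_measurable lborel"
    using assms unfolding set_borel_measurable_def by measurable
  also have "(\<lambda>t. ennreal (indicator A t *\<^sub>R f t)) = (\<lambda>t. ennreal (f t) * indicator A t)"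
    by (auto simp: indicator_def fun_eq_iff)
  finally show ?thesis .
qed

lemma nn_integral_split_at:
  fixes x :: real
  assumes x: "x > 0"
    and F: "set_borel_measurable lborel {0<..<x} F" "\<And>t. 0 < t \<Longrightarrow> t < x \<Longrightarrow> K t = ennreal (c1 * F t)"
    and G: "set_borel_measurable lborel {x<..} G" "\<And>t. x < t \<Longrightarrow> K t = ennreal (c2 * G t)"
    and c: "c1 \<ge> 0" "c2 \<ge> 0"
  shows "(\<integral>\<^sup>+t. ennreal (exp (- p * t)) * K t * indicator {0<..} t \<partial>lborel) =
    ennreal c1 * nn_int {0<..<x} (\<lambda>t. exp (- p * t) * F t) + ennreal c2 * nn_int {x<..} (\<lambda>t. exp (- p * t) * G t)"
proof -
  have m: "set_borel_measurable lborel A (\<lambda>t. exp (- p * t) * F t)" if "set_borel_measurable lborel A F" for A F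
  proof -
    have "(\<lambda>t. exp (- p * t) * (indicator A t *\<^sub>R F t)) \<in> borel_measurable lborel"
      using that unfolding set_borel_measurable_def by measurable
    then show ?thesis unfolding set_borel_measurable_def by (simp add: mult_ac)
  qed
  note mF = set_measurable_ennreal[OF m[OF F(1)]] and mG = set_measurable_ennreal[OF m[OF G(1)]]
  have "(\<integral>\<^sup>+t. ennreal (exp (- p * t)) * K t * indicator {0<..} t \<partial>lborel) =
      (\<integral>\<^sup>+t. ennreal c1 * (ennreal (exp (- p * t) * F t) * indicator {0<..<x} t) +
        ennreal c2 * (ennreal (exp (- p * t) * G t) * indicator {x<..} t) \<partial>lborel)"
  proof (rule nn_integral_cong_AE, rule AE_mp[OF AE_lborel_singleton[of x]], intro AE_I2 impI)
    fix t :: real assume t: "t \<noteq> x"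
    have e: "ennreal (exp (- p * t)) * ennreal (c * r) = ennreal c * ennreal (exp (- p * t) * r)" if "c \<ge> 0" for c r
    proof -
      have "ennreal (exp (- p * t)) * ennreal (c * r) = ennreal (exp (- p * t) * (c * r))"
        by (rule ennreal_mult'[symmetric]) simp
      also have "exp (- p * t) * (c * r) = c * (exp (- p * t) * r)" by simp
      also have "ennreal \<dots> = ennreal c * ennreal (exp (- p * t) * r)" by (rule ennreal_mult'[OF that])
      finally show ?thesis .
    qed
    consider "t \<le> 0" | "0 < t" "t < x" | "x < t" using t by linarith
    then show "ennreal (exp (- p * t)) * K t * indicator {0<..} t =
        ennreal c1 * (ennreal (exp (- p * t) * F t) * indicator {0<..<x} t) +
        ennreal c2 * (ennreal (exp (- p * t) * G t) * indicator {x<..} t)"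
    proof cases
      case 1
      then show ?thesis using x by simp
    next
      case 2
      then show ?thesis using F(2)[OF 2] e[OF c(1), of "F t"] by simp
    next
      case 3
      then show ?thesis using G(2)[OF 3] e[OF c(2), of "G t"] x by simp
    qed
  qed
  also have "\<dots> = ennreal c1 * nn_int {0<..<x} (\<lambda>t. exp (- p * t) * F t) + ennreal c2 * nn_int {x<..} (\<lambda>t. exp (- p * t) * G t)"
    using mF mG by (simp add: nn_integral_add nn_integral_cmult)
  finally show ?thesis .
qed

text \<open>A finite sum with positive coefficients has finite summands. In this way convergence of
  the integrals in the real case follows from the finiteness of the product of Laplace
  transforms.\<close>

lemma ennreal_linear_combination:
  assumes "ennreal V = ennreal c1 * X + ennreal c2 * Y" "c1 > 0" "c2 > 0" "V \<ge> 0"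
  shows "\<exists>\<phi> \<gamma>. \<phi> \<ge> 0 \<and> \<gamma> \<ge> 0 \<and> X = ennreal \<phi> \<and> Y = ennreal \<gamma> \<and> V = c1 * \<phi> + c2 * \<gamma>"
proof -
  have "X \<noteq> top" "Y \<noteq> top"
    using assms by (auto simp: ennreal_mult_top)
  then obtain \<phi> \<gamma> where *: "\<phi> \<ge> 0" "\<gamma> \<ge> 0" "X = ennreal \<phi>" "Y = ennreal \<gamma>"
    by (cases X; cases Y) auto
  have "ennreal V = ennreal (c1 * \<phi> + c2 * \<gamma>)"
    using assms * by (simp add: ennreal_mult)
  then have "V = c1 * \<phi> + c2 * \<gamma>" using assms * by (subst (asm) ennreal_inj) auto
  with * show ?thesis by blast
qed

text \<open>Both follow from factorisations of denominator minus numerator: x y in the first case,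
  (t - x) (t + y) in the second.\<close>

lemma cross_ratio_less_1:
  fixes x y t :: real
  assumes "x > 0" "y > 0"
  shows "0 < t \<Longrightarrow> t < x \<Longrightarrow> t * (x - y - t) / ((x - t) * (y + t)) < 1"
    and "x < t \<Longrightarrow> x * y / (t * (y - x + t)) < 1"
proof -
  show "t * (x - y - t) / ((x - t) * (y + t)) < 1" if t: "0 < t" "t < x"
  proof -
    have "(x - t) * (y + t) - t * (x - y - t) = x * y" by (simp add: algebra_simps)
    moreover have "x * y > 0" using assms by simp
    ultimately have "t * (x - y - t) < (x - t) * (y + t)" by linarith
    moreover have "(x - t) * (y + t) > 0" using t assms by simp
    ultimately show ?thesis by (simp add: divide_less_eq)
  qed
  show "x * y / (t * (y - x + t)) < 1" if t: "x < t"
  proof -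
    have "t * (y - x + t) - x * y = (t - x) * (t + y)" by (simp add: algebra_simps)
    moreover have "(t - x) * (t + y) > 0" using t assms by simp
    moreover have "t * (y - x + t) > 0" using t assms by simp
    ultimately show ?thesis by (simp add: divide_less_eq)
  qed
qed

text \<open>Each pairing equates a product of two Laplace transforms with a combination of an
  integral over (0, x) and one over (x, infinity). The product of the two D's is a combination of
  \<open>a2 * b1\<close> and \<open>a1 * b2\<close>; \<open>G1\<close> stems from the even part of
  the second factor, \<open>G2\<close> from the odd part.\<close>

lemma product_formula_positive:
  fixes \<mu> \<nu> x y p :: real
  assumes \<mu>: "\<mu> < 0" and \<nu>: "- 1 < \<nu>" "\<nu> < 0" and x: "x > 0" and y: "y > 0" and p: "p > 0"
  defines "F \<equiv> \<lambda>t. t powr ((\<nu> - \<mu>) / 2) * (x - t) powr (- (1 + \<nu>) / 2) * (y + t) powr (\<mu> / 2) *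
      hyp2f1_real (- \<mu> / 2) ((1 + \<nu>) / 2) (1 + (\<nu> - \<mu>) / 2) (t * (x - y - t) / ((x - t) * (y + t)))"
    and "G1 \<equiv> \<lambda>t. t powr (\<nu> / 2) * (t - x) powr (- (1 + \<mu> + \<nu>) / 2) * (y - x + t) powr (\<mu> / 2) *
      hyp2f1_real (- \<mu> / 2) (- \<nu> / 2) (1 / 2) (x * y / (t * (y - x + t)))"
    and "G2 \<equiv> \<lambda>t. t powr ((\<nu> - 1) / 2) * (t - x) powr (- (1 + \<mu> + \<nu>) / 2) * (y - x + t) powr ((\<mu> - 1) / 2) *
      hyp2f1_real ((1 - \<mu>) / 2) ((1 - \<nu>) / 2) (3 / 2) (x * y / (t * (y - x + t)))"
  shows "\<exists>\<phi> \<gamma>1 \<gamma>2. \<phi> \<ge> 0 \<and> \<gamma>1 \<ge> 0 \<and> \<gamma>2 \<ge> 0 \<and>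
    nn_int {0<..<x} (\<lambda>t. exp (- p * t) * F t) = ennreal \<phi> \<and>
    nn_int {x<..} (\<lambda>t. exp (- p * t) * G1 t) = ennreal \<gamma>1 \<and>
    nn_int {x<..} (\<lambda>t. exp (- p * t) * G2 t) = ennreal \<gamma>2 \<and>
    p powr (- 1 / 2) * exp (1 / 2 * p * (y - x)) * D_real \<mu> (sqrt (2 * y * p)) * D_real \<nu> (- sqrt (2 * x * p)) =
      2 powr ((\<mu> - \<nu>) / 2) * sqrt pi * rGamma (1 + (\<nu> - \<mu>) / 2) * rGamma (- \<nu>) * \<phi> +
      2 powr ((\<mu> + \<nu>) / 2) * sqrt pi * (rGamma ((1 - \<mu>) / 2) * rGamma ((1 - \<nu>) / 2) * \<gamma>1 +
        2 * sqrt x * sqrt y * rGamma (- \<mu> / 2) * rGamma (- \<nu> / 2) * \<gamma>2)"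
proof -
  define B1 where "B1 = Beta ((1 + \<nu>) / 2) ((1 - \<mu>) / 2)"
  define B2 where "B2 = Beta (- \<nu> / 2) ((1 + \<nu>) / 2)"
  define B3 where "B3 = Beta (- \<mu> / 2) (1 + \<nu> / 2)"
  define B4 where "B4 = Beta ((1 - \<nu>) / 2) (1 + \<nu> / 2)"
  have B: "B1 > 0" "B2 > 0" "B3 > 0" "B4 > 0"
  proof -
    have "Beta u v > 0" if "u > 0" "v > 0" for u v :: real
      unfolding Beta_def using that by (intro divide_pos_pos mult_pos_pos Gamma_real_pos) auto
    then show "B1 > 0" "B2 > 0" "B3 > 0" "B4 > 0"
      unfolding B1_def B2_def B3_def B4_def using \<mu> \<nu> by auto
  qed
  have c0: "1 + (\<nu> - \<mu>) / 2 > 0" using \<mu> \<nu> by (simp add: field_simps)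
  \<comment> \<open>\<open>\<alpha>1\<close> and \<open>\<alpha>2\<close> are the two densities of
    \<open>D_real_laplace\<close>, without and with a factor sqrt p; \<open>\<beta>1\<close> and
    \<open>\<beta>2\<close> are the Beta densities of the even and the odd part.\<close>
  define \<alpha>1 where "\<alpha>1 = (\<lambda>t. t powr (- \<mu> / 2 - 1) * (y + t) powr ((\<mu> - 1) / 2))"
  define \<alpha>2 where "\<alpha>2 = (\<lambda>t. t powr (- (1 + \<mu>) / 2) * (y + t) powr (\<mu> / 2))"
  define \<beta>1 where "\<beta>1 = (\<lambda>s. s powr ((\<nu> - 1) / 2) * (x - s) powr (- \<nu> / 2 - 1))"
  define \<beta>2 where "\<beta>2 = (\<lambda>s. s powr (\<nu> / 2) * (x - s) powr (- (1 + \<nu>) / 2))"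
  have meas: "\<alpha>1 \<in> borel_measurable borel" "\<alpha>2 \<in> borel_measurable borel"
      "\<beta>1 \<in> borel_measurable borel" "\<beta>2 \<in> borel_measurable borel"
    unfolding \<alpha>1_def \<alpha>2_def \<beta>1_def \<beta>2_def by measurable
  have nonneg: "\<alpha>1 t \<ge> 0" "\<alpha>2 t \<ge> 0" "\<beta>1 t \<ge> 0" "\<beta>2 t \<ge> 0" for t
    by (simp_all add: \<alpha>1_def \<alpha>2_def \<beta>1_def \<beta>2_def)
  have mF: "set_borel_measurable lborel {0<..<x} F"
    unfolding F_def using x y c0
    by (intro set_borel_measurable_lborel continuous_on_mult continuous_on_hyp2f1_real cross_ratio_less_1)
      (auto intro!: continuous_intros)
  have mG: "set_borel_measurable lborel {x<..} G1" "set_borel_measurable lborel {x<..} G2"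
    unfolding G1_def G2_def using x y
    by (intro set_borel_measurable_lborel continuous_on_mult continuous_on_hyp2f1_real cross_ratio_less_1;
        auto intro!: continuous_intros)+
  \<comment> \<open>Here T = t, P = x, Q = y + t. In \<open>K2a\<close> P and Q change places, and
    \<open>nn_int_four_points_right\<close> yields the same Gauss function with its first two
    parameters interchanged.\<close>
  have K1a: "nn_int {0<..<min t x} (\<lambda>s. \<beta>1 s * \<alpha>2 (t - s)) = ennreal ((x powr (- 1 / 2) * B1) * F t)" if t: "0 < t" "t < x" for t
  proof -
    have "nn_int {0<..<min t x} (\<lambda>s. \<beta>1 s * \<alpha>2 (t - s)) =
        nn_int {0<..<t} (\<lambda>s. s powr ((\<nu> - 1) / 2) * (x - s) powr (- \<nu> / 2 - 1) * (t - s) powr (- (1 + \<mu>) / 2) * (y + t - s) powr (\<mu> / 2))"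
      using t by (simp add: \<alpha>2_def \<beta>1_def min_def mult.assoc add_diff_eq)
    also have "\<dots> = ennreal (t powr ((\<nu> - 1) / 2 + - (1 + \<mu>) / 2 + 1) * x powr ((\<nu> - 1) / 2 + (- \<nu> / 2 - 1) + 1) *
        (x - t) powr ((- \<nu> / 2 - 1) + - (1 + \<mu>) / 2 + \<mu> / 2 + 1) * (y + t) powr (\<mu> / 2) *
        (Beta ((\<nu> - 1) / 2 + 1) (- (1 + \<mu>) / 2 + 1) * hyp2f1_real (- (\<mu> / 2)) ((\<nu> - 1) / 2 + 1) ((\<nu> - 1) / 2 + - (1 + \<mu>) / 2 + 2)
          (t * (x - (y + t)) / ((y + t) * (x - t)))))"
      by (rule nn_int_four_points_left) (use t x y \<mu> \<nu> in \<open>auto simp: field_simps\<close>)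
    also have "(\<nu> - 1) / 2 + - (1 + \<mu>) / 2 + 1 = (\<nu> - \<mu>) / 2" by (simp add: field_simps)
    also have "(\<nu> - 1) / 2 + (- \<nu> / 2 - 1) + 1 = - 1 / 2" by (simp add: field_simps)
    also have "(- \<nu> / 2 - 1) + - (1 + \<mu>) / 2 + \<mu> / 2 + 1 = - (1 + \<nu>) / 2" by (simp add: field_simps)
    also have "(\<nu> - 1) / 2 + 1 = (1 + \<nu>) / 2" by (simp add: field_simps)
    also have "- (1 + \<mu>) / 2 + 1 = (1 - \<mu>) / 2" by (simp add: field_simps)
    also have "(\<nu> - 1) / 2 + - (1 + \<mu>) / 2 + 2 = 1 + (\<nu> - \<mu>) / 2" by (simp add: field_simps)
    also have "t * (x - (y + t)) / ((y + t) * (x - t)) = t * (x - y - t) / ((x - t) * (y + t))"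
      by (simp add: diff_diff_eq mult.commute)
    finally show ?thesis unfolding F_def B1_def by (simp add: mult_ac)
  qed
  \<comment> \<open>For t > x the upper end is T = x, and P = t. The third parameter e1 + e3 + 2 is
    1/2 for this pairing and 3/2 for \<open>K2b\<close>: the two Gauss functions of the second
    integrand.\<close>
  have K1b: "nn_int {0<..<min t x} (\<lambda>s. \<beta>1 s * \<alpha>2 (t - s)) = ennreal ((x powr (- 1 / 2) * B2) * G1 t)" if t: "x < t" for t
  proof -
    have "nn_int {0<..<min t x} (\<lambda>s. \<beta>1 s * \<alpha>2 (t - s)) =
        nn_int {0<..<x} (\<lambda>s. s powr ((\<nu> - 1) / 2) * (t - s) powr (- (1 + \<mu>) / 2) * (x - s) powr (- \<nu> / 2 - 1) * (y + t - s) powr (\<mu> / 2))"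
      using t by (simp add: \<alpha>2_def \<beta>1_def min_def mult_ac add_diff_eq)
    also have "\<dots> = ennreal (x powr ((\<nu> - 1) / 2 + (- \<nu> / 2 - 1) + 1) * t powr ((\<nu> - 1) / 2 + - (1 + \<mu>) / 2 + \<mu> / 2 + 1) *
        (t - x) powr (- (1 + \<mu>) / 2 + (- \<nu> / 2 - 1) + 1) * (y + t - x) powr (\<mu> / 2) *
        (Beta ((- \<nu> / 2 - 1) + 1) ((\<nu> - 1) / 2 + 1) * hyp2f1_real (- (\<mu> / 2)) ((- \<nu> / 2 - 1) + 1) ((\<nu> - 1) / 2 + (- \<nu> / 2 - 1) + 2)
          (x * (y + t - t) / (t * (y + t - x)))))"
      by (rule nn_int_four_points_right) (use t x y \<mu> \<nu> in \<open>auto simp: field_simps\<close>)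
    also have "(\<nu> - 1) / 2 + (- \<nu> / 2 - 1) + 1 = - 1 / 2" by (simp add: field_simps)
    also have "(\<nu> - 1) / 2 + - (1 + \<mu>) / 2 + \<mu> / 2 + 1 = \<nu> / 2" by (simp add: field_simps)
    also have "- (1 + \<mu>) / 2 + (- \<nu> / 2 - 1) + 1 = - (1 + \<mu> + \<nu>) / 2" by (simp add: field_simps)
    also have "(- \<nu> / 2 - 1) + 1 = - \<nu> / 2" by (simp add: field_simps)
    also have "(\<nu> - 1) / 2 + 1 = (1 + \<nu>) / 2" by (simp add: field_simps)
    also have "(\<nu> - 1) / 2 + (- \<nu> / 2 - 1) + 2 = 1 / 2" by (simp add: field_simps)
    also have "y + t - x = y - x + t" by simp
    also have "y + t - t = y" by simp
    finally show ?thesis unfolding G1_def B2_def by (simp add: mult_ac)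
  qed
  have K2a: "nn_int {0<..<min t x} (\<lambda>s. \<beta>2 s * \<alpha>1 (t - s)) = ennreal ((y powr (- 1 / 2) * B3) * F t)" if t: "0 < t" "t < x" for t
  proof -
    have "nn_int {0<..<min t x} (\<lambda>s. \<beta>2 s * \<alpha>1 (t - s)) =
        nn_int {0<..<t} (\<lambda>s. s powr (\<nu> / 2) * (y + t - s) powr ((\<mu> - 1) / 2) * (t - s) powr (- \<mu> / 2 - 1) * (x - s) powr (- (1 + \<nu>) / 2))"
      using t by (simp add: \<alpha>1_def \<beta>2_def min_def mult_ac add_diff_eq)
    also have "\<dots> = ennreal (t powr (\<nu> / 2 + (- \<mu> / 2 - 1) + 1) * (y + t) powr (\<nu> / 2 + (\<mu> - 1) / 2 + - (1 + \<nu>) / 2 + 1) *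
        (y + t - t) powr ((\<mu> - 1) / 2 + (- \<mu> / 2 - 1) + 1) * (x - t) powr (- (1 + \<nu>) / 2) *
        (Beta ((- \<mu> / 2 - 1) + 1) (\<nu> / 2 + 1) * hyp2f1_real (- (- (1 + \<nu>) / 2)) ((- \<mu> / 2 - 1) + 1) (\<nu> / 2 + (- \<mu> / 2 - 1) + 2)
          (t * (x - (y + t)) / ((y + t) * (x - t)))))"
      by (rule nn_int_four_points_right) (use t x y \<mu> \<nu> in \<open>auto simp: field_simps\<close>)
    also have "\<nu> / 2 + (- \<mu> / 2 - 1) + 1 = (\<nu> - \<mu>) / 2" by (simp add: field_simps)
    also have "\<nu> / 2 + (\<mu> - 1) / 2 + - (1 + \<nu>) / 2 + 1 = \<mu> / 2" by (simp add: field_simps)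
    also have "(\<mu> - 1) / 2 + (- \<mu> / 2 - 1) + 1 = - 1 / 2" by (simp add: field_simps)
    also have "(- \<mu> / 2 - 1) + 1 = - \<mu> / 2" by (simp add: field_simps)
    also have "\<nu> / 2 + 1 = 1 + \<nu> / 2" by (simp add: field_simps)
    also have "- (- (1 + \<nu>) / 2) = (1 + \<nu>) / 2" by (simp add: field_simps)
    also have "\<nu> / 2 + (- \<mu> / 2 - 1) + 2 = 1 + (\<nu> - \<mu>) / 2" by (simp add: field_simps)
    also have "y + t - t = y" by simp
    also have "t * (x - (y + t)) / ((y + t) * (x - t)) = t * (x - y - t) / ((x - t) * (y + t))"
      by (simp add: diff_diff_eq mult.commute)
    also have "hyp2f1_real ((1 + \<nu>) / 2) (- \<mu> / 2) (1 + (\<nu> - \<mu>) / 2) (t * (x - y - t) / ((x - t) * (y + t))) =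
        hyp2f1_real (- \<mu> / 2) ((1 + \<nu>) / 2) (1 + (\<nu> - \<mu>) / 2) (t * (x - y - t) / ((x - t) * (y + t)))"
      by (rule hyp2f1_real_commute)
    finally show ?thesis unfolding F_def B3_def by (simp add: mult_ac)
  qed
  have K2b: "nn_int {0<..<min t x} (\<lambda>s. \<beta>2 s * \<alpha>1 (t - s)) = ennreal ((x powr (1 / 2) * B4) * G2 t)" if t: "x < t" for t
  proof -
    have "nn_int {0<..<min t x} (\<lambda>s. \<beta>2 s * \<alpha>1 (t - s)) =
        nn_int {0<..<x} (\<lambda>s. s powr (\<nu> / 2) * (t - s) powr (- \<mu> / 2 - 1) * (x - s) powr (- (1 + \<nu>) / 2) * (y + t - s) powr ((\<mu> - 1) / 2))"
      using t by (simp add: \<alpha>1_def \<beta>2_def min_def mult_ac add_diff_eq)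
    also have "\<dots> = ennreal (x powr (\<nu> / 2 + - (1 + \<nu>) / 2 + 1) * t powr (\<nu> / 2 + (- \<mu> / 2 - 1) + (\<mu> - 1) / 2 + 1) *
        (t - x) powr ((- \<mu> / 2 - 1) + - (1 + \<nu>) / 2 + 1) * (y + t - x) powr ((\<mu> - 1) / 2) *
        (Beta (- (1 + \<nu>) / 2 + 1) (\<nu> / 2 + 1) * hyp2f1_real (- ((\<mu> - 1) / 2)) (- (1 + \<nu>) / 2 + 1) (\<nu> / 2 + - (1 + \<nu>) / 2 + 2)
          (x * (y + t - t) / (t * (y + t - x)))))"
      by (rule nn_int_four_points_right) (use t x y \<mu> \<nu> in \<open>auto simp: field_simps\<close>)
    also have "\<nu> / 2 + - (1 + \<nu>) / 2 + 1 = 1 / 2" by (simp add: field_simps)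
    also have "\<nu> / 2 + (- \<mu> / 2 - 1) + (\<mu> - 1) / 2 + 1 = (\<nu> - 1) / 2" by (simp add: field_simps)
    also have "(- \<mu> / 2 - 1) + - (1 + \<nu>) / 2 + 1 = - (1 + \<mu> + \<nu>) / 2" by (simp add: field_simps)
    also have "- (1 + \<nu>) / 2 + 1 = (1 - \<nu>) / 2" by (simp add: field_simps)
    also have "\<nu> / 2 + 1 = 1 + \<nu> / 2" by (simp add: field_simps)
    also have "- ((\<mu> - 1) / 2) = (1 - \<mu>) / 2" by (simp add: field_simps)
    also have "\<nu> / 2 + - (1 + \<nu>) / 2 + 2 = 3 / 2" by (simp add: field_simps)
    also have "y + t - x = y - x + t" by simp
    also have "y + t - t = y" by simp
    finally show ?thesis unfolding G2_def B4_def by (simp add: mult_ac)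
  qed
  obtain a1 a2 where a: "a1 \<ge> 0" "a2 \<ge> 0"
    "nn_int {0<..} (\<lambda>t. \<alpha>1 t * exp (- p * t)) = ennreal a1"
    "nn_int {0<..} (\<lambda>t. \<alpha>2 t * exp (- p * t)) = ennreal a2"
    "D_real \<mu> (sqrt (2 * y * p)) * exp (y * p / 2) = 2 powr (\<mu> / 2) * sqrt y / Gamma (- \<mu> / 2) * a1"
    "D_real \<mu> (sqrt (2 * y * p)) * exp (y * p / 2) = 2 powr (\<mu> / 2) * sqrt p / Gamma ((1 - \<mu>) / 2) * a2"
    unfolding \<alpha>1_def \<alpha>2_def by (rule D_real_laplace[OF \<mu> y p]) blast
  define k1 where "k1 = kummer_real (- \<nu> / 2) (1 / 2) (p * x)"
  define k2 where "k2 = kummer_real ((1 - \<nu>) / 2) (3 / 2) (p * x)"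
  define b1 where "b1 = x powr (- 1 / 2) * exp (- p * x) * B2 * k1"
  define b2 where "b2 = x powr (1 / 2) * exp (- p * x) * B4 * k2"
  have k0: "k1 \<ge> 0" "k2 \<ge> 0"
  proof -
    have "kummer_real a b (p * x) \<ge> 0" if "a > 0" "b > 0" for a b
      by (rule sums_le[OF _ sums_zero kummer_real_sums[OF that(2)]])
        (use that p x in \<open>auto intro!: divide_nonneg_nonneg mult_nonneg_nonneg pochhammer_nonneg\<close>)
    then show "k1 \<ge> 0" "k2 \<ge> 0" unfolding k1_def k2_def using \<nu> by auto
  qed
  have b: "b1 \<ge> 0" "b2 \<ge> 0" using k0 B by (auto simp: b1_def b2_def)
  have nb1: "nn_int {0<..<x} (\<lambda>s. \<beta>1 s * exp (- p * s)) = ennreal b1"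
    using nn_int_Beta_exp[of "- \<nu> / 2" "(1 + \<nu>) / 2" x p] \<nu> x p
    unfolding \<beta>1_def b1_def B2_def k1_def by (simp add: add_divide_distrib diff_divide_distrib)
  have nb2: "nn_int {0<..<x} (\<lambda>s. \<beta>2 s * exp (- p * s)) = ennreal b2"
    using nn_int_Beta_exp[of "(1 - \<nu>) / 2" "1 + \<nu> / 2" x p] \<nu> x p
    unfolding \<beta>2_def b2_def B4_def k2_def by (simp add: add_divide_distrib diff_divide_distrib)
  have "ennreal (a2 * b1) = nn_int {0<..} (\<lambda>t. \<alpha>2 t * exp (- p * t)) * nn_int {0<..<x} (\<lambda>s. \<beta>1 s * exp (- p * s))"
    unfolding a(4) nb1 by (rule ennreal_mult'[OF a(2)])
  also have "\<dots> = (\<integral>\<^sup>+t. ennreal (exp (- p * t)) * nn_int {0<..<min t x} (\<lambda>s. \<beta>1 s * \<alpha>2 (t - s)) * indicator {0<..} t \<partial>lborel)"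
    by (rule nn_int_laplace_convolution) (use meas nonneg in auto)
  also have "\<dots> = ennreal (x powr (- 1 / 2) * B1) * nn_int {0<..<x} (\<lambda>t. exp (- p * t) * F t) +
      ennreal (x powr (- 1 / 2) * B2) * nn_int {x<..} (\<lambda>t. exp (- p * t) * G1 t)"
    by (rule nn_integral_split_at[OF x mF K1a mG(1) K1b]) (use B in auto)
  finally have E1: "ennreal (a2 * b1) = ennreal (x powr (- 1 / 2) * B1) * nn_int {0<..<x} (\<lambda>t. exp (- p * t) * F t) +
      ennreal (x powr (- 1 / 2) * B2) * nn_int {x<..} (\<lambda>t. exp (- p * t) * G1 t)" .
  have "x powr (- 1 / 2) * B1 > 0" "x powr (- 1 / 2) * B2 > 0" "a2 * b1 \<ge> 0" using B x a b by auto
  from ennreal_linear_combination[OF E1 this] obtain \<phi> \<gamma>1 where 1: "\<phi> \<ge> 0" "\<gamma>1 \<ge> 0" "nn_int {0<..<x} (\<lambda>t. exp (- p * t) * F t) = ennreal \<phi>"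
      "nn_int {x<..} (\<lambda>t. exp (- p * t) * G1 t) = ennreal \<gamma>1"
      "a2 * b1 = x powr (- 1 / 2) * B1 * \<phi> + x powr (- 1 / 2) * B2 * \<gamma>1"
    by blast
  have "ennreal (a1 * b2) = nn_int {0<..} (\<lambda>t. \<alpha>1 t * exp (- p * t)) * nn_int {0<..<x} (\<lambda>s. \<beta>2 s * exp (- p * s))"
    unfolding a(3) nb2 by (rule ennreal_mult'[OF a(1)])
  also have "\<dots> = (\<integral>\<^sup>+t. ennreal (exp (- p * t)) * nn_int {0<..<min t x} (\<lambda>s. \<beta>2 s * \<alpha>1 (t - s)) * indicator {0<..} t \<partial>lborel)"
    by (rule nn_int_laplace_convolution) (use meas nonneg in auto)
  also have "\<dots> = ennreal (y powr (- 1 / 2) * B3) * nn_int {0<..<x} (\<lambda>t. exp (- p * t) * F t) +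
      ennreal (x powr (1 / 2) * B4) * nn_int {x<..} (\<lambda>t. exp (- p * t) * G2 t)"
    by (rule nn_integral_split_at[OF x mF K2a mG(2) K2b]) (use B in auto)
  finally have E2: "ennreal (a1 * b2) = ennreal (y powr (- 1 / 2) * B3) * nn_int {0<..<x} (\<lambda>t. exp (- p * t) * F t) +
      ennreal (x powr (1 / 2) * B4) * nn_int {x<..} (\<lambda>t. exp (- p * t) * G2 t)" .
  have "y powr (- 1 / 2) * B3 > 0" "x powr (1 / 2) * B4 > 0" "a1 * b2 \<ge> 0" using B x y a b by auto
  from ennreal_linear_combination[OF E2 this] obtain \<phi>' \<gamma>2 where 2: "\<phi>' \<ge> 0" "\<gamma>2 \<ge> 0" "nn_int {0<..<x} (\<lambda>t. exp (- p * t) * F t) = ennreal \<phi>'"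
      "nn_int {x<..} (\<lambda>t. exp (- p * t) * G2 t) = ennreal \<gamma>2"
      "a1 * b2 = y powr (- 1 / 2) * B3 * \<phi>' + x powr (1 / 2) * B4 * \<gamma>2"
    by blast
  \<comment> \<open>Both pairings involve the same integral over (0, x), so a single number enters
    both equations.\<close>
  have "\<phi>' = \<phi>" using 1(1,3) 2(1,3) by simp
  note 2 = 2[unfolded this]
  define gA gB gC gD gE gF gc gN s where g_defs: "gA = Gamma (- \<mu> / 2)" "gB = Gamma ((1 - \<mu>) / 2)"
    "gC = Gamma (- \<nu> / 2)" "gD = Gamma ((1 - \<nu>) / 2)" "gE = Gamma ((1 + \<nu>) / 2)" "gF = Gamma (1 + \<nu> / 2)"
    "gc = Gamma (1 + (\<nu> - \<mu>) / 2)" "gN = Gamma (- \<nu>)" "s = sqrt pi"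
  have g: "gA > 0" "gB > 0" "gC > 0" "gD > 0" "gE > 0" "gF > 0" "gc > 0" "gN > 0" "s > 0"
    unfolding g_defs using \<mu> \<nu> c0 by (auto intro!: Gamma_real_pos)
  have dup: "gC * gD = 2 powr (1 + \<nu>) * s * gN"
    using Gamma_duplication_real[of "- \<nu>"] \<nu> unfolding g_defs by (simp add: add_divide_distrib diff_divide_distrib)
  have G32: "Gamma (3 / 2 :: real) = s / 2"
  proof -
    have "(1 / 2 :: real) \<notin> \<int>\<^sub>\<le>\<^sub>0" by (auto elim!: nonpos_Ints_cases)
    from Gamma_plus1[OF this] show ?thesis by (simp add: Gamma_one_half_real g_defs)
  qed
  have Bs: "B1 = gE * gB / gc" "B2 = gC * gE / s" "B3 = gA * gF / gc" "B4 = gD * gF / (s / 2)"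
  proof -
    show "B1 = gE * gB / gc" unfolding B1_def Beta_def g_defs by (simp add: add_divide_distrib diff_divide_distrib)
    show "B2 = gC * gE / s" unfolding B2_def Beta_def g_defs
      using Gamma_one_half_real by (simp add: add_divide_distrib)
    have e3: "- \<mu> / 2 + (1 + \<nu> / 2) = 1 + (\<nu> - \<mu>) / 2" by (simp add: diff_divide_distrib)
    show "B3 = gA * gF / gc" unfolding B3_def Beta_def e3 g_defs by (rule refl)
    have e4: "(1 - \<nu>) / 2 + (1 + \<nu> / 2) = 3 / 2" by (simp add: diff_divide_distrib)
    show "B4 = gD * gF / (s / 2)" unfolding B4_def Beta_def e4 G32 unfolding g_defs by (rule refl)
  qed
  have r: "rGamma (1 + (\<nu> - \<mu>) / 2) = 1 / gc" "rGamma (- \<nu>) = 1 / gN" "rGamma ((1 - \<mu>) / 2) = 1 / gB"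
      "rGamma ((1 - \<nu>) / 2) = 1 / gD" "rGamma (- \<mu> / 2) = 1 / gA" "rGamma (- \<nu> / 2) = 1 / gC"
    unfolding g_defs by (simp_all add: rGamma_inverse_Gamma inverse_eq_divide)
  define sx sy sp where sq: "sx = sqrt x" "sy = sqrt y" "sp = sqrt p"
  have sq0: "sx > 0" "sy > 0" "sp > 0" using x y p by (auto simp: sq)
  have pw: "x powr (- 1 / 2) = 1 / sx" "x powr (1 / 2) = sx" "y powr (- 1 / 2) = 1 / sy" "p powr (- 1 / 2) = 1 / sp"
    using x y p by (simp_all add: sq powr_minus_divide powr_half_sqrt)
  define E where "E = exp (- p * x)"
  define Dm where "Dm = D_real \<mu> (sqrt (2 * y * p)) * exp (y * p / 2)"
  have D1: "Dm = 2 powr (\<mu> / 2) * sy / gA * a1" and D2: "Dm = 2 powr (\<mu> / 2) * sp / gB * a2"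
    using a(5,6) unfolding Dm_def sq g_defs by auto
  \<comment> \<open>At a negative argument the minus sign in \<open>D_real\<close> turns into a
    plus, so the even and odd parts add up with positive coefficients.\<close>
  have Dn: "D_real \<nu> (- sqrt (2 * x * p)) = 2 powr (\<nu> / 2) * exp (- (x * p / 2)) * (s * (1 / gD * k1 + 2 * sx * sp * (1 / gC) * k2))"
  proof -
    have "(- sqrt (2 * x * p))\<^sup>2 = 2 * (p * x)" using x p by simp
    moreover have "sqrt (2 * x * p) * sqrt 2 = 2 * sx * sp" by (simp add: sq real_sqrt_mult)
    ultimately show ?thesis unfolding D_real_def r k1_def k2_def by (simp add: g_defs distrib_left mult_ac)
  qed
  have Ek: "E * k1 = b1 * sx / B2" "E * k2 = b2 / (sx * B4)"
    using B sq0 unfolding b1_def b2_def pw E_def by auto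
  have ex: "exp (1 / 2 * p * (y - x)) * exp (- (x * p / 2)) = exp (y * p / 2) * E"
    unfolding E_def exp_add[symmetric] by (rule arg_cong[of _ _ exp]) (simp add: field_simps)
  have "p powr (- 1 / 2) * exp (1 / 2 * p * (y - x)) * D_real \<mu> (sqrt (2 * y * p)) * D_real \<nu> (- sqrt (2 * x * p)) =
      1 / sp * D_real \<mu> (sqrt (2 * y * p)) * 2 powr (\<nu> / 2) * (exp (1 / 2 * p * (y - x)) * exp (- (x * p / 2))) * s * (1 / gD * k1 + 2 * sx * sp * (1 / gC) * k2)"
    unfolding Dn pw by (simp only: mult_ac)
  also have "\<dots> = 1 / sp * 2 powr (\<nu> / 2) * s * ((Dm * E) * (1 / gD * k1 + 2 * sx * sp * (1 / gC) * k2))"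
    unfolding ex Dm_def by (simp only: mult_ac)
  also have "(Dm * E) * (1 / gD * k1 + 2 * sx * sp * (1 / gC) * k2) =
      Dm * (E * k1) / gD + Dm * (2 * sx * sp * (E * k2) / gC)"
    by (simp add: distrib_left mult_ac)
  also have "Dm * (E * k1) / gD = (2 powr (\<mu> / 2) * sp / gB * a2) * (b1 * sx / B2) / gD"
    unfolding Ek by (subst D2) (rule refl)
  also have "Dm * (2 * sx * sp * (E * k2) / gC) = (2 powr (\<mu> / 2) * sy / gA * a1) * (2 * sx * sp * (b2 / (sx * B4)) / gC)"
    unfolding Ek by (subst D1) (rule refl)
  also have "1 / sp * 2 powr (\<nu> / 2) * s * ((2 powr (\<mu> / 2) * sp / gB * a2) * (b1 * sx / B2) / gD +
        (2 powr (\<mu> / 2) * sy / gA * a1) * (2 * sx * sp * (b2 / (sx * B4)) / gC)) =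
      2 powr (\<nu> / 2) * 2 powr (\<mu> / 2) * s * ((a2 * b1) * sx / (B2 * gB * gD) + 2 * ((a1 * b2) * sy) / (B4 * gA * gC))"
    using sq0 by (simp add: field_simps)
  also have "(a2 * b1) * sx = B1 * \<phi> + B2 * \<gamma>1"
    unfolding 1(5) pw using sq0 by (simp add: field_simps)
  also have "(a1 * b2) * sy = B3 * \<phi> + sx * sy * B4 * \<gamma>2"
    unfolding 2(5) pw using sq0 by (simp add: field_simps)
  also have "2 powr (\<nu> / 2) * 2 powr (\<mu> / 2) = 2 powr ((\<mu> + \<nu>) / 2)"
    by (simp add: powr_add[symmetric] add_divide_distrib add.commute)
  also have "(B1 * \<phi> + B2 * \<gamma>1) / (B2 * gB * gD) = s / (gc * gC * gD) * \<phi> + 1 / gB * (1 / gD) * \<gamma>1"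
    unfolding Bs using g by (simp add: field_simps)
  also have "2 * (B3 * \<phi> + sx * sy * B4 * \<gamma>2) / (B4 * gA * gC) = s / (gc * gC * gD) * \<phi> + 2 * sx * sy * (1 / gA) * (1 / gC) * \<gamma>2"
    unfolding Bs using g by (simp add: field_simps)
  \<comment> \<open>Both pairings produced this same coefficient of \<phi>. Duplication rewrites it
    with 1 / Gamma(-\<nu>), and its factor 1/2 disappears when the two are added.\<close>
  also have "s / (gc * gC * gD) = 1 / (2 * 2 powr \<nu> * gc * gN)"
  proof -
    have "s / (gc * gC * gD) = s / (gc * (2 powr (1 + \<nu>) * s * gN))"
      unfolding dup[symmetric] by (simp add: mult.assoc)
    also have "\<dots> = 1 / (2 * 2 powr \<nu> * gc * gN)" using g(9) by (simp add: powr_add mult_ac)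
    finally show ?thesis .
  qed
  also have "2 powr ((\<mu> + \<nu>) / 2) * s * (1 / (2 * 2 powr \<nu> * gc * gN) * \<phi> + 1 / gB * (1 / gD) * \<gamma>1 +
        (1 / (2 * 2 powr \<nu> * gc * gN) * \<phi> + 2 * sx * sy * (1 / gA) * (1 / gC) * \<gamma>2)) =
      (2 powr ((\<mu> + \<nu>) / 2) / 2 powr \<nu>) * s * (1 / gc) * (1 / gN) * \<phi> +
      2 powr ((\<mu> + \<nu>) / 2) * s * (1 / gB * (1 / gD) * \<gamma>1 + 2 * sx * sy * (1 / gA) * (1 / gC) * \<gamma>2)"
    by (simp add: field_simps)
  also have "2 powr ((\<mu> + \<nu>) / 2) / 2 powr \<nu> = 2 powr ((\<mu> - \<nu>) / 2)"
    by (simp add: powr_diff[symmetric] field_simps)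
  finally show ?thesis
    using 1 2 unfolding r[symmetric] sq g_defs(9) by blast
qed

section \<open>Domination of the integrands\<close>

text \<open>Replaces an exponent that varies with the parameters by a fixed smaller one, at the
  price of a constant: near 0 the smaller exponent dominates, and up to X the quotient is
  bounded.\<close>

lemma powr_le_powr_mult:
  fixes t X :: real
  assumes "0 < t" "t \<le> X" "1 \<le> X" "r0 \<le> r" "r - r0 \<le> K"
  shows "t powr r \<le> t powr r0 * X powr K"
proof -
  have "t powr r = t powr r0 * t powr (r - r0)" by (simp add: powr_add[symmetric])
  also have "t powr (r - r0) \<le> X powr (r - r0)" using assms by (intro powr_mono2) auto
  also have "X powr (r - r0) \<le> X powr K" using assms by (intro powr_mono) auto
  finally show ?thesis by (simp add: mult_left_mono)
qed

lemma powr_le_of_abs_le: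
  fixes s X :: real
  assumes X: "1 \<le> X" and s: "1 / X \<le> s" "s \<le> X" and r: "\<bar>r\<bar> \<le> K"
  shows "s powr r \<le> X powr K"
proof -
  have s0: "s > 0" using s X by (meson less_le_trans zero_less_divide_1_iff zero_less_one)
  have "s powr r \<le> X powr \<bar>r\<bar>"
  proof (cases "r \<ge> 0")
    case True
    then show ?thesis using s s0 by (auto intro!: powr_mono2)
  next
    case False
    have "s powr r = (1 / s) powr (- r)" using s0 by (simp add: powr_divide powr_minus_divide)
    also have "\<dots> \<le> X powr (- r)"
      using False s s0 X by (intro powr_mono2) (auto simp: field_simps)
    finally show ?thesis using False by simp
  qed
  also have "\<dots> \<le> X powr K" using X r by (intro powr_mono) auto
  finally show ?thesis .
qed

definition fker :: "real \<Rightarrow> real \<Rightarrow> complex \<Rightarrow> complex \<Rightarrow> complex \<Rightarrow> real \<Rightarrow> complex" where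
  "fker x y \<mu> \<nu> p t =
     exp (- p * of_real t) * of_real t powr ((\<nu> - \<mu>) / 2) *
     of_real (x - t) powr (- (1 + \<nu>) / 2) * of_real (y + t) powr (\<mu> / 2) *
     hyp2f1 (- \<mu> / 2) ((1 + \<nu>) / 2) (1 + (\<nu> - \<mu>) / 2)
       (of_real (t * (x - y - t) / ((x - t) * (y + t))))"

definition gker :: "real \<Rightarrow> real \<Rightarrow> complex \<Rightarrow> complex \<Rightarrow> complex \<Rightarrow> real \<Rightarrow> complex" where
  "gker x y \<mu> \<nu> p t =
     exp (- p * of_real t) * of_real t powr ((\<nu> - 1) / 2) *
     of_real (t - x) powr (- (1 + \<mu> + \<nu>) / 2) * of_real (y - x + t) powr ((\<mu> - 1) / 2) *
     (rGamma (- \<mu> / 2) * rGamma (- \<nu> / 2) *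
        hyp2f1 ((1 - \<mu>) / 2) ((1 - \<nu>) / 2) (3 / 2) (of_real (x * y / (t * (y - x + t)))) +
      rGamma ((1 - \<mu>) / 2) * rGamma ((1 - \<nu>) / 2) *
        of_real (t * (y - x + t) / (4 * x * y)) powr (1 / 2) *
        hyp2f1 (- \<mu> / 2) (- \<nu> / 2) (1 / 2) (of_real (x * y / (t * (y - x + t)))))"

definition admissible :: "complex \<Rightarrow> complex \<Rightarrow> complex \<Rightarrow> bool" where
  "admissible \<mu> \<nu> p \<longleftrightarrow> Re \<nu> < 1 \<and> Re \<mu> < 1 - Re \<nu> \<and> Re \<mu> < 2 + Re \<nu> \<and> Re p > 0"

lemma admissible_cRe: "admissible \<mu> \<nu> p \<Longrightarrow> Re (1 + (\<nu> - \<mu>) / 2) > 0"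
  by (auto simp: admissible_def field_simps)

lemma fker_measurable:
  assumes "x > 0" "y > 0" "admissible \<mu> \<nu> p"
  shows "set_borel_measurable lborel {0<..<x} (fker x y \<mu> \<nu> p)"
proof -
  have "continuous_on {0<..<x} (\<lambda>t. t * (x - y - t) / ((x - t) * (y + t)))"
    using assms by (intro continuous_intros) auto
  then have "continuous_on {0<..<x} (\<lambda>t. hyp2f1 (- \<mu> / 2) ((1 + \<nu>) / 2) (1 + (\<nu> - \<mu>) / 2)
      (of_real (t * (x - y - t) / ((x - t) * (y + t)))))"
    by (rule continuous_on_hyp2f1[OF admissible_cRe[OF assms(3)]])
      (use cross_ratio_less_1(1)[OF assms(1,2)] in auto)
  then show ?thesis unfolding fker_def using assms
    by (intro set_borel_measurable_lborel open_greaterThanLessThan continuous_on_mult continuous_on_of_real_powr continuous_intros) auto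
qed

lemma gker_measurable:
  assumes "x > 0" "y > 0"
  shows "set_borel_measurable lborel {x<..} (gker x y \<mu> \<nu> p)"
proof -
  have pos: "t * (y - x + t) > 0" if "t \<in> {x<..}" for t using that assms by (intro mult_pos_pos) auto
  have "continuous_on {x<..} (\<lambda>t. x * y / (t * (y - x + t)))"
    using pos by (intro continuous_intros) (auto simp: less_le)
  then have h: "continuous_on {x<..} (\<lambda>t. hyp2f1 a b c (of_real (x * y / (t * (y - x + t)))))" if "Re c > 0" for a b c
    by (rule continuous_on_hyp2f1[OF that]) (use cross_ratio_less_1(2)[OF assms] in auto)
  have "continuous_on {x<..} (\<lambda>t. t * (y - x + t) / (4 * x * y))"
    using assms by (intro continuous_intros) auto
  then have "continuous_on {x<..} (\<lambda>t. complex_of_real (t * (y - x + t) / (4 * x * y)) powr (1 / 2))"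
    by (rule continuous_on_of_real_powr) (use assms pos in auto)
  then show ?thesis unfolding gker_def using assms
    by (intro set_borel_measurable_lborel open_greaterThan continuous_on_mult continuous_on_add h
        continuous_on_of_real_powr continuous_intros) auto
qed

text \<open>The argument z of the Gauss function satisfies 1 - z = x y / ((x - t) (y + t)), so a
  bound by a power of 1 - z only shifts the exponent of x - t. The last two conditions on \<sigma>
  say that it exceeds the growth exponent of the Pfaff series and that the shifted exponent stays
  above -1.\<close>

lemma fker_norm_bound:
  fixes A e \<eta> \<sigma> :: real
  assumes x: "x > 0" and y: "y > 0" and A: "A \<ge> 1" and e: "0 < e" and \<eta>: "0 < \<eta>" and \<sigma>: "\<sigma> > 0"
  shows "\<exists>C. \<forall>\<mu> \<nu> p t. norm \<mu> \<le> A \<longrightarrow> norm \<nu> \<le> A \<longrightarrow> Re p \<ge> 0 \<longrightarrow> e \<le> 1 + (Re \<nu> - Re \<mu>) / 2 \<longrightarrow>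
    Re \<nu> \<le> 1 - 2 * \<eta> \<longrightarrow> - (1 + Re \<mu> + Re \<nu>) / 2 \<le> \<sigma> - \<eta> \<longrightarrow> - (1 + Re \<mu> + Re \<nu>) / 2 - \<sigma> \<ge> \<eta> - 1 \<longrightarrow>
    t \<in> {0<..<x} \<longrightarrow> norm (fker x y \<mu> \<nu> p t) \<le> C * (t powr (e - 1) * (x - t) powr (\<eta> - 1))"
proof -
  \<comment> \<open>\<open>L\<close> dominates x, y, x + y and the reciprocals of x and y, and
    \<open>K\<close> below dominates all exponents and exponent differences that occur; each
    harmless factor is then at most \<open>L powr K\<close>.\<close>
  define L where "L = 1 + x + y + 1 / x + 1 / y"
  have L: "1 \<le> L" "x \<le> L" "y \<le> L" "x + y \<le> L" "1 / L \<le> x" "1 / L \<le> y"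
  proof -
    show "1 \<le> L" "x \<le> L" "y \<le> L" "x + y \<le> L" using x y by (auto simp: L_def)
    have "1 / x \<le> L" "1 / y \<le> L" using x y by (auto simp: L_def)
    then show "1 / L \<le> x" "1 / L \<le> y" using x y \<open>1 \<le> L\<close> by (auto simp: field_simps)
  qed
  define \<sigma>2 where "\<sigma>2 = 2 * A + 1"
  have \<sigma>2: "\<sigma>2 > 0" using A by (simp add: \<sigma>2_def)
  define K where "K = 3 * A + \<sigma> + \<sigma>2 + e + \<eta> + 3"
  obtain C1 where C1: "C1 \<ge> 0" "\<And>a b c z. \<lbrakk>norm a \<le> A; norm b \<le> A; e \<le> Re c; Re a + Re b - Re c \<le> \<sigma> - \<eta>; norm z < 1\<rbrakk> \<Longrightarrow>
       norm (gauss_series a b c z) \<le> C1 * (1 - norm z) powr (- \<sigma>)"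
    using gauss_series_bound[OF e \<sigma> \<eta>, of A] by blast
  obtain C2 where C2: "C2 \<ge> 0" "\<And>a b c z. \<lbrakk>norm a \<le> A; norm b \<le> A; e \<le> Re c; Re a + Re b - Re c \<le> \<sigma>2 - 1; norm z < 1\<rbrakk> \<Longrightarrow>
       norm (gauss_series a b c z) \<le> C2 * (1 - norm z) powr (- \<sigma>2)"
    using gauss_series_bound[OF e \<sigma>2 zero_less_one, of A] by blast
  define C where "C = (C1 + C2) * (L powr K * L powr K * L powr K * L powr K * L powr K)"
  show ?thesis
  proof (intro exI[of _ C] allI impI)
    fix \<mu> \<nu> p :: complex and t :: real
    assume n: "norm \<mu> \<le> A" "norm \<nu> \<le> A" and p: "Re p \<ge> 0" and ce: "e \<le> 1 + (Re \<nu> - Re \<mu>) / 2"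
      and \<nu>: "Re \<nu> \<le> 1 - 2 * \<eta>" and s1: "- (1 + Re \<mu> + Re \<nu>) / 2 \<le> \<sigma> - \<eta>"
      and s2: "- (1 + Re \<mu> + Re \<nu>) / 2 - \<sigma> \<ge> \<eta> - 1" and t: "t \<in> {0<..<x}"
    have t0: "0 < t" "t < x" "0 < x - t" "0 < y + t" using t y by auto
    define z where "z = t * (x - y - t) / ((x - t) * (y + t))"
    define a b c where abc: "a = - \<mu> / 2" "b = (1 + \<nu>) / 2" "c = 1 + (\<nu> - \<mu>) / 2"
    define r1 r2 r3 where r: "r1 = (Re \<nu> - Re \<mu>) / 2" "r2 = - (1 + Re \<nu>) / 2" "r3 = Re \<mu> / 2"
    have cRe: "Re c > 0" "e \<le> Re c" using ce e by (auto simp: abc)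
    have re: "\<bar>Re \<mu>\<bar> \<le> A" "\<bar>Re \<nu>\<bar> \<le> A" using n abs_Re_le_cmod order_trans by blast+
    have ce2: "2 * e - 2 \<le> Re \<nu> - Re \<mu>" using ce by (simp add: field_simps)
    have na: "norm a \<le> A" "norm b \<le> A" "norm (c - b) \<le> A"
    proof -
      show "norm a \<le> A" using n A by (simp add: abc norm_divide)
      show "norm b \<le> A" using norm_triangle_ineq[of 1 \<nu>] n A by (simp add: abc norm_divide)
      have "c - b = (1 - \<mu>) / 2" by (simp add: abc field_simps)
      then have "norm (c - b) = norm (1 - \<mu>) / 2" by (simp only: norm_divide norm_numeral)
      then show "norm (c - b) \<le> A" using norm_triangle_ineq4[of 1 \<mu>] n(1) A norm_one[where 'a = complex] by linarith
    qed
    have z1: "1 - z = x * y / ((x - t) * (y + t))"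
    proof -
      have "(x - t) * (y + t) - t * (x - y - t) = x * y" by (simp add: algebra_simps)
      then show ?thesis unfolding z_def using t0 by (simp add: diff_divide_eq_iff divide_diff_eq_iff)
    qed
    have z1p: "1 - z > 0" unfolding z1 using t0 x y by simp
    have zp: "(1 - z) powr s = x powr s * y powr s * (x - t) powr (- s) * (y + t) powr (- s)" for s
      unfolding z1 using t0 x y by (simp add: powr_divide powr_mult powr_minus_divide)
    have nf: "norm (fker x y \<mu> \<nu> p t) = exp (- Re p * t) * (t powr r1 * (x - t) powr r2 * (y + t) powr r3 * norm (hyp2f1 a b c (of_real z)))"
    proof -
      have "norm (complex_of_real t powr ((\<nu> - \<mu>) / 2)) = t powr r1"
        using t0 by (simp add: norm_of_real_powr r)
      moreover have "norm (complex_of_real (x - t) powr (- (1 + \<nu>) / 2)) = (x - t) powr r2"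
        using norm_of_real_powr[OF t0(3)] by (simp add: r)
      moreover have "norm (complex_of_real (y + t) powr (\<mu> / 2)) = (y + t) powr r3"
        using norm_of_real_powr[OF t0(4)] by (simp add: r)
      ultimately show ?thesis
        unfolding fker_def abc[symmetric] z_def[symmetric] norm_mult by (simp add: mult.assoc)
    qed
    \<comment> \<open>Common conclusion of both cases: a bound by (1 - z)^s changes the exponent of
      x - t from r2 to r2 - s. It is applied with s = -\<sigma>2 and with s = r3 + \<sigma>.\<close>
    have shape: "norm (fker x y \<mu> \<nu> p t) \<le> C * (t powr (e - 1) * (x - t) powr (\<eta> - 1))"
      if bound: "norm (hyp2f1 a b c (of_real z)) \<le> D * (x powr s * y powr s * (x - t) powr (- s) * (y + t) powr (- s))"
        and D: "0 \<le> D" "D \<le> C1 + C2" and s: "\<bar>s\<bar> \<le> A + \<sigma> + \<sigma>2" "r2 - s \<ge> \<eta> - 1" for D s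
    proof -
      have "norm (fker x y \<mu> \<nu> p t) \<le> 1 * (t powr r1 * (x - t) powr r2 * (y + t) powr r3 *
          (D * (x powr s * y powr s * (x - t) powr (- s) * (y + t) powr (- s))))"
        unfolding nf using p t0 bound by (intro mult_mono) auto
      also have "\<dots> = D * (t powr r1 * (x - t) powr (r2 - s) * (y + t) powr (r3 - s) * x powr s * y powr s)"
        by (simp add: powr_diff powr_minus_divide)
      also have "\<dots> \<le> (C1 + C2) * ((t powr (e - 1) * L powr K) * ((x - t) powr (\<eta> - 1) * L powr K) * L powr K * L powr K * L powr K)"
      proof (intro mult_mono D)
        show "t powr r1 \<le> t powr (e - 1) * L powr K"
          using t0 L ce2 re A \<sigma> \<sigma>2 \<eta> e by (intro powr_le_powr_mult) (auto simp: r K_def abs_le_iff field_simps)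
        show "(x - t) powr (r2 - s) \<le> (x - t) powr (\<eta> - 1) * L powr K"
          using t0 L s re A \<sigma> \<sigma>2 \<eta> e by (intro powr_le_powr_mult) (auto simp: r K_def abs_le_iff field_simps)
        show "(y + t) powr (r3 - s) \<le> L powr K"
        proof (rule powr_le_of_abs_le[OF L(1)])
          show "1 / L \<le> y + t" "y + t \<le> L" using L t0 by linarith+
          show "\<bar>r3 - s\<bar> \<le> K" using s re A \<sigma> \<sigma>2 \<eta> e by (simp add: r K_def abs_le_iff field_simps)
        qed
        show "x powr s \<le> L powr K" "y powr s \<le> L powr K"
          using L s re A \<sigma> \<sigma>2 \<eta> e by (intro powr_le_of_abs_le; simp add: K_def)+
      qed (use C1 C2 in auto)
      also have "\<dots> = C * (t powr (e - 1) * (x - t) powr (\<eta> - 1))"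
        by (simp add: C_def mult_ac)
      finally show ?thesis .
    qed
    show "norm (fker x y \<mu> \<nu> p t) \<le> C * (t powr (e - 1) * (x - t) powr (\<eta> - 1))"
    \<comment> \<open>As t -> x the argument z tends to -infinity and w = z / (z - 1) to 1, where
      the Pfaff series grows with exponent -(1 + Re \<mu> + Re \<nu>) / 2; this case decides the
      condition on \<sigma>. For z >= 0 the crude exponent \<sigma>2 is affordable, as (1 -
      z)^(-\<sigma>2) raises the exponent of x - t.\<close>
    proof (cases "z \<ge> 0")
      case True
      then have nz: "norm (complex_of_real z) < 1" "norm (complex_of_real z) = z" using z1p by auto
      have "Re a + Re b - Re c \<le> \<sigma>2 - 1" using re A cRe(1) by (auto simp: abc \<sigma>2_def abs_le_iff field_simps)
      from C2(2)[OF na(1,2) cRe(2) this nz(1)]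
      have "norm (hyp2f1 a b c (of_real z)) \<le> C2 * (1 - z) powr (- \<sigma>2)"
        using hyp2f1_eq_gauss_series[OF cRe(1) nz(1)] nz(2) by simp
      then show ?thesis unfolding zp
        by (rule shape) (use C1 C2 A \<sigma> \<sigma>2 \<nu> in \<open>auto simp: r field_simps\<close>)
    next
      case False
      define w where "w = z / (z - 1)"
      have w: "0 \<le> w" "w < 1" "1 - w = 1 / (1 - z)"
        using False by (auto simp: w_def divide_simps)
      have nw: "norm (complex_of_real w) < 1" "norm (complex_of_real w) = w" using w by auto
      have "Re a + Re (c - b) - Re c \<le> \<sigma> - \<eta>" using s1 by (simp add: abc field_simps)
      from C1(2)[OF na(1,3) cRe(2) this nw(1)]
      have gs: "norm (gauss_series a (c - b) c (of_real w)) \<le> C1 * (1 - w) powr (- \<sigma>)" using nw(2) by simp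
      have "norm (hyp2f1 a b c (of_real z)) = (1 - z) powr r3 * norm (gauss_series a (c - b) c (of_real w))"
        using hyp2f1_Pfaff[OF cRe(1), of z a b] False norm_of_real_powr[OF z1p, of "- a"]
        unfolding w_def[symmetric] by (simp add: norm_mult abc r)
      also have "\<dots> \<le> (1 - z) powr r3 * (C1 * (1 - w) powr (- \<sigma>))"
        by (intro mult_left_mono gs) simp
      also have "(1 - w) powr (- \<sigma>) = (1 - z) powr \<sigma>"
        unfolding w(3) using z1p by (simp add: powr_divide powr_minus_divide)
      also have "(1 - z) powr r3 * (C1 * (1 - z) powr \<sigma>) = C1 * (1 - z) powr (r3 + \<sigma>)"
        by (simp add: powr_add)
      finally show ?thesis unfolding zp
        by (rule shape) (use C1 C2 A \<sigma> \<sigma>2 s2 re in \<open>auto simp: r field_simps abs_le_iff\<close>)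
    qed
  qed
qed

lemma power_div_fact_le_exp:
  fixes s :: real
  assumes "s \<ge> 0" shows "s ^ N / fact N \<le> exp s"
proof -
  have e: "(\<lambda>n. s ^ n / fact n) sums exp s"
    using exp_converges[of s] by (simp add: divide_inverse mult.commute)
  have "(\<Sum>n\<in>{N}. s ^ n / fact n) \<le> (\<Sum>n. s ^ n / fact n)"
    by (rule sum_le_suminf[OF sums_summable[OF e]]) (use assms in auto)
  then show ?thesis using sums_unique[OF e] by simp
qed

lemma set_integrable_shifted_Gamma:
  fixes x c \<eta> :: real
  assumes "\<eta> > 0" "c > 0"
  shows "set_integrable lborel {x<..} (\<lambda>t. (t - x) powr (\<eta> - 1) * exp (- c * (t - x)))"
proof -
  have "nn_int {x<..} (\<lambda>t. (t - x) powr (\<eta> - 1) * exp (- c * (t - x))) =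
      nn_int {0<..} (\<lambda>s. c powr (- \<eta>) * (s powr (\<eta> - 1) * exp (- s)))"
  proof (rule nn_int_change_of_variables[where g = "\<lambda>s. x + s / c" and h = "\<lambda>t. c * (t - x)" and g' = "\<lambda>s. 1 / c"])
    fix s :: real assume s: "s \<in> {0<..}"
    have "c powr (- \<eta>) = 1 / c * (1 / c) powr (\<eta> - 1)"
      using assms by (simp add: powr_divide powr_diff powr_minus_divide)
    then show "c powr (- \<eta>) * (s powr (\<eta> - 1) * exp (- s)) =
        \<bar>1 / c\<bar> * ((x + s / c - x) powr (\<eta> - 1) * exp (- c * (x + s / c - x)))"
      using assms s by (simp add: powr_divide)
  qed (use assms in \<open>auto intro!: continuous_intros derivative_eq_intros\<close>)
  also have "\<dots> = ennreal (c powr (- \<eta>)) * ennreal (Gamma \<eta>)"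
    unfolding nn_int_Gamma[OF assms(1), symmetric] by (rule nn_int_cmult) auto
  also have "\<dots> = ennreal (c powr (- \<eta>) * Gamma \<eta>)" by (rule ennreal_mult'[symmetric]) simp
  finally have "nn_int {x<..} (\<lambda>t. (t - x) powr (\<eta> - 1) * exp (- c * (t - x))) = ennreal (c powr (- \<eta>) * Gamma \<eta>)" .
  moreover have "c powr (- \<eta>) * Gamma \<eta> \<ge> 0" using assms by (simp add: Gamma_real_pos less_imp_le)
  ultimately show ?thesis
    by (subst (asm) nn_int_eq_ennreal_iff) (auto simp: set_borel_measurable_def)
qed

text \<open>Here 0 < z < 1, so the Gauss series applies directly, and both Gauss functions have the
  same growth exponent -(1 + Re \<mu> + Re \<nu>) / 2. All factors other than the power of t - x
  grow at most polynomially, and half of the exponential decay absorbs them.\<close>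

lemma gker_norm_bound:
  fixes A \<eta> \<sigma> \<epsilon> R :: real
  assumes x: "x > 0" and y: "y > 0" and A: "A \<ge> 1" and \<eta>: "0 < \<eta>" and \<sigma>: "\<sigma> > 0" and \<epsilon>: "\<epsilon> > 0" and R: "R \<ge> 0"
  shows "\<exists>C. \<forall>\<mu> \<nu> p t. norm \<mu> \<le> A \<longrightarrow> norm \<nu> \<le> A \<longrightarrow> Re p \<ge> 2 * \<epsilon> \<longrightarrow>
    norm (rGamma (- \<mu> / 2) * rGamma (- \<nu> / 2)) \<le> R \<longrightarrow> norm (rGamma ((1 - \<mu>) / 2) * rGamma ((1 - \<nu>) / 2)) \<le> R \<longrightarrow>
    - (1 + Re \<mu> + Re \<nu>) / 2 \<le> \<sigma> - \<eta> \<longrightarrow> - (1 + Re \<mu> + Re \<nu>) / 2 - \<sigma> \<ge> \<eta> - 1 \<longrightarrow>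
    t \<in> {x<..} \<longrightarrow> norm (gker x y \<mu> \<nu> p t) \<le> C * ((t - x) powr (\<eta> - 1) * exp (- \<epsilon> * (t - x)))"
proof -
  define L where "L = 1 + x + y + 1 / x + 1 / y"
  have L: "1 \<le> L" "x \<le> L" "y \<le> L" "x + y \<le> L" "1 / L \<le> x" "1 / L \<le> y"
  proof -
    show "1 \<le> L" "x \<le> L" "y \<le> L" "x + y \<le> L" using x y by (auto simp: L_def)
    have "1 / x \<le> L" "1 / y \<le> L" using x y by (auto simp: L_def)
    then show "1 / L \<le> x" "1 / L \<le> y" using x y \<open>1 \<le> L\<close> by (auto simp: field_simps)
  qed
  obtain K :: nat where K: "3 * A + \<sigma> + \<eta> + 5 \<le> real K" using real_arch_simple by blast
  have half: "(0::real) < 1 / 2" by simp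
  obtain C1 where C1: "C1 \<ge> 0" "\<And>a b c z. \<lbrakk>norm a \<le> A; norm b \<le> A; 1 / 2 \<le> Re c; Re a + Re b - Re c \<le> \<sigma> - \<eta>; norm z < 1\<rbrakk> \<Longrightarrow>
       norm (gauss_series a b c z) \<le> C1 * (1 - norm z) powr (- \<sigma>)"
    using gauss_series_bound[OF half \<sigma> \<eta>, of A] by blast
  define q where "q = 1 / (4 * x * y)"
  have q: "q > 0" using x y by (simp add: q_def)
  define B where "B = R * C1 * (1 + q powr (1 / 2))"
  have B: "B \<ge> 0" using R C1 q by (simp add: B_def)
  \<comment> \<open>The constant in (1 + u)^(6K) <= E exp (\<epsilon> u), from s^N / N! <= exp s at
    s = \<epsilon> (1 + u). The power 6K counts five factors \<open>X powr K\<close>, with X = L (1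
    + u), and one factor (1 + u)^K.\<close>
  define E where "E = fact (6 * K) * (1 / \<epsilon>) ^ (6 * K) * exp \<epsilon>"
  define C where "C = B * (L ^ (5 * K) * E)"
  show ?thesis
  proof (intro exI[of _ C] allI impI)
    fix \<mu> \<nu> p :: complex and t :: real
    assume n: "norm \<mu> \<le> A" "norm \<nu> \<le> A" and p: "Re p \<ge> 2 * \<epsilon>"
      and rG: "norm (rGamma (- \<mu> / 2) * rGamma (- \<nu> / 2)) \<le> R" "norm (rGamma ((1 - \<mu>) / 2) * rGamma ((1 - \<nu>) / 2)) \<le> R"
      and s1: "- (1 + Re \<mu> + Re \<nu>) / 2 \<le> \<sigma> - \<eta>" and s2: "- (1 + Re \<mu> + Re \<nu>) / 2 - \<sigma> \<ge> \<eta> - 1"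
      and t: "t \<in> {x<..}"
    define u where "u = t - x"
    define v where "v = y - x + t"
    have u: "u > 0" and t0: "t > 0" "v > 0" "t + y > 0" using t x y by (auto simp: u_def v_def)
    have re: "\<bar>Re \<mu>\<bar> \<le> A" "\<bar>Re \<nu>\<bar> \<le> A" using n abs_Re_le_cmod order_trans by blast+
    define z where "z = x * y / (t * v)"
    have z1: "1 - z = u * (t + y) / (t * v)"
    proof -
      have "t * v - x * y = u * (t + y)" by (simp add: u_def v_def algebra_simps)
      then show ?thesis unfolding z_def using t0 by (simp add: diff_divide_eq_iff divide_diff_eq_iff)
    qed
    have z1p: "1 - z > 0" unfolding z1 using u t0 by simp
    have "z > 0" unfolding z_def using x y t0 by simp
    then have nz: "norm (complex_of_real z) < 1" "norm (complex_of_real z) = z" using z1p by auto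
    define W where "W = (1 - z) powr (- \<sigma>)"
    have na: "norm ((1 - \<mu>) / 2) \<le> A" "norm ((1 - \<nu>) / 2) \<le> A" "norm (- \<mu> / 2) \<le> A" "norm (- \<nu> / 2) \<le> A"
      using norm_triangle_ineq4[of 1 \<mu>] norm_triangle_ineq4[of 1 \<nu>] n A by (auto simp: norm_divide)
    have h1: "norm (hyp2f1 ((1 - \<mu>) / 2) ((1 - \<nu>) / 2) (3 / 2) (of_real z)) \<le> C1 * W"
    proof -
      have "Re ((1 - \<mu>) / 2) + Re ((1 - \<nu>) / 2) - Re (3 / 2) \<le> \<sigma> - \<eta>" using s1 by (simp add: field_simps)
      then show ?thesis
        using C1(2)[OF na(1,2) _ _ nz(1), of "3 / 2"] hyp2f1_eq_gauss_series[of "3 / 2" "of_real z"] nz by (simp add: W_def)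
    qed
    have h2: "norm (hyp2f1 (- \<mu> / 2) (- \<nu> / 2) (1 / 2) (of_real z)) \<le> C1 * W"
    proof -
      have "Re (- \<mu> / 2) + Re (- \<nu> / 2) - Re (1 / 2) \<le> \<sigma> - \<eta>" using s1 by (simp add: field_simps)
      then show ?thesis
        using C1(2)[OF na(3,4) _ _ nz(1), of "1 / 2"] hyp2f1_eq_gauss_series[of "1 / 2" "of_real z"] nz by (simp add: W_def)
    qed
    \<comment> \<open>\<open>X\<close> dominates u, t, v, t + y and also the reciprocals of t, v and
      t + y. Only u may approach 0, so its power is treated separately.\<close>
    define X where "X = L * (1 + u)"
    have X1: "1 * 1 \<le> L * (1 + u)" using L u by (intro mult_mono) auto
    have XL: "L \<le> X" using L u by (simp add: X_def)
    have X: "1 \<le> X" using X1 by (simp add: X_def)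
    have XI: "1 / X \<le> s" if "x \<le> s \<or> y \<le> s" for s
    proof -
      have "1 / X \<le> 1 / L" using XL L by (intro divide_left_mono) auto
      then show ?thesis using that L by linarith
    qed
    have uX: "u \<le> X" and tX: "t \<le> X" "v \<le> X" "t + y \<le> X"
    proof -
      have "1 * u \<le> L * u" using L u by (intro mult_right_mono) auto
      then have "u + L \<le> X" by (simp add: X_def algebra_simps)
      moreover have "t = u + x" "v = u + y" "t + y = u + (x + y)" by (auto simp: u_def v_def)
      ultimately show "u \<le> X" "t \<le> X" "v \<le> X" "t + y \<le> X" using L by linarith+
    qed
    have low: "1 / X \<le> t" "1 / X \<le> v" "1 / X \<le> t + y"
      by (intro XI; use u x y in \<open>auto simp: u_def v_def\<close>)+
    have Kr: "X powr r \<le> X powr real K" if "r \<le> real K" for r using X that by (intro powr_mono) auto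
    have pXK: "s powr r \<le> X powr real K" if "1 / X \<le> s" "s \<le> X" "\<bar>r\<bar> \<le> real K" for s r
      by (rule powr_le_of_abs_le[OF X that])
    define r1 r2 r3 where r: "r1 = (Re \<nu> - 1) / 2" "r2 = - (1 + Re \<mu> + Re \<nu>) / 2" "r3 = (Re \<mu> - 1) / 2"
    have tv: "(t * v / (4 * x * y)) powr (1 / 2) = q powr (1 / 2) * (t powr (1 / 2) * v powr (1 / 2))"
    proof -
      have "t * v / (4 * x * y) = q * (t * v)" by (simp add: q_def)
      then show ?thesis using q t0 by (simp add: powr_mult)
    qed
    have inner: "norm (rGamma (- \<mu> / 2) * rGamma (- \<nu> / 2) *
        hyp2f1 ((1 - \<mu>) / 2) ((1 - \<nu>) / 2) (3 / 2) (of_real z) +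
      rGamma ((1 - \<mu>) / 2) * rGamma ((1 - \<nu>) / 2) *
        of_real (t * v / (4 * x * y)) powr (1 / 2) *
        hyp2f1 (- \<mu> / 2) (- \<nu> / 2) (1 / 2) (of_real z)) \<le> B * (X powr real K * X powr real K) * W"
    proof -
      have W0: "W \<ge> 0" by (simp add: W_def)
      have one: "1 \<le> X powr real K" using X by (intro ge_one_powr_ge_zero) auto
      have "1 * 1 \<le> X powr real K * X powr real K" using one by (intro mult_mono) auto
      then have 1: "norm (rGamma (- \<mu> / 2) * rGamma (- \<nu> / 2) * hyp2f1 ((1 - \<mu>) / 2) ((1 - \<nu>) / 2) (3 / 2) (of_real z))
          \<le> R * (C1 * W) * (X powr real K * X powr real K)"
        unfolding norm_mult[of _ "hyp2f1 _ _ _ _"]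
        using mult_mono[OF rG(1) h1] R C1 W0 mult_left_mono[of 1 "X powr real K * X powr real K" "R * (C1 * W)"] by auto
      have tv2: "t powr (1 / 2) \<le> X powr real K" "v powr (1 / 2) \<le> X powr real K"
        using K A \<sigma> \<eta> by (intro pXK low tX; simp)+
      have "norm (complex_of_real (t * v / (4 * x * y)) powr (1 / 2)) = q powr (1 / 2) * (t powr (1 / 2) * v powr (1 / 2))"
        unfolding tv[symmetric] using t0 x y by (subst norm_of_real_powr) auto
      also have "\<dots> \<le> q powr (1 / 2) * (X powr real K * X powr real K)"
        using tv2 by (intro mult_left_mono mult_mono) auto
      finally have 2: "norm (rGamma ((1 - \<mu>) / 2) * rGamma ((1 - \<nu>) / 2) *
          of_real (t * v / (4 * x * y)) powr (1 / 2) * hyp2f1 (- \<mu> / 2) (- \<nu> / 2) (1 / 2) (of_real z))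
          \<le> R * (q powr (1 / 2) * (X powr real K * X powr real K)) * (C1 * W)"
        unfolding norm_mult[of _ "hyp2f1 _ _ _ _"] norm_mult[of _ "of_real _ powr _"]
        using rG(2) h2 R C1 by (intro mult_mono) auto
      have "R * (C1 * W) * (X powr real K * X powr real K) + R * (q powr (1 / 2) * (X powr real K * X powr real K)) * (C1 * W) =
          B * (X powr real K * X powr real K) * W"
        by (simp add: B_def algebra_simps)
      with norm_triangle_mono[OF 1 2] show ?thesis by (simp only:)
    qed
    have Wp: "W = u powr (- \<sigma>) * (t + y) powr (- \<sigma>) * t powr \<sigma> * v powr \<sigma>"
      unfolding W_def z1 using u t0 by (simp add: powr_divide powr_mult powr_minus_divide)
    have "norm (gker x y \<mu> \<nu> p t) = exp (- Re p * t) * (t powr r1 * u powr r2 * v powr r3 *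
        norm (rGamma (- \<mu> / 2) * rGamma (- \<nu> / 2) * hyp2f1 ((1 - \<mu>) / 2) ((1 - \<nu>) / 2) (3 / 2) (of_real z) +
          rGamma ((1 - \<mu>) / 2) * rGamma ((1 - \<nu>) / 2) * of_real (t * v / (4 * x * y)) powr (1 / 2) *
          hyp2f1 (- \<mu> / 2) (- \<nu> / 2) (1 / 2) (of_real z)))"
    proof -
      have "norm (complex_of_real t powr ((\<nu> - 1) / 2)) = t powr r1"
        using t0 by (simp add: norm_of_real_powr r)
      moreover have "norm (complex_of_real u powr (- (1 + \<mu> + \<nu>) / 2)) = u powr r2"
        using norm_of_real_powr[OF u] by (simp add: r)
      moreover have "norm (complex_of_real v powr ((\<mu> - 1) / 2)) = v powr r3"
        using norm_of_real_powr[OF t0(2)] by (simp add: r)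
      moreover have "norm (exp (- p * complex_of_real t)) = exp (- Re p * t)" by simp
      ultimately show ?thesis
        unfolding gker_def u_def[symmetric] v_def[symmetric] z_def[symmetric]
          norm_mult[of "exp _"] norm_mult[of "_ * _ powr _"] norm_mult[of "exp _ * _ powr _"]
        by (simp only: norm_mult[of "exp _"] norm_mult[of "exp _ * _ powr _"] norm_mult[of "exp _ * _ powr _ * _ powr _"]
            norm_mult[of "exp _ * _ powr _ * _ powr _ * _ powr _"] mult.assoc)
    qed
    also have "\<dots> \<le> exp (- (2 * \<epsilon>) * u) * (t powr r1 * u powr r2 * v powr r3 * (B * (X powr real K * X powr real K) * W))"
    proof (intro mult_mono inner)
      have "2 * \<epsilon> * u \<le> Re p * t"
      proof (rule mult_mono[OF p])
        show "u \<le> t" using x by (simp add: u_def)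
      qed (use p \<epsilon> u in auto)
      then show "exp (- Re p * t) \<le> exp (- (2 * \<epsilon>) * u)" by simp
    qed (use t0 u in auto)
    also have "\<dots> = exp (- (2 * \<epsilon>) * u) * (B * (X powr real K * X powr real K) *
        (t powr (r1 + \<sigma>) * u powr (r2 - \<sigma>) * v powr (r3 + \<sigma>) * (t + y) powr (- \<sigma>)))"
      unfolding Wp by (simp add: powr_add powr_diff powr_minus_divide)
    also have "\<dots> \<le> exp (- (2 * \<epsilon>) * u) * (B * (X powr real K * X powr real K) *
        (X powr real K * (u powr (\<eta> - 1) * (1 + u) powr real K) * X powr real K * X powr real K))"
    proof (intro mult_left_mono mult_mono)
      show "t powr (r1 + \<sigma>) \<le> X powr real K" "v powr (r3 + \<sigma>) \<le> X powr real K" "(t + y) powr (- \<sigma>) \<le> X powr real K"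
      proof -
        have "\<bar>r1 + \<sigma>\<bar> \<le> real K" "\<bar>r3 + \<sigma>\<bar> \<le> real K" "\<bar>- \<sigma>\<bar> \<le> real K"
          using K A \<sigma> \<eta> re by (simp_all add: r abs_le_iff field_simps)
        then show "t powr (r1 + \<sigma>) \<le> X powr real K" "v powr (r3 + \<sigma>) \<le> X powr real K" "(t + y) powr (- \<sigma>) \<le> X powr real K"
          using pXK[OF low(1) tX(1)] pXK[OF low(2) tX(2)] pXK[OF low(3) tX(3)] by blast+
      qed
      show "u powr (r2 - \<sigma>) \<le> u powr (\<eta> - 1) * (1 + u) powr real K"
        using u s2 K A \<sigma> \<eta> re by (intro powr_le_powr_mult) (auto simp: r abs_le_iff field_simps)
    qed (use B in auto)
    also have "\<dots> = B * L ^ (5 * K) * (u powr (\<eta> - 1) * (exp (- (2 * \<epsilon>) * u) * (1 + u) ^ (6 * K)))"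
    proof -
      have XK: "X powr real K = X ^ K" using X by (simp add: powr_realpow)
      have uK: "(1 + u) powr real K = (1 + u) ^ K" using u by (simp add: powr_realpow)
      have "5 * K = K + K + K + K + K" by simp
      then have "X ^ K * X ^ K * X ^ K * X ^ K * X ^ K * (1 + u) ^ K = X ^ (5 * K) * (1 + u) ^ K"
        by (simp only: power_add)
      also have "\<dots> = L ^ (5 * K) * ((1 + u) ^ (5 * K) * (1 + u) ^ K)"
        by (simp add: X_def power_mult_distrib)
      also have "(1 + u) ^ (5 * K) * (1 + u) ^ K = (1 + u) ^ (6 * K)"
        by (simp add: power_add[symmetric])
      finally have "X ^ K * X ^ K * X ^ K * X ^ K * X ^ K * (1 + u) ^ K = L ^ (5 * K) * (1 + u) ^ (6 * K)" .
      moreover have "exp (- (2 * \<epsilon>) * u) * (B * (X ^ K * X ^ K) * (X ^ K * (u powr (\<eta> - 1) * (1 + u) ^ K) * X ^ K * X ^ K)) =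
          B * (X ^ K * X ^ K * X ^ K * X ^ K * X ^ K * (1 + u) ^ K) * (u powr (\<eta> - 1) * exp (- (2 * \<epsilon>) * u))"
        by (simp only: mult_ac)
      ultimately show ?thesis unfolding XK uK by (simp only: mult_ac)
    qed
    also have "\<dots> \<le> B * L ^ (5 * K) * (u powr (\<eta> - 1) * (E * exp (- \<epsilon> * u)))"
    proof (intro mult_left_mono)
      have "(\<epsilon> * (1 + u)) ^ (6 * K) / fact (6 * K) \<le> exp (\<epsilon> * (1 + u))"
        using \<epsilon> u by (intro power_div_fact_le_exp) auto
      then have "(\<epsilon> * (1 + u)) ^ (6 * K) \<le> exp (\<epsilon> * (1 + u)) * fact (6 * K)"
        by (simp add: divide_le_eq)
      then have "(1 / \<epsilon>) ^ (6 * K) * (\<epsilon> * (1 + u)) ^ (6 * K) \<le> (1 / \<epsilon>) ^ (6 * K) * (exp (\<epsilon> * (1 + u)) * fact (6 * K))"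
        using \<epsilon> by (intro mult_left_mono) auto
      moreover have "(1 / \<epsilon>) ^ (6 * K) * (\<epsilon> * (1 + u)) ^ (6 * K) = (1 + u) ^ (6 * K)"
        using \<epsilon> by (simp add: power_mult_distrib[symmetric])
      moreover have "exp (\<epsilon> * (1 + u)) = exp \<epsilon> * exp (\<epsilon> * u)" by (simp add: exp_add[symmetric] algebra_simps)
      ultimately have "(1 + u) ^ (6 * K) \<le> E * exp (\<epsilon> * u)" by (simp add: E_def mult_ac)
      then have "exp (- (2 * \<epsilon>) * u) * (1 + u) ^ (6 * K) \<le> exp (- (2 * \<epsilon>) * u) * (E * exp (\<epsilon> * u))"
        by (intro mult_left_mono) auto
      also have "exp (- (2 * \<epsilon>) * u) * (E * exp (\<epsilon> * u)) = E * (exp (- (2 * \<epsilon>) * u) * exp (\<epsilon> * u))" by simp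
      also have "exp (- (2 * \<epsilon>) * u) * exp (\<epsilon> * u) = exp (- \<epsilon> * u)" by (simp add: exp_add[symmetric])
      finally show "exp (- (2 * \<epsilon>) * u) * (1 + u) ^ (6 * K) \<le> E * exp (- \<epsilon> * u)" .
    qed (use B L in auto)
    also have "\<dots> = C * ((t - x) powr (\<eta> - 1) * exp (- \<epsilon> * (t - x)))"
      by (simp add: C_def u_def mult_ac)
    finally show "norm (gker x y \<mu> \<nu> p t) \<le> C * ((t - x) powr (\<eta> - 1) * exp (- \<epsilon> * (t - x)))" .
  qed
qed

text \<open>The admissible set is open. The lemma extracts numerical slack valid for all parameters
  within \<eta> of the given ones, in the form required by the norm bounds.\<close>

lemma admissible_margin:
  assumes "admissible \<mu>0 \<nu>0 p0"
  obtains \<eta> e \<sigma> where "0 < \<eta>" "\<eta> \<le> 1" "0 < e" "0 < \<sigma>" "\<eta> \<le> Re p0 / 2"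
    "\<And>\<mu> \<nu>. norm (\<mu> - \<mu>0) \<le> \<eta> \<Longrightarrow> norm (\<nu> - \<nu>0) \<le> \<eta> \<Longrightarrow>
      e \<le> 1 + (Re \<nu> - Re \<mu>) / 2 \<and> Re \<nu> \<le> 1 - 2 * \<eta> \<and>
      - (1 + Re \<mu> + Re \<nu>) / 2 \<le> \<sigma> - \<eta> \<and> - (1 + Re \<mu> + Re \<nu>) / 2 - \<sigma> \<ge> \<eta> - 1"
proof -
  define m n where mn: "m = Re \<mu>0" "n = Re \<nu>0"
  have a: "n < 1" "m + n < 1" "m < 2 + n" "Re p0 > 0" using assms by (auto simp: admissible_def mn)
  define \<kappa> where "\<kappa> = (1 - m - n) / 2"
  define e where "e = (2 + n - m) / 4"
  define \<eta> where "\<eta> = Min {1 / 4, \<kappa> / 4, (1 - n) / 4, e, Re p0 / 4}"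
  \<comment> \<open>At the centre the growth exponent is \<kappa> - 1. With a perturbation of size
    \<eta>, the two demands read \<kappa> - 1 + 2 \<eta> <= \<sigma> <= \<kappa> - 2 \<eta>,
    together with \<sigma> > 0; the bounds \<eta> <= 1/4 and \<eta> <= \<kappa>/4 make this choice
    fit.\<close>
  define \<sigma> where "\<sigma> = max 0 (\<kappa> - 1) + 2 * \<eta>"
  have pos: "\<kappa> > 0" "e > 0" using a by (auto simp: \<kappa>_def e_def)
  have \<eta>: "\<eta> > 0" "\<eta> \<le> 1 / 4" "\<eta> \<le> \<kappa> / 4" "\<eta> \<le> (1 - n) / 4" "\<eta> \<le> e" "\<eta> \<le> Re p0 / 4"
  proof -
    show "\<eta> > 0" using a pos by (auto simp: \<eta>_def)
    have "\<eta> \<le> q" if "q \<in> {1 / 4, \<kappa> / 4, (1 - n) / 4, e, Re p0 / 4}" for q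
      unfolding \<eta>_def using that by (intro Min_le) auto
    then show "\<eta> \<le> 1 / 4" "\<eta> \<le> \<kappa> / 4" "\<eta> \<le> (1 - n) / 4" "\<eta> \<le> e" "\<eta> \<le> Re p0 / 4"
      by blast+
  qed
  show ?thesis
  proof (rule that[of \<eta> e \<sigma>])
    show "0 < \<eta>" "\<eta> \<le> 1" "0 < e" "0 < \<sigma>" "\<eta> \<le> Re p0 / 2"
      using \<eta> pos a by (auto simp: \<sigma>_def)
    fix \<mu> \<nu> :: complex assume n: "norm (\<mu> - \<mu>0) \<le> \<eta>" "norm (\<nu> - \<nu>0) \<le> \<eta>"
    have b: "\<bar>Re \<mu> - m\<bar> \<le> \<eta>" "\<bar>Re \<nu> - n\<bar> \<le> \<eta>"
      using n abs_Re_le_cmod[of "\<mu> - \<mu>0"] abs_Re_le_cmod[of "\<nu> - \<nu>0"] by (auto simp: mn)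
    have 1: "e \<le> 1 + (Re \<nu> - Re \<mu>) / 2"
      using b \<eta> by (simp add: e_def abs_le_iff field_simps)
    have 2: "Re \<nu> \<le> 1 - 2 * \<eta>" using b \<eta> by (simp add: abs_le_iff field_simps)
    have h: "\<kappa> - 1 - \<eta> \<le> - (1 + Re \<mu> + Re \<nu>) / 2" "- (1 + Re \<mu> + Re \<nu>) / 2 \<le> \<kappa> - 1 + \<eta>"
      using b by (simp_all add: \<kappa>_def abs_le_iff field_simps)
    have 3: "- (1 + Re \<mu> + Re \<nu>) / 2 \<le> \<sigma> - \<eta>"
      using h(2) max.cobounded2[of "\<kappa> - 1" 0] unfolding \<sigma>_def by linarith
    have "max 0 (\<kappa> - 1) \<le> \<kappa> - 4 * \<eta>" using \<eta> by (simp add: max_def)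
    then have 4: "- (1 + Re \<mu> + Re \<nu>) / 2 - \<sigma> \<ge> \<eta> - 1" using h \<eta> unfolding \<sigma>_def by linarith
    show "e \<le> 1 + (Re \<nu> - Re \<mu>) / 2 \<and> Re \<nu> \<le> 1 - 2 * \<eta> \<and>
      - (1 + Re \<mu> + Re \<nu>) / 2 \<le> \<sigma> - \<eta> \<and> - (1 + Re \<mu> + Re \<nu>) / 2 - \<sigma> \<ge> \<eta> - 1"
      using 1 2 3 4 by blast
  qed
qed

text \<open>Reuses \<open>nn_int_Beta_exp\<close> with p = 1; the exponential is removed again by 1
  <= exp x * exp (-t) on (0, x).\<close>

lemma set_integrable_Beta_scaled:
  fixes a b x :: real
  assumes "a > 0" "b > 0" "x > 0"
  shows "set_integrable lborel {0<..<x} (\<lambda>t. t powr (a - 1) * (x - t) powr (b - 1))"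
proof -
  have m: "set_borel_measurable lborel {0<..<x} (\<lambda>t. t powr (a - 1) * (x - t) powr (b - 1) * exp (- 1 * t))"
    by (simp add: set_borel_measurable_def)
  have "nn_int {0<..<x} (\<lambda>t. t powr (a - 1) * (x - t) powr (b - 1) * exp (- 1 * t)) < top"
    unfolding nn_int_Beta_exp[OF assms(2,1,3) zero_less_one] by simp
  then obtain r where r: "r \<ge> 0" "nn_int {0<..<x} (\<lambda>t. t powr (a - 1) * (x - t) powr (b - 1) * exp (- 1 * t)) = ennreal r"
    by (cases "nn_int {0<..<x} (\<lambda>t. t powr (a - 1) * (x - t) powr (b - 1) * exp (- 1 * t))") auto
  then have "set_integrable lborel {0<..<x} (\<lambda>t. t powr (a - 1) * (x - t) powr (b - 1) * exp (- 1 * t))"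
    using nn_int_eq_ennreal_iff[OF m _ r(1)] by auto
  then have "set_integrable lborel {0<..<x} (\<lambda>t. exp x * (t powr (a - 1) * (x - t) powr (b - 1) * exp (- 1 * t)))"
    by (rule set_integrable_mult_right)
  then show ?thesis
  proof (rule set_integrable_bound)
    show "set_borel_measurable lborel {0<..<x} (\<lambda>t. t powr (a - 1) * (x - t) powr (b - 1))"
      by (simp add: set_borel_measurable_def)
    show "AE t in lborel. t \<in> {0<..<x} \<longrightarrow> norm (t powr (a - 1) * (x - t) powr (b - 1)) \<le>
        norm (exp x * (t powr (a - 1) * (x - t) powr (b - 1) * exp (- 1 * t)))"
    proof (rule AE_I2, rule impI)
      fix t assume t: "t \<in> {0<..<x}"
      have "(t powr (a - 1) * (x - t) powr (b - 1)) * 1 \<le> (t powr (a - 1) * (x - t) powr (b - 1)) * (exp x * exp (- 1 * t))"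
        using t by (intro mult_left_mono) (auto simp: exp_add[symmetric])
      then show "norm (t powr (a - 1) * (x - t) powr (b - 1)) \<le>
        norm (exp x * (t powr (a - 1) * (x - t) powr (b - 1) * exp (- 1 * t)))"
        by (simp add: abs_mult mult_ac)
    qed
  qed
qed

text \<open>One dominating function for a whole polydisc in (\<mu>, \<nu>, p), so that the same
  bound serves the continuation in each of the three variables.\<close>

lemma fker_local_bound:
  assumes x: "x > 0" and y: "y > 0" and adm: "admissible \<mu>0 \<nu>0 p0"
  shows "\<exists>\<delta>>0. \<exists>h. set_integrable lborel {0<..<x} h \<and> (\<forall>\<mu> \<nu> p t. norm (\<mu> - \<mu>0) \<le> \<delta> \<longrightarrow>
    norm (\<nu> - \<nu>0) \<le> \<delta> \<longrightarrow> norm (p - p0) \<le> \<delta> \<longrightarrow> t \<in> {0<..<x} \<longrightarrow> norm (fker x y \<mu> \<nu> p t) \<le> h t)"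
proof -
  obtain \<eta> e \<sigma> where \<eta>: "0 < \<eta>" "\<eta> \<le> 1" "0 < e" "0 < \<sigma>" "\<eta> \<le> Re p0 / 2"
    and marg: "\<And>\<mu> \<nu>. norm (\<mu> - \<mu>0) \<le> \<eta> \<Longrightarrow> norm (\<nu> - \<nu>0) \<le> \<eta> \<Longrightarrow>
      e \<le> 1 + (Re \<nu> - Re \<mu>) / 2 \<and> Re \<nu> \<le> 1 - 2 * \<eta> \<and>
      - (1 + Re \<mu> + Re \<nu>) / 2 \<le> \<sigma> - \<eta> \<and> - (1 + Re \<mu> + Re \<nu>) / 2 - \<sigma> \<ge> \<eta> - 1"
    using admissible_margin[OF adm] by blast
  define A where "A = norm \<mu>0 + norm \<nu>0 + 1"
  have A: "A \<ge> 1" by (simp add: A_def)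
  obtain C where C: "\<And>\<mu> \<nu> p t. norm \<mu> \<le> A \<Longrightarrow> norm \<nu> \<le> A \<Longrightarrow> Re p \<ge> 0 \<Longrightarrow> e \<le> 1 + (Re \<nu> - Re \<mu>) / 2 \<Longrightarrow>
    Re \<nu> \<le> 1 - 2 * \<eta> \<Longrightarrow> - (1 + Re \<mu> + Re \<nu>) / 2 \<le> \<sigma> - \<eta> \<Longrightarrow> - (1 + Re \<mu> + Re \<nu>) / 2 - \<sigma> \<ge> \<eta> - 1 \<Longrightarrow>
    t \<in> {0<..<x} \<Longrightarrow> norm (fker x y \<mu> \<nu> p t) \<le> C * (t powr (e - 1) * (x - t) powr (\<eta> - 1))"
    using fker_norm_bound[OF x y A \<eta>(3,1,4)] by blast
  show ?thesis
  proof (intro exI[of _ \<eta>] conjI exI[of _ "\<lambda>t. C * (t powr (e - 1) * (x - t) powr (\<eta> - 1))"] allI impI)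
    show "set_integrable lborel {0<..<x} (\<lambda>t. C * (t powr (e - 1) * (x - t) powr (\<eta> - 1)))"
      by (intro set_integrable_mult_right set_integrable_Beta_scaled \<eta> x)
    fix \<mu> \<nu> p :: complex and t
    assume d: "norm (\<mu> - \<mu>0) \<le> \<eta>" "norm (\<nu> - \<nu>0) \<le> \<eta>" "norm (p - p0) \<le> \<eta>" and t: "t \<in> {0<..<x}"
    have n: "norm \<mu> \<le> A" "norm \<nu> \<le> A"
      using norm_triangle_sub[of \<mu> \<mu>0] norm_triangle_sub[of \<nu> \<nu>0] d \<eta>(2) norm_ge_zero[of \<mu>0] norm_ge_zero[of \<nu>0]
      unfolding A_def by linarith+
    have "\<bar>Re (p - p0)\<bar> \<le> \<eta>" using d(3) abs_Re_le_cmod order_trans by blast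
    then have "Re p \<ge> 0" using \<eta>(1,5) by simp
    then show "norm (fker x y \<mu> \<nu> p t) \<le> C * (t powr (e - 1) * (x - t) powr (\<eta> - 1))"
      using marg[OF d(1,2)] by (intro C n t) auto
  qed (rule \<eta>(1))
qed

lemma gker_local_bound:
  assumes x: "x > 0" and y: "y > 0" and adm: "admissible \<mu>0 \<nu>0 p0"
  shows "\<exists>\<delta>>0. \<exists>h. set_integrable lborel {x<..} h \<and> (\<forall>\<mu> \<nu> p t. norm (\<mu> - \<mu>0) \<le> \<delta> \<longrightarrow>
    norm (\<nu> - \<nu>0) \<le> \<delta> \<longrightarrow> norm (p - p0) \<le> \<delta> \<longrightarrow> t \<in> {x<..} \<longrightarrow> norm (gker x y \<mu> \<nu> p t) \<le> h t)"
proof -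
  obtain \<eta> e \<sigma> where \<eta>: "0 < \<eta>" "\<eta> \<le> 1" "0 < e" "0 < \<sigma>" "\<eta> \<le> Re p0 / 2"
    and marg: "\<And>\<mu> \<nu>. norm (\<mu> - \<mu>0) \<le> \<eta> \<Longrightarrow> norm (\<nu> - \<nu>0) \<le> \<eta> \<Longrightarrow>
      e \<le> 1 + (Re \<nu> - Re \<mu>) / 2 \<and> Re \<nu> \<le> 1 - 2 * \<eta> \<and>
      - (1 + Re \<mu> + Re \<nu>) / 2 \<le> \<sigma> - \<eta> \<and> - (1 + Re \<mu> + Re \<nu>) / 2 - \<sigma> \<ge> \<eta> - 1"
    using admissible_margin[OF adm] by blast
  define A where "A = norm \<mu>0 + norm \<nu>0 + 1"
  have A: "A \<ge> 1" by (simp add: A_def)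
  \<comment> \<open>Within \<eta> <= Re p0 / 2 of p0 one has Re p >= 2 \<epsilon>. One \<epsilon>
    pays for polynomial growth in \<open>gker_norm_bound\<close>, the other remains in the
    dominating function.\<close>
  define \<epsilon> where "\<epsilon> = Re p0 / 4"
  have \<epsilon>: "\<epsilon> > 0" using adm by (simp add: \<epsilon>_def admissible_def)
  have bdd: "\<exists>B\<ge>0. \<forall>u\<in>cball (c::complex) \<eta>. norm (rGamma (f u)) \<le> B" if "continuous_on UNIV f" for c and f :: "complex \<Rightarrow> complex"
  proof -
    have "continuous_on (cball c \<eta>) (\<lambda>u. rGamma (f u))"
      by (rule continuous_on_subset[OF continuous_on_compose2[OF holomorphic_on_imp_continuous_on[OF holomorphic_rGamma[of UNIV]] that]]) auto
    then have "bounded ((\<lambda>u. rGamma (f u)) ` cball c \<eta>)"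
      by (intro compact_imp_bounded compact_continuous_image) auto
    then show ?thesis unfolding bounded_pos by (auto intro: less_imp_le)
  qed
  have cont: "continuous_on UNIV (\<lambda>u::complex. - u / 2)" "continuous_on UNIV (\<lambda>u::complex. (1 - u) / 2)"
    by (auto intro!: continuous_intros)
  obtain R1 where R1: "R1 \<ge> 0" "\<And>u. u \<in> cball \<mu>0 \<eta> \<Longrightarrow> norm (rGamma (- u / 2)) \<le> R1"
    using bdd[OF cont(1), of \<mu>0] by blast
  obtain R2 where R2: "R2 \<ge> 0" "\<And>u. u \<in> cball \<nu>0 \<eta> \<Longrightarrow> norm (rGamma (- u / 2)) \<le> R2"
    using bdd[OF cont(1), of \<nu>0] by blast
  obtain R3 where R3: "R3 \<ge> 0" "\<And>u. u \<in> cball \<mu>0 \<eta> \<Longrightarrow> norm (rGamma ((1 - u) / 2)) \<le> R3"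
    using bdd[OF cont(2), of \<mu>0] by blast
  obtain R4 where R4: "R4 \<ge> 0" "\<And>u. u \<in> cball \<nu>0 \<eta> \<Longrightarrow> norm (rGamma ((1 - u) / 2)) \<le> R4"
    using bdd[OF cont(2), of \<nu>0] by blast
  define R where "R = R1 * R2 + R3 * R4"
  have R: "R \<ge> 0" "R1 * R2 \<le> R" "R3 * R4 \<le> R" using R1(1) R2(1) R3(1) R4(1) by (auto simp: R_def)
  obtain C where C: "\<And>\<mu> \<nu> p t. norm \<mu> \<le> A \<Longrightarrow> norm \<nu> \<le> A \<Longrightarrow> Re p \<ge> 2 * \<epsilon> \<Longrightarrow>
    norm (rGamma (- \<mu> / 2) * rGamma (- \<nu> / 2)) \<le> R \<Longrightarrow> norm (rGamma ((1 - \<mu>) / 2) * rGamma ((1 - \<nu>) / 2)) \<le> R \<Longrightarrow>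
    - (1 + Re \<mu> + Re \<nu>) / 2 \<le> \<sigma> - \<eta> \<Longrightarrow> - (1 + Re \<mu> + Re \<nu>) / 2 - \<sigma> \<ge> \<eta> - 1 \<Longrightarrow>
    t \<in> {x<..} \<Longrightarrow> norm (gker x y \<mu> \<nu> p t) \<le> C * ((t - x) powr (\<eta> - 1) * exp (- \<epsilon> * (t - x)))"
    using gker_norm_bound[OF x y A \<eta>(1,4) \<epsilon> R(1)] by blast
  show ?thesis
  proof (intro exI[of _ \<eta>] conjI exI[of _ "\<lambda>t. C * ((t - x) powr (\<eta> - 1) * exp (- \<epsilon> * (t - x)))"] allI impI)
    show "set_integrable lborel {x<..} (\<lambda>t. C * ((t - x) powr (\<eta> - 1) * exp (- \<epsilon> * (t - x))))"
      by (intro set_integrable_mult_right set_integrable_shifted_Gamma \<eta> \<epsilon>)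
    fix \<mu> \<nu> p :: complex and t
    assume d: "norm (\<mu> - \<mu>0) \<le> \<eta>" "norm (\<nu> - \<nu>0) \<le> \<eta>" "norm (p - p0) \<le> \<eta>" and t: "t \<in> {x<..}"
    have n: "norm \<mu> \<le> A" "norm \<nu> \<le> A"
      using norm_triangle_sub[of \<mu> \<mu>0] norm_triangle_sub[of \<nu> \<nu>0] d \<eta>(2) norm_ge_zero[of \<mu>0] norm_ge_zero[of \<nu>0]
      unfolding A_def by linarith+
    have "\<bar>Re (p - p0)\<bar> \<le> \<eta>" using d(3) abs_Re_le_cmod order_trans by blast
    then have p: "Re p \<ge> 2 * \<epsilon>" using \<eta>(1,5) by (simp add: \<epsilon>_def)
    have c: "\<mu> \<in> cball \<mu>0 \<eta>" "\<nu> \<in> cball \<nu>0 \<eta>" using d by (auto simp: dist_norm norm_minus_commute)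
    have g1: "norm (rGamma (- \<mu> / 2) * rGamma (- \<nu> / 2)) \<le> R"
      unfolding norm_mult using mult_mono[OF R1(2)[OF c(1)] R2(2)[OF c(2)] R1(1) norm_ge_zero] R(2) by linarith
    have g2: "norm (rGamma ((1 - \<mu>) / 2) * rGamma ((1 - \<nu>) / 2)) \<le> R"
      unfolding norm_mult using mult_mono[OF R3(2)[OF c(1)] R4(2)[OF c(2)] R3(1) norm_ge_zero] R(3) by linarith
    show "norm (gker x y \<mu> \<nu> p t) \<le> C * ((t - x) powr (\<eta> - 1) * exp (- \<epsilon> * (t - x)))"
      using marg[OF d(1,2)] by (intro C n p t g1 g2) auto
  qed (rule \<eta>(1))
qed

section \<open>Integrability and holomorphy of the kernel integrals\<close>

lemma set_integrable_of_local_bound: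
  fixes ker :: "complex \<Rightarrow> complex \<Rightarrow> complex \<Rightarrow> real \<Rightarrow> complex"
  assumes "set_borel_measurable lborel A (ker \<mu> \<nu> p)"
    and "\<exists>\<delta>>0. \<exists>h. set_integrable lborel A h \<and> (\<forall>\<mu>' \<nu>' p' t. norm (\<mu>' - \<mu>) \<le> \<delta> \<longrightarrow>
      norm (\<nu>' - \<nu>) \<le> \<delta> \<longrightarrow> norm (p' - p) \<le> \<delta> \<longrightarrow> t \<in> A \<longrightarrow> norm (ker \<mu>' \<nu>' p' t) \<le> h t)"
  shows "set_integrable lborel A (ker \<mu> \<nu> p)"
proof -
  obtain \<delta> and h :: "real \<Rightarrow> real" where h: "\<delta> > 0" "set_integrable lborel A h"
    "\<And>\<mu>' \<nu>' p' t. norm (\<mu>' - \<mu>) \<le> \<delta> \<Longrightarrow> norm (\<nu>' - \<nu>) \<le> \<delta> \<Longrightarrow> norm (p' - p) \<le> \<delta> \<Longrightarrow> t \<in> A \<Longrightarrow> norm (ker \<mu>' \<nu>' p' t) \<le> h t"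
    using assms(2) by blast
  have "norm (ker \<mu> \<nu> p t) \<le> norm (h t)" if "t \<in> A" for t
  proof -
    have "norm (ker \<mu> \<nu> p t) \<le> h t" using h(1) that by (intro h(3)) auto
    then show ?thesis by simp
  qed
  then show ?thesis
    by (intro set_integrable_bound[OF h(2) assms(1)] AE_I2 impI)
qed

text \<open>The parameters are holomorphic functions of a single variable w; letting one of them be
  w and the others constant gives all three continuations. Continuity maps a small ball around w
  into the polydisc of the local bound.\<close>

lemma holomorphic_on_kernel_integral:
  fixes ker :: "complex \<Rightarrow> complex \<Rightarrow> complex \<Rightarrow> real \<Rightarrow> complex"
  assumes W: "open W" and hol: "\<mu> holomorphic_on W" "\<nu> holomorphic_on W" "p holomorphic_on W"
    and adm: "\<And>w. w \<in> W \<Longrightarrow> admissible (\<mu> w) (\<nu> w) (p w)"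
    and meas: "\<And>\<mu> \<nu> p. admissible \<mu> \<nu> p \<Longrightarrow> set_borel_measurable lborel A (ker \<mu> \<nu> p)"
    and ker: "\<And>t. t \<in> A \<Longrightarrow> (\<lambda>w. ker (\<mu> w) (\<nu> w) (p w) t) holomorphic_on W"
    and bound: "\<And>\<mu>0 \<nu>0 p0. admissible \<mu>0 \<nu>0 p0 \<Longrightarrow> \<exists>\<delta>>0. \<exists>h. set_integrable lborel A h \<and> (\<forall>\<mu> \<nu> p t. norm (\<mu> - \<mu>0) \<le> \<delta> \<longrightarrow>
      norm (\<nu> - \<nu>0) \<le> \<delta> \<longrightarrow> norm (p - p0) \<le> \<delta> \<longrightarrow> t \<in> A \<longrightarrow> norm (ker \<mu> \<nu> p t) \<le> h t)"
  shows "(\<lambda>w. LBINT t:A. ker (\<mu> w) (\<nu> w) (p w) t) holomorphic_on W"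
proof (rule holomorphic_on_set_lebesgue_integral[OF W])
  show "set_borel_measurable lborel A (\<lambda>t. ker (\<mu> w) (\<nu> w) (p w) t)" if "w \<in> W" for w
    using meas[OF adm[OF that]] by simp
  fix w assume w: "w \<in> W"
  obtain \<delta> and h :: "real \<Rightarrow> real" where h: "\<delta> > 0" "set_integrable lborel A h"
    "\<And>\<mu>' \<nu>' p' t. norm (\<mu>' - \<mu> w) \<le> \<delta> \<Longrightarrow> norm (\<nu>' - \<nu> w) \<le> \<delta> \<Longrightarrow> norm (p' - p w) \<le> \<delta> \<Longrightarrow> t \<in> A \<Longrightarrow> norm (ker \<mu>' \<nu>' p' t) \<le> h t"
    using bound[OF adm[OF w]] by blast
  have near: "\<forall>\<^sub>F u in nhds w. norm (f u - f w) \<le> \<delta>" if "f holomorphic_on W" for f :: "complex \<Rightarrow> complex"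
  proof -
    have "isCont f w"
      using holomorphic_on_imp_continuous_on[OF that] W w continuous_on_eq_continuous_at by blast
    then have "(f \<longlongrightarrow> f w) (nhds w)" by (simp add: continuous_at tendsto_nhds_iff)
    then have "\<forall>\<^sub>F u in nhds w. dist (f u) (f w) < \<delta>" using h(1) by (rule tendstoD)
    then show ?thesis by eventually_elim (simp add: dist_norm)
  qed
  have "\<forall>\<^sub>F u in nhds w. norm (\<mu> u - \<mu> w) \<le> \<delta> \<and> norm (\<nu> u - \<nu> w) \<le> \<delta> \<and> norm (p u - p w) \<le> \<delta>"
    by (intro eventually_conj near hol)
  then obtain r where r: "r > 0" "\<And>u. dist u w < r \<Longrightarrow> norm (\<mu> u - \<mu> w) \<le> \<delta> \<and> norm (\<nu> u - \<nu> w) \<le> \<delta> \<and> norm (p u - p w) \<le> \<delta>"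
    unfolding eventually_nhds_metric by blast
  show "\<exists>r>0. \<exists>h. set_integrable lborel A h \<and>
      (\<forall>u\<in>ball w r \<inter> W. \<forall>t\<in>A. norm (ker (\<mu> u) (\<nu> u) (p u) t) \<le> h t)"
  proof (intro exI[of _ r] conjI exI[of _ h] ballI)
    fix u t assume "u \<in> ball w r \<inter> W" and t: "t \<in> A"
    then have "dist u w < r" by (simp add: dist_commute)
    then show "norm (ker (\<mu> u) (\<nu> u) (p u) t) \<le> h t" using r(2) h(3) t by blast
  qed (use r h in auto)
qed (rule ker)

lemma holomorphic_fker_integral:
  assumes x: "x > 0" and y: "y > 0" and W: "open W"
    and hol: "\<mu> holomorphic_on W" "\<nu> holomorphic_on W" "p holomorphic_on W"
    and adm: "\<And>w. w \<in> W \<Longrightarrow> admissible (\<mu> w) (\<nu> w) (p w)"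
  shows "(\<lambda>w. LBINT t:{0<..<x}. fker x y (\<mu> w) (\<nu> w) (p w) t) holomorphic_on W"
proof (rule holomorphic_on_kernel_integral[OF W hol adm fker_measurable[OF x y] _ fker_local_bound[OF x y]])
  fix t :: real assume t: "t \<in> {0<..<x}"
  have "(\<lambda>w. hyp2f1 (- \<mu> w / 2) ((1 + \<nu> w) / 2) (1 + (\<nu> w - \<mu> w) / 2)
      (of_real (t * (x - y - t) / ((x - t) * (y + t))))) holomorphic_on W"
  proof (rule holomorphic_hyp2f1_params[OF W])
    show "t * (x - y - t) / ((x - t) * (y + t)) < 1" using t by (intro cross_ratio_less_1(1) x y) auto
    show "Re (1 + (\<nu> w - \<mu> w) / 2) > 0" if "w \<in> W" for w by (rule admissible_cRe[OF adm[OF that]])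
  qed (intro holomorphic_intros hol; simp)+
  then show "(\<lambda>w. fker x y (\<mu> w) (\<nu> w) (p w) t) holomorphic_on W"
    unfolding fker_def by (intro holomorphic_intros hol) auto
qed

lemma holomorphic_gker_integral:
  assumes x: "x > 0" and y: "y > 0" and W: "open W"
    and hol: "\<mu> holomorphic_on W" "\<nu> holomorphic_on W" "p holomorphic_on W"
    and adm: "\<And>w. w \<in> W \<Longrightarrow> admissible (\<mu> w) (\<nu> w) (p w)"
  shows "(\<lambda>w. LBINT t:{x<..}. gker x y (\<mu> w) (\<nu> w) (p w) t) holomorphic_on W"
proof (rule holomorphic_on_kernel_integral[OF W hol adm gker_measurable[OF x y] _ gker_local_bound[OF x y]])
  fix t :: real assume t: "t \<in> {x<..}"
  have z: "x * y / (t * (y - x + t)) < 1" using t by (intro cross_ratio_less_1(2) x y) auto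
  have 1: "(\<lambda>w. hyp2f1 ((1 - \<mu> w) / 2) ((1 - \<nu> w) / 2) (3 / 2) (of_real (x * y / (t * (y - x + t))))) holomorphic_on W"
    by (rule holomorphic_hyp2f1_params[OF W _ _ _ _ z]) (auto intro!: holomorphic_intros hol)
  have 2: "(\<lambda>w. hyp2f1 (- \<mu> w / 2) (- \<nu> w / 2) (1 / 2) (of_real (x * y / (t * (y - x + t))))) holomorphic_on W"
    by (rule holomorphic_hyp2f1_params[OF W _ _ _ _ z]) (auto intro!: holomorphic_intros hol)
  show "(\<lambda>w. gker x y (\<mu> w) (\<nu> w) (p w) t) holomorphic_on W"
    unfolding gker_def by (intro holomorphic_intros hol 1 2) auto
qed

section \<open>Analytic continuation in the parameters\<close>

definition product_side :: "real \<Rightarrow> real \<Rightarrow> complex \<Rightarrow> complex \<Rightarrow> complex \<Rightarrow> complex" where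
  "product_side x y \<mu> \<nu> p = p powr (- 1 / 2) * exp (1 / 2 * p * of_real (y - x)) *
     parabolic_cylinder_D \<mu> (2 powr (1 / 2) * of_real y powr (1 / 2) * p powr (1 / 2)) *
     parabolic_cylinder_D \<nu> (- (2 powr (1 / 2)) * of_real x powr (1 / 2) * p powr (1 / 2))"

definition integral_side :: "real \<Rightarrow> real \<Rightarrow> complex \<Rightarrow> complex \<Rightarrow> complex \<Rightarrow> complex" where
  "integral_side x y \<mu> \<nu> p = 2 powr ((\<mu> - \<nu>) / 2) * of_real (sqrt pi) *
     rGamma (1 + (\<nu> - \<mu>) / 2) * rGamma (- \<nu>) * (LBINT t:{0<..<x}. fker x y \<mu> \<nu> p t) +
     2 powr (1 + (\<mu> + \<nu>) / 2) * of_real (sqrt pi) *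
     of_real x powr (1 / 2) * of_real y powr (1 / 2) * (LBINT t:{x<..}. gker x y \<mu> \<nu> p t)"

lemma holomorphic_product_side:
  assumes W: "open W" and hol: "\<mu> holomorphic_on W" "\<nu> holomorphic_on W" "p holomorphic_on W"
    and p: "\<And>w. w \<in> W \<Longrightarrow> Re (p w) > 0"
  shows "(\<lambda>w. product_side x y (\<mu> w) (\<nu> w) (p w)) holomorphic_on W"
proof -
  have np: "p w \<notin> \<real>\<^sub>\<le>\<^sub>0" if "w \<in> W" for w
    using p[OF that] by (auto simp: complex_nonpos_Reals_iff)
  show ?thesis unfolding product_side_def
    by (intro holomorphic_intros holomorphic_parabolic_cylinder_D W hol np)
qed

lemma holomorphic_integral_side:
  assumes x: "x > 0" and y: "y > 0" and W: "open W"
    and hol: "\<mu> holomorphic_on W" "\<nu> holomorphic_on W" "p holomorphic_on W"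
    and adm: "\<And>w. w \<in> W \<Longrightarrow> admissible (\<mu> w) (\<nu> w) (p w)"
  shows "(\<lambda>w. integral_side x y (\<mu> w) (\<nu> w) (p w)) holomorphic_on W"
  unfolding integral_side_def
  by (intro holomorphic_on_add holomorphic_on_mult holomorphic_fker_integral[OF x y W hol adm]
      holomorphic_gker_integral[OF x y W hol adm])
    (auto intro!: holomorphic_intros hol)

lemma powr_half_of_real: "r \<ge> 0 \<Longrightarrow> complex_of_real r powr (1 / 2) = of_real (sqrt r)"
  using powr_of_real[of r "1 / 2"] by (simp add: powr_half_sqrt)

lemma exp_minus_mult_of_real: "exp (- complex_of_real p * of_real t) = of_real (exp (- p * t))"
  by (simp flip: exp_of_real)

lemma fker_of_real:
  assumes \<mu>: "\<mu> < 0" and \<nu>: "- 1 < \<nu>" "\<nu> < 0" and x: "x > 0" and y: "y > 0" and t: "0 < t" "t < x"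
  shows "fker x y (of_real \<mu>) (of_real \<nu>) (of_real p) t = of_real (exp (- p * t) *
    (t powr ((\<nu> - \<mu>) / 2) * (x - t) powr (- (1 + \<nu>) / 2) * (y + t) powr (\<mu> / 2) *
      hyp2f1_real (- \<mu> / 2) ((1 + \<nu>) / 2) (1 + (\<nu> - \<mu>) / 2) (t * (x - y - t) / ((x - t) * (y + t)))))"
proof -
  have pos: "x - t > 0" "y + t > 0" using t y by auto
  have z: "t * (x - y - t) / ((x - t) * (y + t)) < 1" by (rule cross_ratio_less_1(1)[OF x y t])
  have h: "hyp2f1 (of_real (- \<mu> / 2)) (of_real ((1 + \<nu>) / 2)) (of_real (1 + (\<nu> - \<mu>) / 2))
      (of_real (t * (x - y - t) / ((x - t) * (y + t)))) =
      of_real (hyp2f1_real (- \<mu> / 2) ((1 + \<nu>) / 2) (1 + (\<nu> - \<mu>) / 2) (t * (x - y - t) / ((x - t) * (y + t))))"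
    by (rule hyp2f1_real_euler(3)) (use \<mu> \<nu> z in \<open>auto simp: field_simps\<close>)
  have args: "- complex_of_real \<mu> / 2 = of_real (- \<mu> / 2)" "(1 + complex_of_real \<nu>) / 2 = of_real ((1 + \<nu>) / 2)"
    "1 + complex_of_real ((\<nu> - \<mu>) / 2) = of_real (1 + (\<nu> - \<mu>) / 2)"
    "(complex_of_real \<nu> - of_real \<mu>) / 2 = of_real ((\<nu> - \<mu>) / 2)"
    "- (1 + complex_of_real \<nu>) / 2 = of_real (- (1 + \<nu>) / 2)" "complex_of_real \<mu> / 2 = of_real (\<mu> / 2)"
    by simp_all
  show ?thesis
    unfolding fker_def args h exp_minus_mult_of_real
      powr_of_real[OF less_imp_le[OF t(1)]] powr_of_real[OF less_imp_le[OF pos(1)]] powr_of_real[OF less_imp_le[OF pos(2)]]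
    by (simp only: of_real_mult mult.assoc)
qed

text \<open>The root of t (y - x + t) / (4 x y) raises the exponents (\<nu> - 1) / 2 and (\<mu> - 1)
  / 2 to \<nu> / 2 and \<mu> / 2, which turns the last term into the integrand \<open>G1\<close>,
  and leaves 1 / (2 sqrt x sqrt y) as coefficient.\<close>

lemma gker_of_real:
  assumes \<mu>: "\<mu> < 0" and \<nu>: "- 1 < \<nu>" "\<nu> < 0" and x: "x > 0" and y: "y > 0" and t: "x < t"
  shows "gker x y (of_real \<mu>) (of_real \<nu>) (of_real p) t = of_real (
    rGamma (- \<mu> / 2) * rGamma (- \<nu> / 2) * (exp (- p * t) *
      (t powr ((\<nu> - 1) / 2) * (t - x) powr (- (1 + \<mu> + \<nu>) / 2) * (y - x + t) powr ((\<mu> - 1) / 2) *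
        hyp2f1_real ((1 - \<mu>) / 2) ((1 - \<nu>) / 2) (3 / 2) (x * y / (t * (y - x + t))))) +
    rGamma ((1 - \<mu>) / 2) * rGamma ((1 - \<nu>) / 2) / (2 * sqrt x * sqrt y) * (exp (- p * t) *
      (t powr (\<nu> / 2) * (t - x) powr (- (1 + \<mu> + \<nu>) / 2) * (y - x + t) powr (\<mu> / 2) *
        hyp2f1_real (- \<mu> / 2) (- \<nu> / 2) (1 / 2) (x * y / (t * (y - x + t))))))"
proof -
  define v where "v = y - x + t"
  have pos: "t > 0" "t - x > 0" "v > 0" using t x y by (auto simp: v_def)
  define z where "z = x * y / (t * v)"
  have z: "z < 1" unfolding z_def v_def by (rule cross_ratio_less_1(2)[OF x y t])
  have h1: "hyp2f1 (of_real ((1 - \<mu>) / 2)) (of_real ((1 - \<nu>) / 2)) (of_real (3 / 2)) (of_real z) =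
      of_real (hyp2f1_real ((1 - \<mu>) / 2) ((1 - \<nu>) / 2) (3 / 2) z)"
    by (rule hyp2f1_real_euler(3)) (use \<mu> \<nu> z in \<open>auto simp: field_simps\<close>)
  have h2: "hyp2f1 (of_real (- \<mu> / 2)) (of_real (- \<nu> / 2)) (of_real (1 / 2)) (of_real z) =
      of_real (hyp2f1_real (- \<mu> / 2) (- \<nu> / 2) (1 / 2) z)"
    by (rule hyp2f1_real_euler(3)) (use \<mu> \<nu> z in \<open>auto simp: field_simps\<close>)
  have args: "- complex_of_real \<mu> / 2 = of_real (- \<mu> / 2)" "- complex_of_real \<nu> / 2 = of_real (- \<nu> / 2)"
    "(1 - complex_of_real \<mu>) / 2 = of_real ((1 - \<mu>) / 2)" "(1 - complex_of_real \<nu>) / 2 = of_real ((1 - \<nu>) / 2)"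
    "(complex_of_real \<nu> - 1) / 2 = of_real ((\<nu> - 1) / 2)" "(complex_of_real \<mu> - 1) / 2 = of_real ((\<mu> - 1) / 2)"
    "- (1 + complex_of_real \<mu> + complex_of_real \<nu>) / 2 = of_real (- (1 + \<mu> + \<nu>) / 2)"
    "(3 / 2 :: complex) = of_real (3 / 2)"
    by simp_all
  have sq: "complex_of_real (t * v / (4 * x * y)) powr (1 / 2) = of_real (sqrt t * sqrt v / (2 * sqrt x * sqrt y))"
    using pos x y by (subst powr_half_of_real) (auto simp: real_sqrt_mult real_sqrt_divide)
  have half: "(1 / 2 :: complex) = of_real (1 / 2)" by simp
  define r2 where "r2 = (t - x) powr (- (1 + \<mu> + \<nu>) / 2)"
  define H1 where "H1 = hyp2f1_real ((1 - \<mu>) / 2) ((1 - \<nu>) / 2) (3 / 2) z"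
  define H2 where "H2 = hyp2f1_real (- \<mu> / 2) (- \<nu> / 2) (1 / 2) z"
  have "gker x y (of_real \<mu>) (of_real \<nu>) (of_real p) t = of_real (exp (- p * t) * t powr ((\<nu> - 1) / 2) * r2 * v powr ((\<mu> - 1) / 2) *
      (rGamma (- \<mu> / 2) * rGamma (- \<nu> / 2) * H1 +
       rGamma ((1 - \<mu>) / 2) * rGamma ((1 - \<nu>) / 2) * (sqrt t * sqrt v / (2 * sqrt x * sqrt y)) * H2))"
    unfolding gker_def v_def[symmetric] z_def[symmetric] sq unfolding args half h1 h2 exp_minus_mult_of_real rGamma_complex_of_real
      powr_of_real[OF less_imp_le[OF pos(1)]] powr_of_real[OF less_imp_le[OF pos(2)]] powr_of_real[OF less_imp_le[OF pos(3)]]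
      r2_def H1_def H2_def
    by (simp only: of_real_mult of_real_add)
  also have "exp (- p * t) * t powr ((\<nu> - 1) / 2) * r2 * v powr ((\<mu> - 1) / 2) *
      (rGamma (- \<mu> / 2) * rGamma (- \<nu> / 2) * H1 +
       rGamma ((1 - \<mu>) / 2) * rGamma ((1 - \<nu>) / 2) * (sqrt t * sqrt v / (2 * sqrt x * sqrt y)) * H2) =
    rGamma (- \<mu> / 2) * rGamma (- \<nu> / 2) * (exp (- p * t) * (t powr ((\<nu> - 1) / 2) * r2 * v powr ((\<mu> - 1) / 2) * H1)) +
    rGamma ((1 - \<mu>) / 2) * rGamma ((1 - \<nu>) / 2) / (2 * sqrt x * sqrt y) * (exp (- p * t) *
      ((t powr ((\<nu> - 1) / 2) * sqrt t) * r2 * (v powr ((\<mu> - 1) / 2) * sqrt v) * H2))"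
    by (simp add: distrib_left mult_ac)
  also have "t powr ((\<nu> - 1) / 2) * sqrt t = t powr (\<nu> / 2)"
    using pos by (simp add: powr_half_sqrt[symmetric] powr_add[symmetric] field_simps)
  also have "v powr ((\<mu> - 1) / 2) * sqrt v = v powr (\<mu> / 2)"
    using pos by (simp add: powr_half_sqrt[symmetric] powr_add[symmetric] field_simps)
  finally show ?thesis unfolding r2_def H1_def H2_def z_def v_def .
qed

lemma product_side_eq_integral_side_real:
  assumes \<mu>: "\<mu> < 0" and \<nu>: "- 1 < \<nu>" "\<nu> < 0" and x: "x > 0" and y: "y > 0" and p: "p > 0"
  shows "product_side x y (of_real \<mu>) (of_real \<nu>) (of_real p) = integral_side x y (of_real \<mu>) (of_real \<nu>) (of_real p)"
proof -
  define F where "F = (\<lambda>t. t powr ((\<nu> - \<mu>) / 2) * (x - t) powr (- (1 + \<nu>) / 2) * (y + t) powr (\<mu> / 2) *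
      hyp2f1_real (- \<mu> / 2) ((1 + \<nu>) / 2) (1 + (\<nu> - \<mu>) / 2) (t * (x - y - t) / ((x - t) * (y + t))))"
  define G1 where "G1 = (\<lambda>t. t powr (\<nu> / 2) * (t - x) powr (- (1 + \<mu> + \<nu>) / 2) * (y - x + t) powr (\<mu> / 2) *
      hyp2f1_real (- \<mu> / 2) (- \<nu> / 2) (1 / 2) (x * y / (t * (y - x + t))))"
  define G2 where "G2 = (\<lambda>t. t powr ((\<nu> - 1) / 2) * (t - x) powr (- (1 + \<mu> + \<nu>) / 2) * (y - x + t) powr ((\<mu> - 1) / 2) *
      hyp2f1_real ((1 - \<mu>) / 2) ((1 - \<nu>) / 2) (3 / 2) (x * y / (t * (y - x + t))))"
  have c0: "1 + (\<nu> - \<mu>) / 2 > 0" using \<mu> \<nu> by (simp add: field_simps)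
  have zG: "continuous_on {x<..} (\<lambda>t. hyp2f1_real a b c (x * y / (t * (y - x + t))))" if "c > 0" for a b c
    by (rule continuous_on_hyp2f1_real[OF that])
      (use x y cross_ratio_less_1(2)[OF x y] in \<open>auto intro!: continuous_intros\<close>)
  have zF: "continuous_on {0<..<x} (\<lambda>t. hyp2f1_real (- \<mu> / 2) ((1 + \<nu>) / 2) (1 + (\<nu> - \<mu>) / 2) (t * (x - y - t) / ((x - t) * (y + t))))"
    by (rule continuous_on_hyp2f1_real[OF c0])
      (use x y cross_ratio_less_1(1)[OF x y] in \<open>auto intro!: continuous_intros\<close>)
  have mF: "set_borel_measurable lborel {0<..<x} (\<lambda>t. exp (- p * t) * F t)"
    unfolding F_def using x y by (intro set_borel_measurable_lborel open_greaterThanLessThan continuous_on_mult zF) (auto intro!: continuous_intros)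
  have mG1: "set_borel_measurable lborel {x<..} (\<lambda>t. exp (- p * t) * G1 t)"
    unfolding G1_def using x y by (intro set_borel_measurable_lborel open_greaterThan continuous_on_mult zG) (auto intro!: continuous_intros)
  have mG2: "set_borel_measurable lborel {x<..} (\<lambda>t. exp (- p * t) * G2 t)"
    unfolding G2_def using x y by (intro set_borel_measurable_lborel open_greaterThan continuous_on_mult zG) (auto intro!: continuous_intros)
  have F0: "exp (- p * t) * F t \<ge> 0" if "t \<in> {0<..<x}" for t
    unfolding F_def using that \<mu> \<nu> cross_ratio_less_1(1)[OF x y, of t]
    by (intro mult_nonneg_nonneg hyp2f1_real_euler(2)) (auto simp: field_simps)
  have G10: "exp (- p * t) * G1 t \<ge> 0" if "t \<in> {x<..}" for t
    unfolding G1_def using that \<mu> \<nu> cross_ratio_less_1(2)[OF x y, of t]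
    by (intro mult_nonneg_nonneg hyp2f1_real_euler(2)) auto
  have G20: "exp (- p * t) * G2 t \<ge> 0" if "t \<in> {x<..}" for t
    unfolding G2_def using that \<mu> \<nu> cross_ratio_less_1(2)[OF x y, of t]
    by (intro mult_nonneg_nonneg hyp2f1_real_euler(2)) auto
  obtain \<phi> \<gamma>1 \<gamma>2 where *: "\<phi> \<ge> 0" "\<gamma>1 \<ge> 0" "\<gamma>2 \<ge> 0"
    "nn_int {0<..<x} (\<lambda>t. exp (- p * t) * F t) = ennreal \<phi>"
    "nn_int {x<..} (\<lambda>t. exp (- p * t) * G1 t) = ennreal \<gamma>1"
    "nn_int {x<..} (\<lambda>t. exp (- p * t) * G2 t) = ennreal \<gamma>2"
    "p powr (- 1 / 2) * exp (1 / 2 * p * (y - x)) * D_real \<mu> (sqrt (2 * y * p)) * D_real \<nu> (- sqrt (2 * x * p)) =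
      2 powr ((\<mu> - \<nu>) / 2) * sqrt pi * rGamma (1 + (\<nu> - \<mu>) / 2) * rGamma (- \<nu>) * \<phi> +
      2 powr ((\<mu> + \<nu>) / 2) * sqrt pi * (rGamma ((1 - \<mu>) / 2) * rGamma ((1 - \<nu>) / 2) * \<gamma>1 +
        2 * sqrt x * sqrt y * rGamma (- \<mu> / 2) * rGamma (- \<nu> / 2) * \<gamma>2)"
    using product_formula_positive[OF \<mu> \<nu> x y p] unfolding F_def G1_def G2_def by blast
  have iF: "(LBINT t:{0<..<x}. exp (- p * t) * F t) = \<phi>"
    using nn_int_eq_ennreal_iff[OF mF F0 *(1)] *(4) by simp
  have iG1: "set_integrable lborel {x<..} (\<lambda>t. exp (- p * t) * G1 t)" "(LBINT t:{x<..}. exp (- p * t) * G1 t) = \<gamma>1"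
    using nn_int_eq_ennreal_iff[OF mG1 G10 *(2)] *(5) by auto
  have iG2: "set_integrable lborel {x<..} (\<lambda>t. exp (- p * t) * G2 t)" "(LBINT t:{x<..}. exp (- p * t) * G2 t) = \<gamma>2"
    using nn_int_eq_ennreal_iff[OF mG2 G20 *(3)] *(6) by auto
  have f: "(LBINT t:{0<..<x}. fker x y (of_real \<mu>) (of_real \<nu>) (of_real p) t) = of_real \<phi>"
  proof -
    have "(LBINT t:{0<..<x}. fker x y (of_real \<mu>) (of_real \<nu>) (of_real p) t) =
        (LBINT t:{0<..<x}. complex_of_real (exp (- p * t) * F t))"
      by (rule set_lebesgue_integral_cong) (auto simp: fker_of_real[OF \<mu> \<nu> x y] F_def simp del: of_real_mult)
    then show ?thesis unfolding set_integral_complex_of_real iF .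
  qed
  define c1 where "c1 = rGamma (- \<mu> / 2) * rGamma (- \<nu> / 2)"
  define c2 where "c2 = rGamma ((1 - \<mu>) / 2) * rGamma ((1 - \<nu>) / 2) / (2 * sqrt x * sqrt y)"
  have g: "(LBINT t:{x<..}. gker x y (of_real \<mu>) (of_real \<nu>) (of_real p) t) = of_real (c1 * \<gamma>2 + c2 * \<gamma>1)"
  proof -
    have "(LBINT t:{x<..}. gker x y (of_real \<mu>) (of_real \<nu>) (of_real p) t) =
        (LBINT t:{x<..}. complex_of_real (c1 * (exp (- p * t) * G2 t) + c2 * (exp (- p * t) * G1 t)))"
      by (rule set_lebesgue_integral_cong)
        (auto simp: gker_of_real[OF \<mu> \<nu> x y] G1_def G2_def c1_def c2_def simp del: of_real_mult of_real_add)
    also have "\<dots> = of_real (LBINT t:{x<..}. c1 * (exp (- p * t) * G2 t) + c2 * (exp (- p * t) * G1 t))"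
      by (rule set_integral_complex_of_real)
    also have "(LBINT t:{x<..}. c1 * (exp (- p * t) * G2 t) + c2 * (exp (- p * t) * G1 t)) = c1 * \<gamma>2 + c2 * \<gamma>1"
      unfolding iG1(2)[symmetric] iG2(2)[symmetric] set_integral_mult_right[symmetric]
      by (intro set_integral_add(2) set_integrable_mult_right iG1 iG2)
    finally show ?thesis .
  qed
  have L: "product_side x y (of_real \<mu>) (of_real \<nu>) (of_real p) =
      of_real (p powr (- 1 / 2) * exp (1 / 2 * p * (y - x)) * D_real \<mu> (sqrt (2 * y * p)) * D_real \<nu> (- sqrt (2 * x * p)))"
  proof -
    have "(2 :: complex) powr (1 / 2) = of_real (sqrt 2)" using powr_half_of_real[of 2] by simp
    then have a: "(2 :: complex) powr (1 / 2) * of_real y powr (1 / 2) * of_real p powr (1 / 2) = of_real (sqrt (2 * y * p))"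
      "- ((2 :: complex) powr (1 / 2)) * of_real x powr (1 / 2) * of_real p powr (1 / 2) = of_real (- sqrt (2 * x * p))"
      using x y p by (simp_all add: powr_half_of_real real_sqrt_mult)
    have b: "complex_of_real p powr (- 1 / 2) = of_real (p powr (- 1 / 2))"
      using powr_of_real[of p "- 1 / 2"] p by simp
    have c: "exp (1 / 2 * complex_of_real p * of_real (y - x)) = of_real (exp (1 / 2 * p * (y - x)))"
      by (simp flip: exp_of_real)
    show ?thesis unfolding product_side_def a b c parabolic_cylinder_D_of_real by (simp only: of_real_mult)
  qed
  have R: "integral_side x y (of_real \<mu>) (of_real \<nu>) (of_real p) =
      of_real (2 powr ((\<mu> - \<nu>) / 2) * sqrt pi * rGamma (1 + (\<nu> - \<mu>) / 2) * rGamma (- \<nu>) * \<phi> +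
        2 powr (1 + (\<mu> + \<nu>) / 2) * sqrt pi * sqrt x * sqrt y * (c1 * \<gamma>2 + c2 * \<gamma>1))"
  proof -
    have a: "(2 :: complex) powr ((of_real \<mu> - of_real \<nu>) / 2) = of_real (2 powr ((\<mu> - \<nu>) / 2))"
      using powr_of_real[of 2 "(\<mu> - \<nu>) / 2"] by simp
    have b: "(2 :: complex) powr (1 + (of_real \<mu> + of_real \<nu>) / 2) = of_real (2 powr (1 + (\<mu> + \<nu>) / 2))"
      using powr_of_real[of 2 "1 + (\<mu> + \<nu>) / 2"] by simp
    have c: "rGamma (1 + (complex_of_real \<nu> - of_real \<mu>) / 2) = of_real (rGamma (1 + (\<nu> - \<mu>) / 2))"
      "rGamma (- complex_of_real \<nu>) = of_real (rGamma (- \<nu>))"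
      by (simp_all flip: rGamma_complex_of_real)
    show ?thesis unfolding integral_side_def f g a b c powr_half_of_real[OF less_imp_le[OF x]] powr_half_of_real[OF less_imp_le[OF y]]
      by (simp only: of_real_mult of_real_add)
  qed
  have "2 powr (1 + (\<mu> + \<nu>) / 2) * sqrt pi * sqrt x * sqrt y * (c1 * \<gamma>2 + c2 * \<gamma>1) =
      2 powr ((\<mu> + \<nu>) / 2) * sqrt pi * (2 * sqrt x * sqrt y * c2 * \<gamma>1 + 2 * sqrt x * sqrt y * c1 * \<gamma>2)"
    by (simp add: powr_add algebra_simps)
  also have "2 * sqrt x * sqrt y * c2 = rGamma ((1 - \<mu>) / 2) * rGamma ((1 - \<nu>) / 2)"
    using x y by (simp add: c2_def)
  finally have E: "2 powr (1 + (\<mu> + \<nu>) / 2) * sqrt pi * sqrt x * sqrt y * (c1 * \<gamma>2 + c2 * \<gamma>1) =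
      2 powr ((\<mu> + \<nu>) / 2) * sqrt pi * (rGamma ((1 - \<mu>) / 2) * rGamma ((1 - \<nu>) / 2) * \<gamma>1 + 2 * sqrt x * sqrt y * c1 * \<gamma>2)" .
  show ?thesis unfolding L R *(7) E unfolding c1_def by (simp only: mult.assoc)
qed

text \<open>In every step the domain of the moving variable is an intersection of half-planes, hence
  convex and connected, and it contains a real interval on which the previous step applies.\<close>

lemma product_side_eq_integral_side:
  assumes x: "x > 0" and y: "y > 0" and adm: "admissible \<mu> \<nu> p"
  shows "product_side x y \<mu> \<nu> p = integral_side x y \<mu> \<nu> p"
proof -
  have 1: "product_side x y \<mu>' (of_real n) (of_real q) = integral_side x y \<mu>' (of_real n) (of_real q)"
    if n: "- 1 < n" "n < 0" and q: "q > 0" and m: "Re \<mu>' < 1 - n" "Re \<mu>' < 2 + n" for \<mu>' and n q :: real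
  proof -
    let ?W = "{\<mu>. Re \<mu> < 1 - n} \<inter> {\<mu>. Re \<mu> < 2 + n}"
    have W: "open ?W" by (intro open_Int open_halfspace_Re_lt)
    have conn: "connected ?W" by (intro convex_connected convex_Int convex_halfspace_Re_lt)
    have adm': "admissible w (of_real n) (of_real q)" if "w \<in> ?W" for w
      using that n q by (auto simp: admissible_def)
    show ?thesis
    proof (rule holomorphic_eq_from_reals[where f = "\<lambda>w. product_side x y w (of_real n) (of_real q)" and
          g = "\<lambda>w. integral_side x y w (of_real n) (of_real q)" and S = ?W and l = "- 1" and u = 0])
      show "(\<lambda>w. product_side x y w (of_real n) (of_real q)) holomorphic_on ?W"
        by (rule holomorphic_product_side[OF W]) (use q in auto)
      show "(\<lambda>w. integral_side x y w (of_real n) (of_real q)) holomorphic_on ?W"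
        by (rule holomorphic_integral_side[OF x y W _ _ _ adm']) auto
      show "product_side x y (of_real m') (of_real n) (of_real q) = integral_side x y (of_real m') (of_real n) (of_real q)"
        if "- 1 < m'" "m' < 0" for m'
        by (rule product_side_eq_integral_side_real[OF that(2) n x y q])
    qed (use W conn n m in auto)
  qed
  have 2: "product_side x y \<mu> \<nu> (of_real q) = integral_side x y \<mu> \<nu> (of_real q)" if q: "q > 0" for q
  proof -
    let ?W = "{\<nu>. Re \<nu> < 1} \<inter> {\<nu>. Re \<nu> < 1 - Re \<mu>} \<inter> {\<nu>. Re \<nu> > Re \<mu> - 2}"
    have W: "open ?W" by (intro open_Int open_halfspace_Re_lt open_halfspace_Re_gt)
    have conn: "connected ?W" by (intro convex_connected convex_Int convex_halfspace_Re_lt convex_halfspace_Re_gt)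
    have adm': "admissible \<mu> w (of_real q)" if "w \<in> ?W" for w
      using that q by (auto simp: admissible_def)
    \<comment> \<open>Adding Re \<mu> < 1 - Re \<nu> and Re \<mu> < 2 + Re \<nu> eliminates \<nu>.
      The result is Re \<mu> - 2 < 1 - Re \<mu>, which makes the interval (l, u) inside (-1, 0)
      nonempty.\<close>
    have m: "Re \<mu> < 3 / 2" using adm by (auto simp: admissible_def)
    define l u where lu: "l = max (- 1) (Re \<mu> - 2)" "u = min 0 (1 - Re \<mu>)"
    show ?thesis
    proof (rule holomorphic_eq_from_reals[where f = "\<lambda>w. product_side x y \<mu> w (of_real q)" and
          g = "\<lambda>w. integral_side x y \<mu> w (of_real q)" and S = ?W and l = l and u = u])
      show "(\<lambda>w. product_side x y \<mu> w (of_real q)) holomorphic_on ?W"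
        by (rule holomorphic_product_side[OF W]) (use q in auto)
      show "(\<lambda>w. integral_side x y \<mu> w (of_real q)) holomorphic_on ?W"
        by (rule holomorphic_integral_side[OF x y W _ _ _ adm']) auto
      show "l < u" using m by (auto simp: lu)
      show "of_real n \<in> ?W" if "l < n" "n < u" for n using that by (auto simp: lu)
      show "product_side x y \<mu> (of_real n) (of_real q) = integral_side x y \<mu> (of_real n) (of_real q)" if "l < n" "n < u" for n
        by (rule 1) (use that q in \<open>auto simp: lu\<close>)
    qed (use W conn adm in \<open>auto simp: admissible_def\<close>)
  qed
  let ?W = "{p. Re p > 0}"
  have W: "open ?W" by (intro open_halfspace_Re_gt)
  have conn: "connected ?W" by (intro convex_connected convex_halfspace_Re_gt)
  have adm': "admissible \<mu> \<nu> w" if "w \<in> ?W" for w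
    using that adm by (auto simp: admissible_def)
  show ?thesis
  proof (rule holomorphic_eq_from_reals[where f = "\<lambda>w. product_side x y \<mu> \<nu> w" and
        g = "\<lambda>w. integral_side x y \<mu> \<nu> w" and S = ?W and l = 0 and u = 1])
    show "(\<lambda>w. product_side x y \<mu> \<nu> w) holomorphic_on ?W"
      by (rule holomorphic_product_side[OF W]) auto
    show "(\<lambda>w. integral_side x y \<mu> \<nu> w) holomorphic_on ?W"
      by (rule holomorphic_integral_side[OF x y W _ _ _ adm']) auto
    show "product_side x y \<mu> \<nu> (of_real q) = integral_side x y \<mu> \<nu> (of_real q)" if "0 < q" "q < 1" for q
      by (rule 2[OF that(1)])
  qed (use W conn adm in \<open>auto simp: admissible_def\<close>)
qed

text \<open>Integrability of both integrands belongs to the conclusion, because the Bochner integral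
  of a non-integrable function is 0 by convention and the bare equation would not express
  convergence.\<close>

theorem theorem3p4:
  fixes \<nu> \<mu> p :: complex and x y :: real
  assumes "Re \<nu> < 1"
    and "Re \<mu> < min (1 - Re \<nu>) (2 + Re \<nu>)"
    and "x > 0" and "y > 0" and "Re p > 0"
  shows
   "let f = (\<lambda>t :: real.
          exp (- p * of_real t) * of_real t powr ((\<nu> - \<mu>) / 2) *
          of_real (x - t) powr (- (1 + \<nu>) / 2) * of_real (y + t) powr (\<mu> / 2) *
          hyp2f1 (- \<mu> / 2) ((1 + \<nu>) / 2) (1 + (\<nu> - \<mu>) / 2)
            (of_real (t * (x - y - t) / ((x - t) * (y + t)))));
        g = (\<lambda>t :: real.
          exp (- p * of_real t) * of_real t powr ((\<nu> - 1) / 2) *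
          of_real (t - x) powr (- (1 + \<mu> + \<nu>) / 2) * of_real (y - x + t) powr ((\<mu> - 1) / 2) *
          (rGamma (- \<mu> / 2) * rGamma (- \<nu> / 2) *
             hyp2f1 ((1 - \<mu>) / 2) ((1 - \<nu>) / 2) (3 / 2)
               (of_real (x * y / (t * (y - x + t)))) +
           rGamma ((1 - \<mu>) / 2) * rGamma ((1 - \<nu>) / 2) *
             of_real (t * (y - x + t) / (4 * x * y)) powr (1 / 2) *
             hyp2f1 (- \<mu> / 2) (- \<nu> / 2) (1 / 2)
               (of_real (x * y / (t * (y - x + t))))))
    in set_integrable lborel {0<..<x} f \<and> set_integrable lborel {x<..} g \<and>
       p powr (- 1 / 2) * exp (1 / 2 * p * of_real (y - x)) *
         parabolic_cylinder_D \<mu> (2 powr (1 / 2) * of_real y powr (1 / 2) * p powr (1 / 2)) *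
         parabolic_cylinder_D \<nu> (- (2 powr (1 / 2)) * of_real x powr (1 / 2) * p powr (1 / 2)) =
       2 powr ((\<mu> - \<nu>) / 2) * of_real (sqrt pi) *
         rGamma (1 + (\<nu> - \<mu>) / 2) * rGamma (- \<nu>) * (LBINT t:{0<..<x}. f t) +
       2 powr (1 + (\<mu> + \<nu>) / 2) * of_real (sqrt pi) *
         of_real x powr (1 / 2) * of_real y powr (1 / 2) * (LBINT t:{x<..}. g t)"
proof -
  have adm: "admissible \<mu> \<nu> p" using assms by (simp add: admissible_def)
  have f: "set_integrable lborel {0<..<x} (fker x y \<mu> \<nu> p)"
    by (intro set_integrable_of_local_bound fker_measurable fker_local_bound adm assms(3,4))
  have g: "set_integrable lborel {x<..} (gker x y \<mu> \<nu> p)"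
    by (intro set_integrable_of_local_bound gker_measurable gker_local_bound adm assms(3,4))
  show ?thesis
    using f g product_side_eq_integral_side[OF assms(3,4) adm]
    unfolding product_side_def integral_side_def fker_def[abs_def] gker_def[abs_def] Let_def by blast
qed

end
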